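(* Let $f\colon X\to Y$ be a perfect surjection of countable functional weight between paracompact spaces. (i) Let $n,m\ge 0$ be integers. If $\dim f\leq n$ and $\dim Y\leq m$, then the set $\mathcal{H}$ of all maps $g\in C(X,\mathbb{I}^{2n+1+m})$ such that $f\times g$ is an embedding is a dense $G_{\delta}$-subset of $C(X,\mathbb{I}^{2n+1+m})$ with respect to the source limitation topology. (ii) If $Y$ is a $C$-space, then the set of all maps $g\in C(X,\mathbb{I}^{\infty})$ such that $f\times g$ is an embedding is a dense $G_{\delta}$-subset of $C(X,\mathbb{I}^{\infty})$ with respect to the source limitation topology.
   Context: All maps are continuous; paracompact spaces are assumed Hausdorff. $\mathbb{I}=[0,1]$, $\mathbb{I}^k$ is the $k$-dimensional cube with the Euclidean metric, and $\mathbb{I}^\infty$ is the Hilbert cube. $C(X,Z)$ is the set of continuous maps from $X$ to $Z$. For $f\colon X\to Y$ and $g\colon X\to Z$, $f\times g\colon X\to Y\times Z$ denotes the map $x\mapsto (f(x),g(x))$. A map is perfect if it is closed with compact fibers. The map $f\colon X\to Y$ is of countable (functional) weight if there is a map $h\colon X\to\mathbb{I}^\infty$ such that $f\times h$ embeds $X$ into $Y\times\mathbb{I}^\infty$. $\dim$ is the covering dimension, and $\dim f\le n$ means $\dim f^{-1}(y)\le n$ for every $y\in Y$. A space $Y$ is a $C$-space if for every sequence $(\omega_i)_{i\ge1}$ of open covers of $Y$ there is a sequence $(\gamma_i)_{i\geq 1}$ of families of pairwise disjoint open subsets of $Y$ such that each element of $\gamma_i$ is contained in some element of $\omega_i$ and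 $\bigcup_i\gamma_i$ covers $Y$. Source limitation topology: for a metric space $(Z,d)$, a set $U\subset C(X,Z)$ is open if for every $g\in U$ there is a continuous function $\alpha\colon X\to(0,\infty)$ with $\overline{B}(g,\alpha)\subset U$, where $\overline{B}(g,\alpha)=\{h\in C(X,Z): d(g(x),h(x))\le\alpha(x)\text{ for all }x\in X\}$. For paracompact $X$ this topology does not depend on the choice of compatible metric $d$ on $Z$. *)

theory Defs
  imports "HOL-Analysis.Analysis"
begin

section \<open>Covers, paracompactness, covering dimension, C-spaces\<close>

definition open_cover :: "'a topology \<Rightarrow> 'a set set \<Rightarrow> bool" where
  "open_cover X \<U> \<longleftrightarrow> (\<forall>U\<in>\<U>. openin X U) \<and> \<Union>\<U> = topspace X"

definition refines :: "'a set set \<Rightarrow> 'a set set \<Rightarrow> bool" where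
  "refines \<V> \<U> \<longleftrightarrow> (\<forall>V\<in>\<V>. \<exists>U\<in>\<U>. V \<subseteq> U)"

definition paracompact_space :: "'a topology \<Rightarrow> bool" where
  "paracompact_space X \<longleftrightarrow> Hausdorff_space X \<and>
     (\<forall>\<U>. open_cover X \<U> \<longrightarrow>
        (\<exists>\<V>. open_cover X \<V> \<and> refines \<V> \<U> \<and> locally_finite_in X \<V>))"

text \<open>\<open>covering_dim_le X n\<close> is \<open>dim X \<le> n\<close>: every finite open cover has a finite open
  refinement of order at most \<open>n\<close>, i.e. no point lies in more than \<open>n + 1\<close> members.\<close>

definition covering_dim_le :: "'a topology \<Rightarrow> nat \<Rightarrow> bool" where
  "covering_dim_le X n \<longleftrightarrow>
     (\<forall>\<U>. finite \<U> \<and> open_cover X \<U> \<longrightarrow>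
        (\<exists>\<V>. finite \<V> \<and> open_cover X \<V> \<and> refines \<V> \<U> \<and>
              (\<forall>x\<in>topspace X. card {V \<in> \<V>. x \<in> V} \<le> n + 1)))"

definition map_dim_le :: "'a topology \<Rightarrow> 'b topology \<Rightarrow> ('a \<Rightarrow> 'b) \<Rightarrow> nat \<Rightarrow> bool" where
  "map_dim_le X Y f n \<longleftrightarrow>
     (\<forall>y\<in>topspace Y. covering_dim_le (subtopology X {x \<in> topspace X. f x = y}) n)"

definition C_space :: "'a topology \<Rightarrow> bool" where
  "C_space Y \<longleftrightarrow>
     (\<forall>\<omega> :: nat \<Rightarrow> 'a set set. (\<forall>i. open_cover Y (\<omega> i)) \<longrightarrow>
        (\<exists>\<gamma> :: nat \<Rightarrow> 'a set set.
           (\<forall>i. (\<forall>V\<in>\<gamma> i. openin Y V) \<and> pairwise disjnt (\<gamma> i) \<and> refines (\<gamma> i) (\<omega> i)) \<and>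
           (\<Union>i. \<Union>(\<gamma> i)) = topspace Y))"


section \<open>Cubes\<close>

text \<open>Points of the \<open>k\<close>-dimensional cube are represented as in \<^const>\<open>Euclidean_space\<close>:
  sequences vanishing from index \<open>k\<close> on.\<close>

definition cube :: "nat \<Rightarrow> (nat \<Rightarrow> real) set" where
  "cube k = {x. (\<forall>i<k. x i \<in> {0..1}) \<and> (\<forall>i\<ge>k. x i = 0)}"

definition cube_metric :: "nat \<Rightarrow> (nat \<Rightarrow> real) metric" where
  "cube_metric k = metric (cube k, \<lambda>x y. L2_set (\<lambda>i. x i - y i) {..<k})"

text \<open>The library metric on \<^typ>\<open>nat \<Rightarrow> real\<close>, a weighted sum of the coordinate distances,
  induces the product topology. The choice of a compatible metric is immaterial below: over a
  paracompact domain the source limitation topology does not depend on it.\<close>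

definition hilbert_cube_metric :: "(nat \<Rightarrow> real) metric" where
  "hilbert_cube_metric = submetric euclidean_metric {x. \<forall>i. x i \<in> {0..1}}"

lemma Metric_space_cube: "Metric_space (cube k) (\<lambda>x y. L2_set (\<lambda>i. x i - y i) {..<k})"
proof
  fix x y z :: "nat \<Rightarrow> real"
  show "0 \<le> L2_set (\<lambda>i. x i - y i) {..<k}"
    by simp
  show "L2_set (\<lambda>i. x i - y i) {..<k} = L2_set (\<lambda>i. y i - x i) {..<k}"
    by (simp add: L2_set_def power2_commute)
  show "L2_set (\<lambda>i. x i - y i) {..<k} = 0 \<longleftrightarrow> x = y" if "x \<in> cube k" "y \<in> cube k"
  proof
    assume "L2_set (\<lambda>i. x i - y i) {..<k} = 0"
    then have "x i = y i" if "i < k" for i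
      using that by (simp add: L2_set_eq_0_iff)
    then show "x = y"
      using \<open>x \<in> cube k\<close> \<open>y \<in> cube k\<close> by (auto simp: cube_def fun_eq_iff) (metis not_le)
  qed (simp add: L2_set_def)
  show "L2_set (\<lambda>i. x i - z i) {..<k} \<le>
        L2_set (\<lambda>i. x i - y i) {..<k} + L2_set (\<lambda>i. y i - z i) {..<k}"
    using L2_set_triangle_ineq [of "\<lambda>i. x i - y i" "\<lambda>i. y i - z i" "{..<k}"] by simp
qed

lemma mspace_cube_metric [simp]: "mspace (cube_metric k) = cube k"
  and mdist_cube_metric [simp]:
    "mdist (cube_metric k) = (\<lambda>x y. L2_set (\<lambda>i. x i - y i) {..<k})"
  using Metric_space.mspace_metric [OF Metric_space_cube]
    Metric_space.mdist_metric [OF Metric_space_cube]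
  by (simp_all add: cube_metric_def)

lemma mtopology_of_cube_metric:
  "mtopology_of (cube_metric k) = subtopology (Euclidean_space k) (cube k)"
proof -
  let ?d = "\<lambda>x y :: nat \<Rightarrow> real. L2_set (\<lambda>i. x i - y i) {..<k}"
  interpret M: Metric_space "cube k" ?d
    by (rule Metric_space_cube)
  have top: "subtopology (Euclidean_space k) (cube k) = top_of_set (cube k)"
  proof -
    have "{x. \<forall>i\<ge>k. x i = 0} \<inter> cube k = cube k"
      by (auto simp: cube_def)
    then show ?thesis
      by (simp add: Euclidean_space_def subtopology_subtopology euclidean_product_topology)
  qed
  have "openin M.mtopology U \<longleftrightarrow> openin (top_of_set (cube k)) U" for U
  proof
    assume U: "openin M.mtopology U"
    have sub: "U \<subseteq> cube k"
      using openin_subset [OF U] by simp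
    have "\<exists>T. openin (top_of_set (cube k)) T \<and> x \<in> T \<and> T \<subseteq> U" if "x \<in> U" for x
    proof -
      obtain r where r: "r > 0" "M.mball x r \<subseteq> U"
        using U \<open>x \<in> U\<close> unfolding M.openin_mtopology by blast
      have "continuous_on UNIV (\<lambda>y. L2_set (\<lambda>i. x i - y i) {..<k})"
        unfolding L2_set_def
        by (intro continuous_intros continuous_on_product_coordinates)
      then have "open {y. L2_set (\<lambda>i. x i - y i) {..<k} < r}"
        by (intro open_Collect_less) simp_all
      then have "openin (top_of_set (cube k)) (cube k \<inter> {y. ?d x y < r})"
        by (rule openin_open_Int)
      moreover have "cube k \<inter> {y. ?d x y < r} = M.mball x r"
        using sub that by (auto simp: M.mball_def)
      moreover have "x \<in> M.mball x r"
        using M.centre_in_mball_iff sub that r(1) by blast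
      ultimately show ?thesis
        using r by metis
    qed
    then show "openin (top_of_set (cube k)) U"
      by (subst openin_subopen) blast
  next
    assume U: "openin (top_of_set (cube k)) U"
    then obtain T where T: "open T" "U = cube k \<inter> T"
      by (auto simp: openin_open)
    have "\<exists>r>0. M.mball x r \<subseteq> U" if x: "x \<in> U" for x
    proof -
      have "openin (product_topology (\<lambda>_. euclidean) UNIV) T"
        using T by (simp add: euclidean_product_topology)
      then obtain V where "x \<in> Pi\<^sub>E UNIV V \<and> (\<forall>i. openin euclidean (V i)) \<and>
          finite {i. V i \<noteq> topspace euclidean} \<and> Pi\<^sub>E UNIV V \<subseteq> T"
        using product_topology_open_contains_basis [of "\<lambda>_. euclidean" UNIV T x] T x by blast
      then have V: "x \<in> Pi\<^sub>E UNIV V" "\<And>i. open (V i)" "Pi\<^sub>E UNIV V \<subseteq> T"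
        by simp_all
      have "\<exists>e>0. \<forall>t. \<bar>x i - t\<bar> < e \<longrightarrow> t \<in> V i" for i
      proof -
        have "x i \<in> V i"
          using V(1) by auto
        then obtain e where "e > 0" "\<forall>t. dist t (x i) < e \<longrightarrow> t \<in> V i"
          using V(2) [of i] by (meson open_dist)
        then show ?thesis
          by (metis abs_minus_commute dist_real_def)
      qed
      then obtain e where e: "\<And>i. e i > 0" "\<And>i t. \<bar>x i - t\<bar> < e i \<Longrightarrow> t \<in> V i"
        by metis
      define r where "r = Min (insert 1 (e ` {..<k}))"
      have r: "r > 0" "\<And>i. i < k \<Longrightarrow> r \<le> e i"
        using e(1) by (auto simp: r_def)
      have "y \<in> U" if y: "y \<in> M.mball x r" for y
      proof -
        have ck: "x \<in> cube k" "y \<in> cube k" and d: "?d x y < r"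
          using y by auto
        have "y i \<in> V i" for i
        proof (cases "i < k")
          case True
          have "\<bar>x i - y i\<bar> \<le> ?d x y"
            using member_le_L2_set [of "{..<k}" i "\<lambda>i. \<bar>x i - y i\<bar>"] True
            by (simp add: L2_set_def)
          then show ?thesis
            using e(2) r(2) [OF True] d by force
        next
          case False
          then have "y i = x i"
            using ck by (simp add: cube_def)
          then show ?thesis
            using e by simp
        qed
        then have "y \<in> T"
          using V(3) by auto
        then show ?thesis
          using T ck by simp
      qed
      then show ?thesis
        using r by blast
    qed
    then show "openin M.mtopology U"
      using T(2) unfolding M.openin_mtopology by blast
  qed
  then have "M.mtopology = top_of_set (cube k)"
    by (simp add: topology_eq)
  then show ?thesis
    by (simp add: top cube_metric_def)
qed

lemma mtopology_of_hilbert_cube_metric: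
  "mtopology_of hilbert_cube_metric = subtopology (powertop_real UNIV) {x. \<forall>i. x i \<in> {0..1}}"
  by (simp add: hilbert_cube_metric_def mtopology_of_submetric euclidean_product_topology)


section \<open>Function spaces and the source limitation topology\<close>

text \<open>Requiring extensionality identifies maps that agree on \<^term>\<open>topspace X\<close>.\<close>

definition map_space :: "'a topology \<Rightarrow> 'b topology \<Rightarrow> ('a \<Rightarrow> 'b) set" where
  "map_space X Z = {g \<in> extensional (topspace X). continuous_map X Z g}"

definition sl_cball ::
    "'a topology \<Rightarrow> 'b metric \<Rightarrow> ('a \<Rightarrow> 'b) \<Rightarrow> ('a \<Rightarrow> real) \<Rightarrow> ('a \<Rightarrow> 'b) set" where
  "sl_cball X Z g \<alpha> =
     {h \<in> map_space X (mtopology_of Z). \<forall>x\<in>topspace X. mdist Z (g x) (h x) \<le> \<alpha> x}"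

definition sl_open :: "'a topology \<Rightarrow> 'b metric \<Rightarrow> ('a \<Rightarrow> 'b) set \<Rightarrow> bool" where
  "sl_open X Z U \<longleftrightarrow> U \<subseteq> map_space X (mtopology_of Z) \<and>
     (\<forall>g\<in>U. \<exists>\<alpha>. continuous_map X euclideanreal \<alpha> \<and> (\<forall>x\<in>topspace X. 0 < \<alpha> x) \<and>
                sl_cball X Z g \<alpha> \<subseteq> U)"

definition source_limitation_topology ::
    "'a topology \<Rightarrow> 'b metric \<Rightarrow> ('a \<Rightarrow> 'b) topology" where
  "source_limitation_topology X Z = topology (sl_open X Z)"

lemma istopology_sl_open: "istopology (sl_open X Z)"
  unfolding istopology_def
proof (intro conjI allI impI)
  fix S T assume S: "sl_open X Z S" and T: "sl_open X Z T"
  show "sl_open X Z (S \<inter> T)"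
    unfolding sl_open_def
  proof (intro conjI ballI)
    show "S \<inter> T \<subseteq> map_space X (mtopology_of Z)"
      using S by (auto simp: sl_open_def)
    fix g assume g: "g \<in> S \<inter> T"
    obtain \<alpha> where \<alpha>: "continuous_map X euclideanreal \<alpha>" "\<forall>x\<in>topspace X. 0 < \<alpha> x"
        "sl_cball X Z g \<alpha> \<subseteq> S"
      using S g unfolding sl_open_def by blast
    obtain \<beta> where \<beta>: "continuous_map X euclideanreal \<beta>" "\<forall>x\<in>topspace X. 0 < \<beta> x"
        "sl_cball X Z g \<beta> \<subseteq> T"
      using T g unfolding sl_open_def by blast
    have "continuous_map X euclideanreal (\<lambda>x. min (\<alpha> x) (\<beta> x))"
      using \<alpha> \<beta> by (intro continuous_map_real_min)
    moreover have "sl_cball X Z g (\<lambda>x. min (\<alpha> x) (\<beta> x)) \<subseteq> sl_cball X Z g \<alpha> \<inter> sl_cball X Z g \<beta>"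
      by (auto simp: sl_cball_def)
    ultimately show "\<exists>\<alpha>. continuous_map X euclideanreal \<alpha> \<and> (\<forall>x\<in>topspace X. 0 < \<alpha> x) \<and>
        sl_cball X Z g \<alpha> \<subseteq> S \<inter> T"
      using \<alpha> \<beta> by (intro exI [of _ "\<lambda>x. min (\<alpha> x) (\<beta> x)"]) auto
  qed
next
  fix \<K> assume \<K>: "\<forall>K\<in>\<K>. sl_open X Z K"
  show "sl_open X Z (\<Union>\<K>)"
    unfolding sl_open_def
  proof (intro conjI ballI)
    show "\<Union>\<K> \<subseteq> map_space X (mtopology_of Z)"
      using \<K> unfolding sl_open_def by blast
    fix g assume "g \<in> \<Union>\<K>"
    then obtain K where K: "K \<in> \<K>" "g \<in> K"
      by blast
    then obtain \<alpha> where "continuous_map X euclideanreal \<alpha>" "\<forall>x\<in>topspace X. 0 < \<alpha> x"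
        "sl_cball X Z g \<alpha> \<subseteq> K"
      using \<K> unfolding sl_open_def by blast
    then show "\<exists>\<alpha>. continuous_map X euclideanreal \<alpha> \<and> (\<forall>x\<in>topspace X. 0 < \<alpha> x) \<and>
        sl_cball X Z g \<alpha> \<subseteq> \<Union>\<K>"
      using K by blast
  qed
qed

lemma openin_source_limitation_topology [simp]:
  "openin (source_limitation_topology X Z) = sl_open X Z"
  by (simp add: source_limitation_topology_def istopology_sl_open)

lemma topspace_source_limitation_topology [simp]:
  "topspace (source_limitation_topology X Z) = map_space X (mtopology_of Z)"
proof -
  have "sl_open X Z (map_space X (mtopology_of Z))"
    by (auto simp: sl_open_def sl_cball_def intro!: exI [of _ "\<lambda>_. 1"])
  then show ?thesis
    unfolding topspace_def openin_source_limitation_topology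
    by (auto simp: sl_open_def)
qed


section \<open>Embeddings and countable functional weight\<close>

text \<open>\<open>diag_map f g\<close> is the map \<open>f \<times> g\<close> with a common domain, not the product map.\<close>

definition diag_map :: "('a \<Rightarrow> 'b) \<Rightarrow> ('a \<Rightarrow> 'c) \<Rightarrow> 'a \<Rightarrow> 'b \<times> 'c" where
  "diag_map f g = (\<lambda>x. (f x, g x))"

definition countable_functional_weight ::
    "'a topology \<Rightarrow> 'b topology \<Rightarrow> ('a \<Rightarrow> 'b) \<Rightarrow> bool" where
  "countable_functional_weight X Y f \<longleftrightarrow>
     (\<exists>h. continuous_map X (mtopology_of hilbert_cube_metric) h \<and>
          embedding_map X (prod_topology Y (mtopology_of hilbert_cube_metric)) (diag_map f h))"

definition embedding_maps ::
    "'a topology \<Rightarrow> 'b topology \<Rightarrow> 'c topology \<Rightarrow> ('a \<Rightarrow> 'b) \<Rightarrow> ('a \<Rightarrow> 'c) set" where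
  "embedding_maps X Y Z f =
     {g \<in> map_space X Z. embedding_map X (prod_topology Y Z) (diag_map f g)}"

definition dense_gdelta_in :: "'a topology \<Rightarrow> 'a set \<Rightarrow> bool" where
  "dense_gdelta_in X S \<longleftrightarrow> gdelta_in X S \<and> X closure_of S = topspace X"

end

theory Submission
  imports Defs
begin

text \<open>
  Let \<open>h\<close> be a map such that \<open>f \<times> h\<close> embeds \<open>X\<close>. Since \<open>f\<close> is perfect, \<open>f \<times> g\<close> is an embedding iff
  \<open>g\<close> separates any two points of a fibre of \<open>f\<close> that \<open>h\<close> separates, so the embeddings form the
  intersection over \<open>k\<close> of the sets of maps \<open>g\<close> for which \<open>f x = f x'\<close> and \<open>g x = g x'\<close> imply that
  \<open>h x\<close> and \<open>h x'\<close> are less than \<open>1 / (k + 1)\<close> apart. These sets are open because \<open>f\<close> is perfect.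

  For the Hilbert cube, density is direct: blend the coordinates of \<open>h\<close> into the far coordinates of
  the given map.

  For the finite-dimensional cube, the Baire property leaves the density of each of these open sets,
  which is obtained in the style of Kolmogorov and Ostrand, without general position. Put
  \<open>N = 2 * n + 1 + m\<close>. In \<open>Y\<close> there are \<open>N\<close> discrete families of small closed sets such that every
  point is missed by at most \<open>m\<close> of them, and locally over \<open>Y\<close> there are \<open>N\<close> finite disjoint families
  of small closed sets of \<open>X\<close> such that every point is missed by at most \<open>n\<close> of them. Let the \<open>i\<close>-th
  coordinate take distinct constant values on the members of the \<open>i\<close>-th family of \<open>X\<close> over each member
  of the \<open>i\<close>-th family of \<open>Y\<close>. Two points of one fibre miss at most \<open>m + n + n < N\<close> of the coordinates,
  and any other coordinate separates them unless they lie in one small set. The local families of \<open>X\<close>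
  have to change along \<open>Y\<close>; they are therefore chosen at \<open>m + 1\<close> successively finer scales, and over a
  member of a family of \<open>Y\<close> all the scales that are available there are merged, coarser sets
  absorbing the finer ones they meet.
\<close>

section \<open>Paracompact spaces\<close>

text \<open>The obstacle is that dimension is bounded on the fibres and on \<open>Y\<close>, never
  directly on \<open>X\<close>. A family built from one fibre is good only over a neighbourhood of
  its base point, and the bound n on misses can be used for x and x' together only if both are
  measured against the same local family. A coordinate, however, is glued from pieces over the
  members of \<open>\<D> i\<close>, and these straddle regions with different local families. Hence
  the auxiliary families \<open>E p\<close>, p < m + 1, in \<open>Y\<close>: by the bound m on
  misses they jointly cover \<open>Y\<close>, each member of \<open>E p\<close> carries one fixed
  local family of scale p, and a member of \<open>\<D> i\<close> meets at most one member of each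
  \<open>E p\<close>. So merging over it involves at most one local family per scale. The families
  themselves come from functions with values in [0,1], at each point of a fibre (or of
  \<open>Y\<close>) few of them positive and one equal to 1. The interval contains N disjoint bands;
  the i-th family misses a point only when some value falls into band i, and the value 1 falls into
  none.\<close>

lemma continuous_map_if_locally:
  assumes "\<And>x. x \<in> topspace X \<Longrightarrow> \<exists>T h. openin X T \<and> x \<in> T \<and> continuous_map X Y h \<and> (\<forall>z\<in>T. g z = h z)"
  shows "continuous_map X Y g"
proof -
  obtain T h where Th: "\<And>x. x \<in> topspace X \<Longrightarrow> openin X (T x) \<and> x \<in> T x \<and> continuous_map X Y (h x) \<and> (\<forall>z\<in>T x. g z = h x z)"
    using assms by metis
  show ?thesis
  proof (rule pasting_lemma[where I = "topspace X" and T = T and f = h])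
    show "openin X (T i)" if "i \<in> topspace X" for i
      using Th[OF that] by blast
    show "\<exists>j. j \<in> topspace X \<and> x \<in> T j \<and> g x = h j x" if "x \<in> topspace X" for x
      using Th[OF that] that by blast
    show "continuous_map (subtopology X (T i)) Y (h i)" if "i \<in> topspace X" for i
      using Th[OF that] by (simp add: continuous_map_from_subtopology)
    show "h i x = h j x" if "i \<in> topspace X" "j \<in> topspace X" "x \<in> topspace X \<inter> T i \<inter> T j" for i j x
      using Th[OF that(1)] Th[OF that(2)] that(3) by (metis IntE)
  qed
qed

lemma openin_finite_conditions:
  assumes "openin X T" "finite I" "\<And>i. i \<in> I \<Longrightarrow> openin X (S i)"
  shows "openin X {x \<in> T. \<forall>i\<in>I. x \<in> S i}"
proof -
  have "{x \<in> T. \<forall>i\<in>I. x \<in> S i} = T \<inter> \<Inter>(insert T (S ` I))"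
    by auto
  moreover have "openin X (\<Inter>(insert T (S ` I)))"
    using assms by (intro openin_Inter) auto
  ultimately show ?thesis
    using assms(1) by (metis openin_Int)
qed

text \<open>The common step from points to closed sets: with \<open>K\<close> a point it turns
  Hausdorff into regular, with \<open>K\<close> closed it turns regular into normal. Each chosen
  member has closure disjoint from \<open>K\<close>, and by local finiteness the closure of their
  union is the union of their closures.\<close>

lemma paracompact_separate_closed_sets:
  assumes Y: "paracompact_space Y" and C: "closedin Y C"
    and sep: "\<And>c. c \<in> C \<Longrightarrow> \<exists>U V. openin Y U \<and> openin Y V \<and> c \<in> U \<and> K \<subseteq> V \<and> disjnt U V"
    and K: "K \<subseteq> topspace Y"
  shows "\<exists>U V. openin Y U \<and> openin Y V \<and> C \<subseteq> U \<and> K \<subseteq> V \<and> disjnt U V"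
proof -
  define \<U> where "\<U> = insert (topspace Y - C) {U. openin Y U \<and> (\<exists>V. openin Y V \<and> K \<subseteq> V \<and> disjnt U V)}"
  have "open_cover Y \<U>"
    unfolding open_cover_def
  proof (intro conjI ballI subset_antisym subsetI)
    fix y assume "y \<in> topspace Y"
    then show "y \<in> \<Union>\<U>"
      using sep[of y] by (cases "y \<in> C") (auto simp: \<U>_def)
  next
    fix U assume "U \<in> \<U>"
    then show "openin Y U"
      using C by (auto simp: \<U>_def)
  next
    fix y assume "y \<in> \<Union>\<U>"
    then show "y \<in> topspace Y"
      using openin_subset by (auto simp: \<U>_def)
  qed
  then obtain \<V> where \<V>: "open_cover Y \<V>" "refines \<V> \<U>" "locally_finite_in Y \<V>"
    using Y unfolding paracompact_space_def by blast
  define \<W> where "\<W> = {V \<in> \<V>. V \<inter> C \<noteq> {}}"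
  have lf: "locally_finite_in Y \<W>"
    by (rule locally_finite_in_subset[OF \<V>(3)]) (auto simp: \<W>_def)
  have "Y closure_of W \<inter> K = {}" if W: "W \<in> \<W>" for W
  proof -
    obtain U where "U \<in> \<U>" "W \<subseteq> U"
      using W \<V>(2) by (auto simp: \<W>_def refines_def)
    then obtain V where "openin Y V" "K \<subseteq> V" "disjnt W V"
      using W by (auto simp: \<U>_def \<W>_def disjnt_iff)
    then show ?thesis
      using openin_Int_closure_of_eq_empty[of Y V W] by (auto simp: disjnt_def)
  qed
  then have "Y closure_of \<Union>\<W> \<inter> K = {}"
    unfolding closure_of_locally_finite_Union[OF lf] by blast
  moreover have "openin Y (\<Union>\<W>)"
    using \<V>(1) by (auto simp: open_cover_def \<W>_def)
  moreover have "C \<subseteq> \<Union>\<W>"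
    using \<V>(1) closedin_subset[OF C] unfolding open_cover_def \<W>_def by blast
  moreover have "\<Union>\<W> \<subseteq> Y closure_of \<Union>\<W>"
    using lf by (intro closure_of_subset) (auto simp: locally_finite_in_def)
  ultimately show ?thesis
    using K by (intro exI[of _ "\<Union>\<W>"] exI[of _ "topspace Y - Y closure_of \<Union>\<W>"]) (auto simp: disjnt_def)
qed

lemma paracompact_imp_regular_space:
  assumes Y: "paracompact_space Y"
  shows "regular_space Y"
  unfolding regular_space_def
proof clarify
  fix C a assume C: "closedin Y C" and a: "a \<in> topspace Y" "a \<notin> C"
  have "\<exists>U V. openin Y U \<and> openin Y V \<and> C \<subseteq> U \<and> {a} \<subseteq> V \<and> disjnt U V"
  proof (rule paracompact_separate_closed_sets[OF Y C])
    fix c assume "c \<in> C"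
    then have "c \<in> topspace Y" "c \<noteq> a"
      using closedin_subset[OF C] a by auto
    then show "\<exists>U V. openin Y U \<and> openin Y V \<and> c \<in> U \<and> {a} \<subseteq> V \<and> disjnt U V"
      using Y a(1) unfolding paracompact_space_def Hausdorff_space_def by simp
  qed (use a in auto)
  then show "\<exists>U V. openin Y U \<and> openin Y V \<and> a \<in> U \<and> C \<subseteq> V \<and> disjnt U V"
    by (meson disjnt_sym insert_subset)
qed

lemma paracompact_imp_normal_space:
  assumes Y: "paracompact_space Y"
  shows "normal_space Y"
  unfolding normal_space_def
proof clarify
  fix S T assume S: "closedin Y S" and T: "closedin Y T" and d: "disjnt S T"
  show "\<exists>U V. openin Y U \<and> openin Y V \<and> S \<subseteq> U \<and> T \<subseteq> V \<and> disjnt U V"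
  proof (rule paracompact_separate_closed_sets[OF Y S])
    fix c assume "c \<in> S"
    then have "c \<in> topspace Y - T"
      using d closedin_subset[OF S] by (auto simp: disjnt_iff)
    then show "\<exists>U V. openin Y U \<and> openin Y V \<and> c \<in> U \<and> T \<subseteq> V \<and> disjnt U V"
      using paracompact_imp_regular_space[OF Y] T unfolding regular_space_def by blast
  qed (rule closedin_subset[OF T])
qed

section \<open>Closed shrinkings, Urysohn functions and continuous insertion\<close>

lemma paracompact_closure_refinement:
  assumes Y: "paracompact_space Y" and \<U>: "open_cover Y \<U>"
  obtains \<V> where "open_cover Y \<V>" "locally_finite_in Y \<V>"
    "\<And>V. V \<in> \<V> \<Longrightarrow> \<exists>U\<in>\<U>. Y closure_of V \<subseteq> U"
proof -
  define \<T> where "\<T> = {T. openin Y T \<and> (\<exists>U\<in>\<U>. Y closure_of T \<subseteq> U)}"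
  have "open_cover Y \<T>"
    unfolding open_cover_def
  proof (intro conjI ballI subset_antisym subsetI)
    fix y assume y: "y \<in> topspace Y"
    then obtain U where U: "U \<in> \<U>" "y \<in> U"
      using \<U> by (auto simp: open_cover_def)
    then obtain T C where "openin Y T" "closedin Y C" "y \<in> T" "T \<subseteq> C" "C \<subseteq> U"
      using paracompact_imp_regular_space[OF Y] \<U>
      unfolding neighbourhood_base_of_closedin[symmetric] neighbourhood_base_of open_cover_def
      by meson
    then show "y \<in> \<Union>\<T>"
      using U by (auto simp: \<T>_def intro!: exI[of _ T] bexI[of _ U]) (meson closure_of_minimal subsetD)
  next
    fix y assume "y \<in> \<Union>\<T>"
    then show "y \<in> topspace Y"
      using openin_subset by (auto simp: \<T>_def)
  qed (simp add: \<T>_def)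
  then obtain \<V> where \<V>: "open_cover Y \<V>" "refines \<V> \<T>" "locally_finite_in Y \<V>"
    using Y unfolding paracompact_space_def by blast
  have "\<exists>U\<in>\<U>. Y closure_of V \<subseteq> U" if V: "V \<in> \<V>" for V
  proof -
    obtain T where "T \<in> \<T>" "V \<subseteq> T"
      using \<V>(2) V by (auto simp: refines_def)
    then obtain U where "U \<in> \<U>" "Y closure_of T \<subseteq> U"
      by (auto simp: \<T>_def)
    then show ?thesis
      using closure_of_mono[OF \<open>V \<subseteq> T\<close>] by blast
  qed
  then show ?thesis
    using \<V> that by blast
qed

text \<open>A substitute for a partition of unity, normalised by the maximum in place of the sum: at
  every point some function attains 1. The counting of bands relies on this value, which lies above
  all bands.\<close>

lemma paracompact_Urysohn_family:
  fixes Y :: "'b topology"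
  assumes Y: "paracompact_space Y"
    and op: "\<And>i. i \<in> I \<Longrightarrow> openin Y (U i)" and cov: "topspace Y \<subseteq> (\<Union>i\<in>I. U i)"
  shows "\<exists>u :: 'i \<Rightarrow> 'b \<Rightarrow> real. (\<forall>i\<in>I. continuous_map Y euclideanreal (u i)) \<and>
    (\<forall>i\<in>I. \<forall>y\<in>topspace Y. u i y \<in> {0..1}) \<and>
    (\<forall>i\<in>I. \<forall>y\<in>topspace Y. y \<notin> U i \<longrightarrow> u i y = 0) \<and>
    (\<forall>y\<in>topspace Y. \<exists>i\<in>I. y \<in> U i \<and> u i y = 1)"
proof -
  have "open_cover Y (U ` I)"
    using op cov openin_subset by (fastforce simp: open_cover_def)
  then obtain \<V> where \<V>: "open_cover Y \<V>" "locally_finite_in Y \<V>"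
    and "\<And>V. V \<in> \<V> \<Longrightarrow> \<exists>i\<in>I. Y closure_of V \<subseteq> U i"
    using paracompact_closure_refinement[OF Y] by (smt (verit) image_iff)
  then obtain j where j: "\<And>V. V \<in> \<V> \<Longrightarrow> j V \<in> I \<and> Y closure_of V \<subseteq> U (j V)"
    by metis
  \<comment> \<open>Grouping the closures by a chosen index gives a closed shrinking of the cover;
    local finiteness keeps every \<open>C i\<close> closed although the grouping may be
    infinite.\<close>
  define C where "C i = (\<Union>V\<in>{V\<in>\<V>. j V = i}. Y closure_of V)" for i
  have clC: "closedin Y (C i)" for i
    unfolding C_def
    by (intro closedin_Union_locally_finite_closure locally_finite_in_subset[OF \<V>(2)]) auto
  have CU: "C i \<subseteq> U i" if "i \<in> I" for i
    using j by (force simp: C_def)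
  have "\<forall>i\<in>I. \<exists>g. continuous_map Y (top_of_set {0..1::real}) g \<and>
      g ` (topspace Y - U i) \<subseteq> {0} \<and> g ` C i \<subseteq> {1}"
  proof
    fix i assume that: "i \<in> I"
    show "\<exists>g. continuous_map Y (top_of_set {0..1::real}) g \<and>
      g ` (topspace Y - U i) \<subseteq> {0} \<and> g ` C i \<subseteq> {1}"
    using paracompact_imp_normal_space[OF Y, unfolded normal_space_iff_Urysohn, rule_format,
        of "topspace Y - U i" "C i"] clC[of i] CU[OF that] op[OF that]
    by (fastforce simp: disjnt_iff openin_closedin_eq)
  qed
  then obtain u where "\<forall>i\<in>I. continuous_map Y (top_of_set {0..1::real}) (u i)
      \<and> u i ` (topspace Y - U i) \<subseteq> {0} \<and> u i ` C i \<subseteq> {1}"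
    by (rule bchoice[THEN exE])
  then have u: "continuous_map Y euclideanreal (u i)" "\<And>y. y \<in> topspace Y \<Longrightarrow> u i y \<in> {0..1}"
      "\<And>y. y \<in> topspace Y \<Longrightarrow> y \<notin> U i \<Longrightarrow> u i y = 0" "\<And>y. y \<in> C i \<Longrightarrow> u i y = 1" if "i \<in> I" for i
    using that by (auto simp: continuous_map_in_subtopology image_subset_iff Pi_iff)
  show ?thesis
  proof (intro exI[of _ u] conjI ballI impI)
    fix y assume y: "y \<in> topspace Y"
    then obtain V where "V \<in> \<V>" "y \<in> V"
      using \<V>(1) by (auto simp: open_cover_def)
    moreover have "V \<subseteq> topspace Y"
      using \<V>(1) \<open>V \<in> \<V>\<close> by (auto simp: open_cover_def)
    ultimately have yV: "y \<in> Y closure_of V"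
      using closure_of_subset by blast
    have jV: "j V \<in> I"
      using j[OF \<open>V \<in> \<V>\<close>] by blast
    have "y \<in> C (j V)"
      unfolding C_def using yV \<open>V \<in> \<V>\<close> by blast
    then have "y \<in> U (j V) \<and> u (j V) y = 1"
      using u(4)[OF jV] CU[OF jV] by blast
    with jV show "\<exists>i\<in>I. y \<in> U i \<and> u i y = 1"
      by blast
  qed (rule u; assumption)+
qed

text \<open>\<open>\<phi>\<close> is the pointwise maximum of Urysohn functions weighted by
  \<open>\<eta>\<close>: the member attaining the maximum gives the upper bound, a member with value
  1 the lower one. As a radius, \<open>\<phi>\<close> is small by the upper bound and positive by
  the lower one; as an exhaustion function for a countable cover it is large by the lower
  one.\<close>

lemma paracompact_insertion:
  fixes \<eta> :: "'i \<Rightarrow> real" and Y :: "'b topology"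
  assumes Y: "paracompact_space Y"
    and op: "\<And>i. i \<in> I \<Longrightarrow> openin Y (U i)" and cov: "topspace Y \<subseteq> (\<Union>i\<in>I. U i)"
    and pos: "\<And>i. i \<in> I \<Longrightarrow> 0 < \<eta> i"
  shows "\<exists>\<phi>. continuous_map Y euclideanreal \<phi> \<and>
    (\<forall>y\<in>topspace Y. \<exists>i\<in>I. y \<in> U i \<and> \<phi> y \<le> \<eta> i) \<and>
    (\<forall>y\<in>topspace Y. \<exists>i\<in>I. y \<in> U i \<and> \<eta> i \<le> \<phi> y)"
proof -
  have "open_cover Y (U ` I)"
    using op cov openin_subset by (fastforce simp: open_cover_def)
  then obtain \<V> where \<V>: "open_cover Y \<V>" "refines \<V> (U ` I)" "locally_finite_in Y \<V>"
    using Y unfolding paracompact_space_def by blast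
  then have "\<forall>V\<in>\<V>. \<exists>i. i \<in> I \<and> V \<subseteq> U i"
    by (auto simp: refines_def)
  then obtain j where j: "\<And>V. V \<in> \<V> \<Longrightarrow> j V \<in> I \<and> V \<subseteq> U (j V)"
    by metis
  obtain u :: "'b set \<Rightarrow> 'b \<Rightarrow> real" where u:
    "\<And>i. i \<in> \<V> \<Longrightarrow> continuous_map Y euclideanreal (u i)"
    "\<And>i y. i \<in> \<V> \<Longrightarrow> y \<in> topspace Y \<Longrightarrow> u i y \<in> {0..1}"
    "\<And>i y. i \<in> \<V> \<Longrightarrow> y \<in> topspace Y \<Longrightarrow> y \<notin> i \<Longrightarrow> u i y = 0"
    "\<And>y. y \<in> topspace Y \<Longrightarrow> \<exists>i\<in>\<V>. y \<in> i \<and> u i y = 1"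
    using paracompact_Urysohn_family[OF Y, of \<V> "\<lambda>V. V"] \<V>(1) unfolding open_cover_def by fastforce
  define g where "g V y = \<eta> (j V) * u V y" for V y
  define \<phi> where "\<phi> y = Max ((\<lambda>V. g V y) ` {V\<in>\<V>. y \<in> V})" for y
  have fin: "finite {V\<in>\<V>. y \<in> V}" if "y \<in> topspace Y" for y
  proof -
    obtain T where "y \<in> T" "finite {V \<in> \<V>. V \<inter> T \<noteq> {}}"
      using \<V>(3) \<open>y \<in> topspace Y\<close> unfolding locally_finite_in_def by blast
    then show ?thesis
      by (elim finite_subset[rotated]) auto
  qed
  have g0: "0 \<le> g V y" if "V \<in> \<V>" "y \<in> topspace Y" for V y
    using u(2)[OF that] pos[of "j V"] j[OF that(1)] by (simp add: g_def)
  note ne = u(4)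
  show ?thesis
  proof (intro exI[of _ \<phi>] conjI ballI)
    show "continuous_map Y euclideanreal \<phi>"
    proof (rule continuous_map_if_locally)
      fix y assume y: "y \<in> topspace Y"
      obtain T where T: "openin Y T" "y \<in> T" "finite {V \<in> \<V>. V \<inter> T \<noteq> {}}"
        using \<V>(3) y unfolding locally_finite_in_def by blast
      let ?S = "{V \<in> \<V>. V \<inter> T \<noteq> {}}"
      \<comment> \<open>Near \<open>y\<close> the index set of the maximum can be frozen to the
        finitely many members meeting \<open>T\<close>: the added members contribute 0, which never
        exceeds the maximum.\<close>
      have "continuous_map Y euclideanreal (\<lambda>z. SUP V\<in>?S. g V z)"
        unfolding g_def by (intro continuous_map_Sup T continuous_intros u) auto
      moreover have "\<phi> z = (SUP V\<in>?S. g V z)" if z: "z \<in> T" for z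
      proof -
        have zY: "z \<in> topspace Y"
          using z T(1) openin_subset by blast
        obtain V0 where V0: "V0 \<in> \<V>" "z \<in> V0"
          using ne[OF zY] by blast
        have "(SUP V\<in>?S. g V z) = Max ((\<lambda>V. g V z) ` ?S)"
          using T(3) V0 z by (intro cSup_eq_Max) auto
        also have "\<dots> = \<phi> z"
          unfolding \<phi>_def
        proof (rule antisym)
          show "Max ((\<lambda>V. g V z) ` ?S) \<le> Max ((\<lambda>V. g V z) ` {V\<in>\<V>. z \<in> V})"
          proof (subst Max_le_iff)
            show "\<forall>a\<in>(\<lambda>V. g V z) ` ?S. a \<le> Max ((\<lambda>V. g V z) ` {V\<in>\<V>. z \<in> V})"
            proof clarify
              fix V assume V: "V \<in> \<V>"
              show "g V z \<le> Max ((\<lambda>V. g V z) ` {V\<in>\<V>. z \<in> V})"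
              proof (cases "z \<in> V")
                case False
                then have "g V z \<le> g V0 z"
                  using u(3)[OF V zY] g0[OF V0(1) zY] by (simp add: g_def)
                also have "\<dots> \<le> Max ((\<lambda>V. g V z) ` {V\<in>\<V>. z \<in> V})"
                  using V0 fin[OF zY] by (intro Max_ge) auto
                finally show ?thesis .
              qed (use V fin[OF zY] in \<open>auto intro!: Max_ge\<close>)
            qed
          qed (use T(3) V0 z in auto)
          show "Max ((\<lambda>V. g V z) ` {V\<in>\<V>. z \<in> V}) \<le> Max ((\<lambda>V. g V z) ` ?S)"
            using T(3) V0 z by (intro Max_mono) auto
        qed
        finally show ?thesis by simp
      qed
      ultimately show "\<exists>T h. openin Y T \<and> y \<in> T \<and> continuous_map Y euclideanreal h \<and> (\<forall>z\<in>T. \<phi> z = h z)"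
        using T by blast
    qed
    fix y assume y: "y \<in> topspace Y"
    have "\<phi> y \<in> (\<lambda>V. g V y) ` {V\<in>\<V>. y \<in> V}"
      unfolding \<phi>_def using fin[OF y] ne[OF y] by (intro Max_in) auto
    then obtain V where V: "V \<in> \<V>" "y \<in> V" "\<phi> y = g V y"
      by auto
    have "g V y \<le> \<eta> (j V)"
      using u(2)[OF V(1) y] pos j[OF V(1)] by (auto simp: g_def mult_left_le less_imp_le)
    then show "\<exists>i\<in>I. y \<in> U i \<and> \<phi> y \<le> \<eta> i"
      using V j by (metis subsetD)
    obtain V where V: "V \<in> \<V>" "y \<in> V" "u V y = 1"
      using ne[OF y] by auto
    then have "\<eta> (j V) \<le> \<phi> y"
      unfolding \<phi>_def using fin[OF y] by (intro Max_ge) (auto simp: g_def image_iff intro!: exI[of _ V])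
    then show "\<exists>i\<in>I. y \<in> U i \<and> \<eta> i \<le> \<phi> y"
      using V j by (metis subsetD)
  qed
qed


section \<open>Fibrewise separating maps and the Baire property\<close>

definition fibre_small_maps ::
  "'a topology \<Rightarrow> 'c topology \<Rightarrow> 'd metric \<Rightarrow> ('a \<Rightarrow> 'b) \<Rightarrow> ('a \<Rightarrow> 'd) \<Rightarrow> real \<Rightarrow> ('a \<Rightarrow> 'c) set" where
  "fibre_small_maps X Z M f h r = {g \<in> map_space X Z.
     \<forall>x\<in>topspace X. \<forall>x'\<in>topspace X. f x = f x' \<and> g x = g x' \<longrightarrow> mdist M (h x) (h x') < r}"

section \<open>Openness of the sets of fibrewise separating maps\<close>

lemma continuous_map_mdist_pair:
  assumes "continuous_map X (mtopology_of M) h"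
  shows "continuous_map (prod_topology X X) euclideanreal (\<lambda>p. mdist M (h (fst p)) (h (snd p)))"
proof -
  have "continuous_map (prod_topology X X) (prod_topology (mtopology_of M) (mtopology_of M))
      (\<lambda>p. (h (fst p), h (snd p)))"
    using continuous_map_compose[OF continuous_map_fst assms] continuous_map_compose[OF continuous_map_snd assms]
    by (intro continuous_map_pairedI) (auto simp: o_def)
  from continuous_map_compose[OF this continuous_map_metric] show ?thesis
    by (simp add: o_def)
qed

text \<open>Compactness makes the separation uniform. The product of \<open>f\<close> with itself is
  proper, so the pairs over \<open>(y,y)\<close> form a compact set, covered by the increasing open
  sets \<open>O' n\<close>; hence one n works there, and closedness of the product map spreads it to
  all pairs over a neighbourhood of \<open>(y,y)\<close>.\<close>

lemma perfect_map_fibre_separation: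
  assumes f: "perfect_map X Y f" and h: "continuous_map X (mtopology_of M) h"
    and g: "continuous_map X (mtopology_of Z) g" and gS: "g \<in> fibre_small_maps X (mtopology_of Z) M f h r"
    and y: "y \<in> topspace Y"
  shows "\<exists>\<eta>>0. \<exists>V. openin Y V \<and> y \<in> V \<and> (\<forall>x\<in>topspace X. \<forall>x'\<in>topspace X.
      f x \<in> V \<and> f x = f x' \<and> r \<le> mdist M (h x) (h x') \<longrightarrow> \<eta> < mdist Z (g x) (g x'))"
proof -
  let ?XX = "prod_topology X X" and ?YY = "prod_topology Y Y" and ?F = "\<lambda>(x,x'). (f x, f x')"
  \<comment> \<open>A pair is harmless if \<open>h\<close> brings it closer than \<open>r\<close>,
    or if \<open>g\<close> separates it by a definite amount. On pairs of the fibre over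
    \<open>y\<close> membership of \<open>g\<close> leaves no third case once n is large.\<close>
  define O' where "O' n = {p \<in> topspace ?XX. mdist M (h (fst p)) (h (snd p)) < r} \<union>
      {p \<in> topspace ?XX. 1 / Suc n < mdist Z (g (fst p)) (g (snd p))}" for n :: nat
  have opO: "openin ?XX (O' n)" for n
  proof -
    have "openin ?XX {p \<in> topspace ?XX. mdist M (h (fst p)) (h (snd p)) \<in> {..<r}}"
      by (rule openin_continuous_map_preimage[OF continuous_map_mdist_pair[OF h]]) auto
    moreover have "openin ?XX {p \<in> topspace ?XX. mdist Z (g (fst p)) (g (snd p)) \<in> {1 / Suc n<..}}"
      by (rule openin_continuous_map_preimage[OF continuous_map_mdist_pair[OF g]]) auto
    ultimately show ?thesis
      unfolding O'_def by (intro openin_Un) auto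
  qed
  have FF: "proper_map ?XX ?YY ?F"
    using f by (simp add: proper_map_prod perfect_map_def)
  let ?K = "{p \<in> topspace ?XX. ?F p = (y,y)}"
  have "compactin ?XX ?K"
    using FF y by (simp add: proper_map_def)
  moreover have "?K \<subseteq> \<Union>(range O')"
  proof
    fix p assume "p \<in> ?K"
    then obtain x x' where p: "p = (x, x')" and x: "(x, x') \<in> topspace ?XX" "f x = y" "f x' = y"
      by auto
    show "p \<in> \<Union>(range O')"
    proof (cases "mdist M (h x) (h x') < r")
      case False
      have xs: "x \<in> topspace X" "x' \<in> topspace X"
        using x by auto
      then have "g x \<noteq> g x'"
        using False gS x unfolding fibre_small_maps_def by fastforce
      moreover have "g x \<in> mspace Z" "g x' \<in> mspace Z"
        using g xs continuous_map_image_subset_topspace[OF g] by auto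
      ultimately have "0 < mdist Z (g x) (g x')"
        by (metis mdist_nonneg mdist_zero order_le_less)
      then obtain n where "1 / Suc n < mdist Z (g x) (g x')"
        by (metis nat_approx_posE)
      then show ?thesis
        using x p by (auto simp: O'_def)
    qed (use x p in \<open>auto simp: O'_def\<close>)
  qed
  ultimately obtain \<F> where \<F>: "finite \<F>" "\<F> \<subseteq> range O'" "?K \<subseteq> \<Union>\<F>"
    using compactinD[of ?XX ?K "range O'"] opO by blast
  then obtain I where I: "finite I" "\<F> = O' ` I"
    using finite_subset_image by metis
  define n where "n = Max (insert 0 I)"
  have mono: "O' i \<subseteq> O' n" if "i \<in> I" for i
  proof -
    have "i \<le> n"
      unfolding n_def using I(1) that by (intro Max_ge) auto
    then have "1 / real (Suc n) \<le> 1 / real (Suc i)"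
      by (simp add: frac_le)
    then show ?thesis
      by (auto simp: O'_def)
  qed
  then have "?K \<subseteq> O' n"
    using \<F>(3) I(2) by blast
  then obtain W where W: "openin ?YY W" "(y,y) \<in> W" "{p \<in> topspace ?XX. ?F p \<in> W} \<subseteq> O' n"
    using proper_imp_closed_map[OF FF, unfolded closed_map_fibre_neighbourhood, THEN conjunct2, rule_format,
        of "O' n" "(y,y)"] opO y by force
  then have "\<exists>U V. openin Y U \<and> openin Y V \<and> y \<in> U \<and> y \<in> V \<and> U \<times> V \<subseteq> W"
    by (simp add: openin_prod_topology_alt)
  then obtain V1 V2 where V: "openin Y V1" "openin Y V2" "y \<in> V1" "y \<in> V2" "V1 \<times> V2 \<subseteq> W"
    by blast
  show ?thesis
  proof (intro exI conjI ballI impI)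
    show "openin Y (V1 \<inter> V2)" "y \<in> V1 \<inter> V2" "(0::real) < 1 / Suc n"
      using V by auto
    fix x x' assume x: "x \<in> topspace X" "x' \<in> topspace X"
      "f x \<in> V1 \<inter> V2 \<and> f x = f x' \<and> r \<le> mdist M (h x) (h x')"
    then have "(x,x') \<in> {p \<in> topspace ?XX. ?F p \<in> W}"
      using V(5) by auto
    then have "(x,x') \<in> O' n"
      using W(3) by blast
    then show "1 / Suc n < mdist Z (g x) (g x')"
      using x by (auto simp: O'_def)
  qed
qed

text \<open>The local separation constants are glued on \<open>Y\<close>, and the radius is taken of
  the form \<open>\<phi> \<circ> f\<close>, so that it agrees at two points of a fibre. The factor
  1/2 is there because both points are moved.\<close>

lemma fibre_small_maps_open:
  assumes Y: "paracompact_space Y" and f: "perfect_map X Y f"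
    and h: "continuous_map X (mtopology_of M) h"
    and gS: "g \<in> fibre_small_maps X (mtopology_of Z) M f h r"
  shows "\<exists>\<alpha>. continuous_map X euclideanreal \<alpha> \<and> (\<forall>x\<in>topspace X. 0 < \<alpha> x) \<and>
           sl_cball X Z g \<alpha> \<subseteq> fibre_small_maps X (mtopology_of Z) M f h r"
proof -
  have g: "continuous_map X (mtopology_of Z) g"
    using gS by (simp add: fibre_small_maps_def map_space_def)
  have gim: "g x \<in> mspace Z" if "x \<in> topspace X" for x
    using continuous_map_image_subset_topspace[OF g] that by auto
  obtain \<eta> V where \<eta>: "\<And>y. y \<in> topspace Y \<Longrightarrow> \<eta> y > 0"
    and V: "\<And>y. y \<in> topspace Y \<Longrightarrow> openin Y (V y) \<and> y \<in> V y"
    and sep: "\<And>y x x'. \<lbrakk>y \<in> topspace Y; x \<in> topspace X; x' \<in> topspace X; f x \<in> V y; f x = f x';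
         r \<le> mdist M (h x) (h x')\<rbrakk> \<Longrightarrow> \<eta> y < mdist Z (g x) (g x')"
    using perfect_map_fibre_separation[OF f h g gS] by metis
  have Vop: "\<And>i. i \<in> topspace Y \<Longrightarrow> openin Y (V i)" and Vcov: "topspace Y \<subseteq> (\<Union>i\<in>topspace Y. V i)"
    using V by blast+
  have eta2: "\<And>i. i \<in> topspace Y \<Longrightarrow> 0 < \<eta> i / 2"
    using \<eta> by simp
  obtain \<phi> where \<phi>: "continuous_map Y euclideanreal \<phi>"
    "\<And>y. y \<in> topspace Y \<Longrightarrow> \<exists>i\<in>topspace Y. y \<in> V i \<and> \<phi> y \<le> \<eta> i / 2"
    "\<And>y. y \<in> topspace Y \<Longrightarrow> \<exists>i\<in>topspace Y. y \<in> V i \<and> \<eta> i / 2 \<le> \<phi> y"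
    using paracompact_insertion[where \<eta> = "\<lambda>y. \<eta> y / 2", OF Y Vop Vcov eta2] by blast
  have fY: "f x \<in> topspace Y" if "x \<in> topspace X" for x
    using f that perfect_imp_continuous_map continuous_map_image_subset_topspace by blast
  have "sl_cball X Z g (\<phi> \<circ> f) \<subseteq> fibre_small_maps X (mtopology_of Z) M f h r"
  proof
    fix g' assume g': "g' \<in> sl_cball X Z g (\<phi> \<circ> f)"
    have g'im: "g' x \<in> mspace Z" if "x \<in> topspace X" for x
      using g' that continuous_map_image_subset_topspace[of X "mtopology_of Z" g']
      by (auto simp: sl_cball_def map_space_def)
    have "mdist M (h x) (h x') < r"
      if x: "x \<in> topspace X" "x' \<in> topspace X" "f x = f x'" "g' x = g' x'" for x x'
    proof (rule ccontr)
      assume "\<not> mdist M (h x) (h x') < r"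
      moreover obtain i where i: "i \<in> topspace Y" "f x \<in> V i" "\<phi> (f x) \<le> \<eta> i / 2"
        using \<phi>(2) fY x by blast
      ultimately have "\<eta> i < mdist Z (g x) (g x')"
        using sep x by force
      also have "\<dots> \<le> mdist Z (g x) (g' x) + mdist Z (g' x) (g x')"
        using x by (intro mdist_triangle gim g'im)
      also have "\<dots> \<le> \<phi> (f x) + \<phi> (f x)"
        using g' x mdist_commute[of Z "g x'" "g' x'"] unfolding sl_cball_def
        by (intro add_mono) auto
      finally show False
        using i by simp
    qed
    then show "g' \<in> fibre_small_maps X (mtopology_of Z) M f h r"
      using g' by (simp add: fibre_small_maps_def sl_cball_def)
  qed
  moreover have "continuous_map X euclideanreal (\<phi> \<circ> f)"
    using f perfect_imp_continuous_map \<phi>(1) continuous_map_compose by blast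
  moreover have "0 < (\<phi> \<circ> f) x" if "x \<in> topspace X" for x
    using \<phi>(3)[OF fY[OF that]] \<eta> by (fastforce intro: less_le_trans)
  ultimately show ?thesis
    by blast
qed

text \<open>Pairing a proper map with a continuous map into a Hausdorff space is again proper, hence
  closed; so only injectivity is at stake, and that is tested through the injective pairing of
  \<open>f\<close> with \<open>h\<close>.\<close>

lemma embedding_maps_eq_fibre_small_maps:
  assumes Y: "Hausdorff_space Y" and f: "perfect_map X Y f"
    and h: "continuous_map X (mtopology_of M) h"
    and emb: "embedding_map X (prod_topology Y (mtopology_of M)) (diag_map f h)"
    and Z: "Hausdorff_space Z"
  shows "embedding_maps X Y Z f = (\<Inter>k. fibre_small_maps X Z M f h (1 / Suc k))"
proof (intro subset_antisym subsetI)
  have him: "h x \<in> mspace M" if "x \<in> topspace X" for x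
    using continuous_map_image_subset_topspace[OF h] that by auto
  fix g assume g: "g \<in> embedding_maps X Y Z f"
  then have "inj_on (diag_map f g) (topspace X)"
    unfolding embedding_maps_def embedding_map_def by (auto dest: homeomorphic_imp_injective_map)
  then have "mdist M (h x) (h x') = 0" if "x \<in> topspace X" "x' \<in> topspace X" "f x = f x'" "g x = g x'" for x x'
    using that him by (auto simp: diag_map_def inj_on_def)
  then show "g \<in> (\<Inter>k. fibre_small_maps X Z M f h (1 / Suc k))"
    using g by (simp add: fibre_small_maps_def embedding_maps_def)
next
  have him: "h x \<in> mspace M" if "x \<in> topspace X" for x
    using continuous_map_image_subset_topspace[OF h] that by auto
  fix g assume g: "g \<in> (\<Inter>k. fibre_small_maps X Z M f h (1 / Suc k))"
  then have gm: "g \<in> map_space X Z"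
    by (auto simp: fibre_small_maps_def)
  then have gc: "continuous_map X Z g"
    by (simp add: map_space_def)
  have injh: "inj_on (diag_map f h) (topspace X)"
    using emb unfolding embedding_map_def by (auto dest: homeomorphic_imp_injective_map)
  have "inj_on (diag_map f g) (topspace X)"
  proof (rule inj_onI)
    fix x x' assume x: "x \<in> topspace X" "x' \<in> topspace X" "diag_map f g x = diag_map f g x'"
    have "mdist M (h x) (h x') < 1 / Suc k" for k
      using g x by (force simp: fibre_small_maps_def diag_map_def)
    then have "\<not> 0 < mdist M (h x) (h x')"
      by (meson less_asym nat_approx_posE)
    then have "h x = h x'"
      using him x by (metis mdist_nonneg mdist_zero order_le_less)
    then show "x = x'"
      using injh x by (auto simp: diag_map_def inj_on_def)
  qed
  moreover have "closed_map X (prod_topology Y Z) (diag_map f g)"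
    unfolding diag_map_def using f Z gc
    by (intro proper_imp_closed_map proper_map_paired) (auto simp: perfect_map_def)
  moreover have "continuous_map X (prod_topology Y Z) (diag_map f g)"
    unfolding diag_map_def using f gc by (simp add: continuous_map_pairedI perfect_map_def)
  ultimately show "g \<in> embedding_maps X Y Z f"
    using gm by (simp add: embedding_maps_def injective_closed_imp_embedding_map)
qed

text \<open>The usual nested balls, with functions as radii. Bounding the k-th radius by (1/2)^k
  makes the centres uniformly Cauchy, so the limit is continuous; pointwise it stays in every closed
  ball, hence in every \<open>S k\<close>.\<close>

lemma source_limitation_Baire:
  fixes Z :: "'c metric" and S :: "nat \<Rightarrow> ('a \<Rightarrow> 'c) set"
  assumes Z: "mcomplete_of Z"
    and op: "\<And>k g. g \<in> S k \<Longrightarrow> \<exists>\<alpha>. continuous_map X euclideanreal \<alpha> \<and> (\<forall>x\<in>topspace X. 0 < \<alpha> x) \<and>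
           sl_cball X Z g \<alpha> \<subseteq> S k"
    and dense: "\<And>k g \<alpha>. \<lbrakk>g \<in> map_space X (mtopology_of Z); continuous_map X euclideanreal \<alpha>;
        \<forall>x\<in>topspace X. 0 < \<alpha> x\<rbrakk> \<Longrightarrow> S k \<inter> sl_cball X Z g \<alpha> \<noteq> {}"
    and g: "g \<in> map_space X (mtopology_of Z)" and \<alpha>: "continuous_map X euclideanreal \<alpha>"
      "\<forall>x\<in>topspace X. 0 < \<alpha> x"
  shows "(\<Inter>k. S k) \<inter> sl_cball X Z g \<alpha> \<noteq> {}"
proof -
  interpret M: Metric_space "mspace Z" "mdist Z"
    by simp
  define C where "C p \<longleftrightarrow> fst p \<in> map_space X (mtopology_of Z) \<and> continuous_map X euclideanreal (snd p) \<and>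
     (\<forall>x\<in>topspace X. 0 < snd p x)" for p :: "('a \<Rightarrow> 'c) \<times> ('a \<Rightarrow> real)"
  define P where "P k p \<longleftrightarrow> C p \<and> (\<forall>x\<in>topspace X. snd p x \<le> (1/2)^k) \<and> sl_cball X Z (fst p) (snd p) \<subseteq> S k"
    for k p
  \<comment> \<open>Moving the centre by at most half the radius and halving the radius bounds the
    move by the loss of radius. This telescopes, and keeps all later centres in the ball.\<close>
  define Q where "Q p q \<longleftrightarrow> (\<forall>x\<in>topspace X. mdist Z (fst p x) (fst q x) \<le> snd p x / 2 \<and>
      snd q x \<le> snd p x / 2)" for p q :: "('a \<Rightarrow> 'c) \<times> ('a \<Rightarrow> real)"
  have step: "\<exists>q. P k q \<and> Q p q" if p: "C p" for k p
  proof -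
    have pp: "fst p \<in> map_space X (mtopology_of Z)" "continuous_map X euclideanreal (snd p)"
        "\<forall>x\<in>topspace X. 0 < snd p x"
      using p by (auto simp: C_def)
    have "continuous_map X euclideanreal (\<lambda>x. snd p x / 2)"
      using pp by (auto intro!: continuous_intros)
    then obtain g' where g': "g' \<in> S k" "g' \<in> sl_cball X Z (fst p) (\<lambda>x. snd p x / 2)"
      using dense[of "fst p" "\<lambda>x. snd p x / 2" k] pp by auto
    then obtain \<beta> where \<beta>: "continuous_map X euclideanreal \<beta>" "\<forall>x\<in>topspace X. 0 < \<beta> x"
        "sl_cball X Z g' \<beta> \<subseteq> S k"
      using op by blast
    let ?\<gamma> = "\<lambda>x. min (\<beta> x) (min (snd p x / 2) ((1/2)^k))"
    have "continuous_map X euclideanreal ?\<gamma>"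
      using \<beta> pp by (auto simp: C_def intro!: continuous_intros)
    moreover have "sl_cball X Z g' ?\<gamma> \<subseteq> sl_cball X Z g' \<beta>"
      by (auto simp: sl_cball_def)
    ultimately have "P k (g', ?\<gamma>) \<and> Q p (g', ?\<gamma>)"
      using \<beta> pp g' by (auto simp: P_def Q_def C_def sl_cball_def)
    then show ?thesis
      by blast
  qed
  have C0: "C (g, \<alpha>)"
    using g \<alpha> by (simp add: C_def)
  obtain p0 where p0: "P 0 p0" "Q (g, \<alpha>) p0"
    using step[OF C0] by blast
  have "\<exists>s. \<forall>k. (P k (s k) \<and> (k = 0 \<longrightarrow> s k = p0)) \<and> Q (s k) (s (Suc k))"
  proof (rule dependent_nat_choice)
    show "\<exists>p. P 0 p \<and> (0 = (0::nat) \<longrightarrow> p = p0)"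
      using p0 by blast
    show "\<exists>q. (P (Suc k) q \<and> (Suc k = 0 \<longrightarrow> q = p0)) \<and> Q p q" if "P k p \<and> (k = 0 \<longrightarrow> p = p0)" for p k
      using step[of p "Suc k"] that by (auto simp: P_def)
  qed
  then obtain s where s: "\<And>k. P k (s k)" "s 0 = p0" "\<And>k. Q (s k) (s (Suc k))"
    by metis
  let ?g = "\<lambda>k. fst (s k)" and ?a = "\<lambda>k. snd (s k)"
  have cont: "continuous_map X (mtopology_of Z) (?g k)" for k
    using s(1)[of k] by (simp add: P_def C_def map_space_def)
  have im: "?g k x \<in> mspace Z" if "x \<in> topspace X" for k x
    using continuous_map_image_subset_topspace[OF cont[of k]] that by auto
  have apos: "0 < ?a k x" "?a k x \<le> (1/2)^k" if "x \<in> topspace X" for k x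
    using s(1)[of k] that by (auto simp: P_def C_def)
  have tel: "mdist Z (?g k x) (?g (k + j) x) \<le> ?a k x - ?a (k + j) x" if x: "x \<in> topspace X" for k j x
  proof (induction j)
    case (Suc j)
    have "mdist Z (?g k x) (?g (k + Suc j) x) \<le>
        mdist Z (?g k x) (?g (k + j) x) + mdist Z (?g (k + j) x) (?g (k + Suc j) x)"
      by (rule mdist_triangle) (rule im[OF x])+
    moreover have "mdist Z (?g (k + j) x) (?g (k + Suc j) x) \<le> ?a (k + j) x / 2"
        "?a (k + Suc j) x \<le> ?a (k + j) x / 2"
      using s(3)[of "k + j"] x by (auto simp: Q_def)
    ultimately show ?case
      using Suc by linarith
  qed (use im[OF x] in simp)
  have near: "mdist Z (?g k x) (?g j x) \<le> ?a k x" if "x \<in> topspace X" "k \<le> j" for k j x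
    using tel[OF that(1), of k "j - k"] apos(1)[OF that(1), of j] that(2) by simp
  have "\<exists>N. \<forall>m n x. N \<le> m \<longrightarrow> N \<le> n \<longrightarrow> x \<in> topspace X \<longrightarrow> mdist Z (?g m x) (?g n x) < \<epsilon>"
    if \<epsilon>: "\<epsilon> > 0" for \<epsilon>
  proof -
    obtain N where N: "(1/2::real)^N < \<epsilon> / 2"
      using \<epsilon> real_arch_pow_inv[of "\<epsilon> / 2" "1/2"] by auto
    have "mdist Z (?g m x) (?g n x) < \<epsilon>" if "N \<le> m" "N \<le> n" and x: "x \<in> topspace X" for m n x
    proof -
      have "mdist Z (?g m x) (?g n x) \<le> mdist Z (?g N x) (?g m x) + mdist Z (?g N x) (?g n x)"
        using mdist_triangle[of "?g m x" Z "?g N x" "?g n x"] im[OF x] by (simp add: mdist_commute)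
      also have "\<dots> < \<epsilon>"
        using near[OF x that(1)] near[OF x that(2)] apos(2)[OF x, of N] N by linarith
      finally show ?thesis .
    qed
    then show ?thesis
      by blast
  qed
  moreover have "\<forall>\<^sub>F n in sequentially. continuous_map X M.mtopology (?g n)"
    using cont by (simp add: mtopology_of_def)
  moreover have "M.mcomplete"
    using Z by (simp add: mcomplete_of_def)
  ultimately obtain G where G: "continuous_map X M.mtopology G"
    "\<And>\<epsilon>. 0 < \<epsilon> \<Longrightarrow> \<forall>\<^sub>F n in sequentially. \<forall>x\<in>topspace X. mdist Z (?g n x) (G x) < \<epsilon>"
    using M.continuous_map_uniformly_Cauchy_limit[of X ?g] by blast
  have Gim: "G x \<in> mspace Z" if "x \<in> topspace X" for x
    using continuous_map_image_subset_topspace[OF G(1)] that by auto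
  have lim: "mdist Z (?g k x) (G x) \<le> ?a k x" if x: "x \<in> topspace X" for k x
  proof (rule field_le_epsilon)
    fix e :: real assume "e > 0"
    from G(2)[OF this] have "\<forall>\<^sub>F n in sequentially. k \<le> n \<and> mdist Z (?g n x) (G x) < e"
      using eventually_ge_at_top[of k] by eventually_elim (use x in auto)
    then obtain n where n: "k \<le> n" "mdist Z (?g n x) (G x) < e"
      using eventually_happens' by force
    have "mdist Z (?g k x) (G x) \<le> mdist Z (?g k x) (?g n x) + mdist Z (?g n x) (G x)"
      by (rule mdist_triangle) (rule im[OF x] Gim[OF x])+
    also have "\<dots> \<le> ?a k x + e"
      using near[OF x n(1)] n(2) by simp
    finally show "mdist Z (?g k x) (G x) \<le> ?a k x + e" .
  qed
  define F where "F = restrict G (topspace X)"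
  have Fm: "F \<in> map_space X (mtopology_of Z)"
    using G(1) unfolding F_def map_space_def mtopology_of_def
    by (simp add: continuous_map_eq[OF G(1)])
  have "F \<in> S k" for k
  proof -
    have "F \<in> sl_cball X Z (?g k) (?a k)"
      using Fm lim by (auto simp: sl_cball_def F_def)
    then show ?thesis
      using s(1)[of k] by (auto simp: P_def)
  qed
  moreover have "F \<in> sl_cball X Z g \<alpha>"
  proof -
    have "mdist Z (g x) (F x) \<le> \<alpha> x" if x: "x \<in> topspace X" for x
    proof -
      have "g x \<in> mspace Z"
        using g continuous_map_image_subset_topspace[of X "mtopology_of Z" g] x by (auto simp: map_space_def)
      then have "mdist Z (g x) (F x) \<le> mdist Z (g x) (?g 0 x) + mdist Z (?g 0 x) (F x)"
        using mdist_triangle[of "g x" Z "?g 0 x" "G x"] im[OF x] Gim[OF x] x by (simp add: F_def)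
      also have "\<dots> \<le> \<alpha> x / 2 + \<alpha> x / 2"
        using p0(2) s(2) lim[OF x, of 0] x by (intro add_mono) (auto simp: Q_def F_def intro: order_trans)
      finally show ?thesis
        by simp
    qed
    then show ?thesis
      using Fm by (simp add: sl_cball_def)
  qed
  ultimately show ?thesis
    by blast
qed

lemma dense_in_source_limitation_topology:
  assumes S: "S \<subseteq> map_space X (mtopology_of Z)"
    and dense: "\<And>g \<alpha>. \<lbrakk>g \<in> map_space X (mtopology_of Z); continuous_map X euclideanreal \<alpha>;
        \<forall>x\<in>topspace X. 0 < \<alpha> x\<rbrakk> \<Longrightarrow> S \<inter> sl_cball X Z g \<alpha> \<noteq> {}"
  shows "source_limitation_topology X Z closure_of S = topspace (source_limitation_topology X Z)"
proof (rule subset_antisym[OF closure_of_subset_topspace], rule subsetI)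
  fix g assume "g \<in> topspace (source_limitation_topology X Z)"
  then have g: "g \<in> map_space X (mtopology_of Z)"
    by simp
  have *: "\<exists>y\<in>S. y \<in> T" if T: "g \<in> T" "sl_open X Z T" for T
  proof -
    obtain \<alpha> where "continuous_map X euclideanreal \<alpha>" "\<forall>x\<in>topspace X. 0 < \<alpha> x" "sl_cball X Z g \<alpha> \<subseteq> T"
      using T unfolding sl_open_def by blast
    then show ?thesis
      using dense[OF g] by blast
  qed
  show "g \<in> source_limitation_topology X Z closure_of S"
    using g * by (auto simp: in_closure_of)
qed

lemma gdelta_in_source_limitation_topology:
  assumes Y: "paracompact_space Y" and f: "perfect_map X Y f"
    and h: "continuous_map X (mtopology_of M) h"
  shows "gdelta_in (source_limitation_topology X Z)
     (\<Inter>k. fibre_small_maps X (mtopology_of Z) M f h (1 / Suc k))"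
proof (rule gdelta_in_Inter)
  show "gdelta_in (source_limitation_topology X Z) T"
    if T: "T \<in> range (\<lambda>k. fibre_small_maps X (mtopology_of Z) M f h (1 / Suc k))" for T
  proof -
    have "sl_open X Z T"
      using T fibre_small_maps_open[OF Y f h] unfolding sl_open_def
      by (auto simp: fibre_small_maps_def)
    then show ?thesis
      by (intro open_imp_gdelta_in) simp
  qed
qed auto


section \<open>Closed families on a fibre\<close>

text \<open>Cut [0,1] into 2 N + 1 equal pieces numbered from 0; band i is piece 2 i + 1. For i < N
  the bands are pairwise disjoint and avoid both 0 and 1.\<close>

definition band_lo :: "nat \<Rightarrow> nat \<Rightarrow> real" where "band_lo N i = (2 * real i + 1) / (2 * real N + 1)"
definition band_hi :: "nat \<Rightarrow> nat \<Rightarrow> real" where "band_hi N i = (2 * real i + 2) / (2 * real N + 1)"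

lemma band_lo_pos: "0 < band_lo N i"
  by (simp add: band_lo_def add_pos_nonneg)

lemma band_lo_less_hi: "band_lo N i < band_hi N i"
  by (simp add: band_lo_def band_hi_def divide_strict_right_mono)

lemma band_hi_less_1: "i < N \<Longrightarrow> band_hi N i < 1"
  by (simp add: band_hi_def)

lemma band_hi_less_lo: "i < j \<Longrightarrow> band_hi N i < band_lo N j"
  by (simp add: band_lo_def band_hi_def divide_strict_right_mono)

lemma band_disjoint:
  assumes "band_lo N i \<le> t" "t \<le> band_hi N i" "band_lo N j \<le> t" "t \<le> band_hi N j"
  shows "i = j"
  using assms band_hi_less_lo[of i j N] band_hi_less_lo[of j i N] by (cases i j rule: linorder_cases) auto

text \<open>One of the at most \<open>n + 1\<close> positive values is \<open>1\<close> and therefore lies in no band.\<close>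

lemma card_bands_hit:
  fixes v :: "'i \<Rightarrow> real"
  assumes fin: "finite {j \<in> I. 0 < v j}" and card: "card {j \<in> I. 0 < v j} \<le> n + 1"
    and one: "\<exists>j\<in>I. v j = 1"
  shows "card {i. i < N \<and> (\<exists>j\<in>I. band_lo N i \<le> v j \<and> v j \<le> band_hi N i)} \<le> n"
proof -
  let ?M = "{i. i < N \<and> (\<exists>j\<in>I. band_lo N i \<le> v j \<and> v j \<le> band_hi N i)}"
  obtain j1 where j1: "j1 \<in> I" "v j1 = 1"
    using one by blast
  have "\<forall>i\<in>?M. \<exists>j. j \<in> I \<and> band_lo N i \<le> v j \<and> v j \<le> band_hi N i"
    by blast
  then obtain s where "\<forall>i\<in>?M. s i \<in> I \<and> band_lo N i \<le> v (s i) \<and> v (s i) \<le> band_hi N i"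
    by (rule bchoice[THEN exE])
  then have s: "s i \<in> I \<and> band_lo N i \<le> v (s i) \<and> v (s i) \<le> band_hi N i" if "i \<in> ?M" for i
    using that by blast
  have "inj_on s ?M"
  proof (rule inj_onI)
    fix i i' assume "i \<in> ?M" "i' \<in> ?M" "s i = s i'"
    then show "i = i'"
      using s[of i] s[of i'] band_disjoint[of N i "v (s i)" i'] by simp
  qed
  moreover have "s ` ?M \<subseteq> {j \<in> I. 0 < v j} - {j1}"
  proof clarify
    fix i j assume "i < N" "j \<in> I" "band_lo N i \<le> v j" "v j \<le> band_hi N i"
    then have "i \<in> ?M"
      by blast
    from s[OF this] show "s i \<in> {j \<in> I. 0 < v j} - {j1}"
      using band_lo_pos[of N i] band_hi_less_1[OF \<open>i < N\<close>] j1 by auto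
  qed
  ultimately have "card ?M \<le> card ({j \<in> I. 0 < v j} - {j1})"
    using fin by (intro card_inj_on_le) auto
  also have "\<dots> \<le> n"
    using fin card j1 by simp
  finally show ?thesis .
qed

text \<open>Band i sorts the indices in \<open>I\<close>: those in \<open>B\<close> lie above it,
  the others below. A point with no value strictly inside the band lies in the cell of exactly one
  \<open>B \<subseteq> I\<close>. The positive width of the band lets closed conditions define
  disjoint sets.\<close>

definition level_cell :: "nat \<Rightarrow> ('i \<Rightarrow> 'a \<Rightarrow> real) \<Rightarrow> 'i set \<Rightarrow> nat \<Rightarrow> 'i set \<Rightarrow> 'a set" where
  "level_cell N u I i B = {x. (\<forall>j\<in>B. band_hi N i \<le> u j x) \<and> (\<forall>j\<in>I - B. u j x \<le> band_lo N i)}"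

lemma level_cell_disjoint:
  assumes "B \<subseteq> I" "B' \<subseteq> I" "B \<noteq> B'"
  shows "level_cell N u I i B \<inter> level_cell N u I i B' = {}"
proof -
  have "False" if "j \<in> C" "j \<notin> C'" "C \<subseteq> I" "x \<in> level_cell N u I i C" "x \<in> level_cell N u I i C'" for j C C' x
  proof -
    have "band_hi N i \<le> u j x" "u j x \<le> band_lo N i"
      using that by (auto simp: level_cell_def)
    then show False
      using band_lo_less_hi[of N i] by linarith
  qed
  then show ?thesis
    using assms by blast
qed

lemma in_level_cell_if_no_band_hit:
  assumes i: "i < N" and no: "\<not> (\<exists>j\<in>I. band_lo N i \<le> u j x \<and> u j x \<le> band_hi N i)"
    and big: "\<exists>j\<in>I. band_hi N i \<le> u j x"
  shows "\<exists>B. B \<subseteq> I \<and> B \<noteq> {} \<and> x \<in> level_cell N u I i B"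
proof (intro exI conjI)
  let ?B = "{j \<in> I. band_hi N i \<le> u j x}"
  show "?B \<subseteq> I" "?B \<noteq> {}"
    using big by auto
  show "x \<in> level_cell N u I i ?B"
    using no by (force simp: level_cell_def)
qed

lemma closedin_level_cell:
  assumes u: "\<And>j. j \<in> I \<Longrightarrow> continuous_map X euclideanreal (u j)" and B: "B \<subseteq> I"
  shows "closedin X (topspace X \<inter> level_cell N u I i B)"
proof -
  let ?H = "\<lambda>j. {x \<in> topspace X. u j x \<in> {band_hi N i..}}"
  let ?L = "\<lambda>j. {x \<in> topspace X. u j x \<in> {..band_lo N i}}"
  have "closedin X (\<Inter>(insert (topspace X) (?H ` B \<union> ?L ` (I - B))))"
  proof (rule closedin_Inter)
    fix S assume "S \<in> insert (topspace X) (?H ` B \<union> ?L ` (I - B))"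
    then consider "S = topspace X" | j where "j \<in> I" "S = ?H j" | j where "j \<in> I" "S = ?L j"
      using B by blast
    then show "closedin X S"
    proof cases
      case 2
      then show ?thesis
        using closedin_continuous_map_preimage[OF u, of j "{band_hi N i..}"] by simp
    next
      case 3
      then show ?thesis
        using closedin_continuous_map_preimage[OF u, of j "{..band_lo N i}"] by simp
    qed simp
  qed simp
  moreover have "topspace X \<inter> level_cell N u I i B = \<Inter>(insert (topspace X) (?H ` B \<union> ?L ` (I - B)))"
    by (auto simp: level_cell_def)
  ultimately show ?thesis
    by simp
qed

lemma compact_Hausdorff_imp_paracompact:
  assumes "compact_space X" "Hausdorff_space X"
  shows "paracompact_space X"
  unfolding paracompact_space_def
proof (intro conjI allI impI)
  fix \<U> assume U: "open_cover X \<U>"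
  then obtain \<F> where F: "finite \<F>" "\<F> \<subseteq> \<U>" "topspace X \<subseteq> \<Union>\<F>"
    using compactinD[of X "topspace X" \<U>] assms(1)
    unfolding compact_space_def open_cover_def by (metis order_refl)
  have sub: "\<Union>\<F> \<subseteq> topspace X"
    using U F(2) unfolding open_cover_def by blast
  show "\<exists>\<V>. open_cover X \<V> \<and> refines \<V> \<U> \<and> locally_finite_in X \<V>"
  proof (intro exI conjI)
    show "open_cover X \<F>"
      using U F sub by (auto simp: open_cover_def)
    show "refines \<F> \<U>"
      using F by (auto simp: refines_def)
    show "locally_finite_in X \<F>"
      by (rule finite_imp_locally_finite_in[OF F(1) sub])
  qed
qed (rule assms)

text \<open>On the compact fibre the dimension gives a finite cover of order n, and with it Urysohn
  functions that hit at most n bands at any point. Tietze extends them to \<open>X\<close>; what the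
  cells require of them persists near the fibre, hence over a neighbourhood \<open>V\<close> of
  \<open>y\<close> because \<open>f\<close> is closed. The cells are closed in all of
  \<open>X\<close>, but small only over \<open>V\<close>.\<close>

lemma fibre_families:
 fixes X :: "'a topology" and Y :: "'b topology" and N n :: nat
  assumes X: "normal_space X" "Hausdorff_space X" and f: "perfect_map X Y f" and y: "y \<in> topspace Y"
    and dim: "covering_dim_le (subtopology X {x \<in> topspace X. f x = y}) n"
    and \<G>: "open_cover X \<G>"
  shows "\<exists>V \<A>. openin Y V \<and> y \<in> V \<and>
    (\<forall>i<N. finite (\<A> i) \<and> pairwise disjnt (\<A> i) \<and>
       (\<forall>A\<in>\<A> i. closedin X A \<and> (\<exists>G\<in>\<G>. {x \<in> A. f x \<in> V} \<subseteq> G))) \<and>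
    (\<forall>x\<in>topspace X. f x \<in> V \<longrightarrow> card {i. i < N \<and> x \<notin> \<Union>(\<A> i)} \<le> n)"
proof -
  let ?lo = "band_lo N" and ?hi = "band_hi N"
  define K where "K = {x \<in> topspace X. f x = y}"
  have K: "compactin X K"
    using f y by (simp add: perfect_map_def proper_map_def K_def)
  have Ksub: "K \<subseteq> topspace X"
    by (auto simp: K_def)
  have Kcl: "closedin X K"
    by (rule compactin_imp_closedin[OF X(2) K])
  have top: "topspace (subtopology X K) = K"
    using Ksub by auto
  have para: "paracompact_space (subtopology X K)"
    using K X(2) by (intro compact_Hausdorff_imp_paracompact) (auto simp: compactin_subspace Hausdorff_space_subtopology)
  obtain \<F> where \<F>: "finite \<F>" "\<F> \<subseteq> \<G>" "K \<subseteq> \<Union>\<F>"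
    using compactinD[OF K, of \<G>] \<G> Ksub by (auto simp: open_cover_def)
  have "open_cover (subtopology X K) ((\<lambda>G. K \<inter> G) ` \<F>)"
    using \<F> \<G> unfolding open_cover_def top by (auto intro!: openin_subtopology_Int2)
  then obtain \<V> where \<V>: "finite \<V>" "open_cover (subtopology X K) \<V>" "refines \<V> ((\<lambda>G. K \<inter> G) ` \<F>)"
    and ord: "\<forall>x\<in>K. card {V \<in> \<V>. x \<in> V} \<le> n + 1"
    using dim \<F>(1) unfolding covering_dim_le_def K_def[symmetric] top by blast
  have "\<forall>V\<in>\<V>. \<exists>G. G \<in> \<G> \<and> V \<subseteq> G"
    using \<V>(3) \<F>(2) unfolding refines_def by fastforce
  then obtain G where G: "\<And>V. V \<in> \<V> \<Longrightarrow> G V \<in> \<G> \<and> V \<subseteq> G V"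
    by metis
  have Gop: "openin X (G V)" if "V \<in> \<V>" for V
    using G[OF that] \<G> by (auto simp: open_cover_def)
  have "\<exists>u :: 'a set \<Rightarrow> 'a \<Rightarrow> real. (\<forall>V\<in>\<V>. continuous_map (subtopology X K) euclideanreal (u V)) \<and>
    (\<forall>V\<in>\<V>. \<forall>x\<in>K. u V x \<in> {0..1}) \<and> (\<forall>V\<in>\<V>. \<forall>x\<in>K. x \<notin> V \<longrightarrow> u V x = 0) \<and>
    (\<forall>x\<in>K. \<exists>V\<in>\<V>. x \<in> V \<and> u V x = 1)"
    using paracompact_Urysohn_family[OF para, of \<V> "\<lambda>V. V"] \<V>(2) unfolding top open_cover_def by auto
  then obtain u :: "'a set \<Rightarrow> 'a \<Rightarrow> real" where u: "\<forall>V\<in>\<V>. continuous_map (subtopology X K) euclideanreal (u V)"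
    "\<forall>V\<in>\<V>. \<forall>x\<in>K. u V x \<in> {0..1}" "\<forall>V\<in>\<V>. \<forall>x\<in>K. x \<notin> V \<longrightarrow> u V x = 0"
    "\<forall>x\<in>K. \<exists>V\<in>\<V>. x \<in> V \<and> u V x = 1"
    by blast
  have "\<forall>V\<in>\<V>. \<exists>w. continuous_map X euclideanreal w \<and> (\<forall>x\<in>K. w x = u V x)"
  proof
    fix V assume V: "V \<in> \<V>"
    have "u V ` K \<subseteq> {0..1}"
      using u(2) V by auto
    then show "\<exists>w. continuous_map X euclideanreal w \<and> (\<forall>x\<in>K. w x = u V x)"
      using Tietze_extension_closed_real_interval[OF X(1) Kcl bspec[OF u(1) V], of 0 1]
      by (metis zero_le_one)
  qed
  then obtain w where "\<forall>V\<in>\<V>. continuous_map X euclideanreal (w V) \<and> (\<forall>x\<in>K. w V x = u V x)"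
    by (rule bchoice[THEN exE])
  then have w: "\<And>V. V \<in> \<V> \<Longrightarrow> continuous_map X euclideanreal (w V)"
    "\<And>V x. V \<in> \<V> \<Longrightarrow> x \<in> K \<Longrightarrow> w V x = u V x"
    by blast+
  have pre: "openin X {x \<in> topspace X. w V x \<in> S}" if "V \<in> \<V>" "open S" for V S
    using openin_continuous_map_preimage[OF w(1)[OF that(1)], of S] that(2) by simp
  \<comment> \<open>Off the fibre an extension may be positive outside \<open>G V\<close>, and the
    value 1 may be lost. The weakened conditions suffice: reaching the lowest band forces membership
    in \<open>G V\<close>, and some value still exceeds all bands.\<close>
  define good where "good x \<longleftrightarrow> x \<in> topspace X \<and>
     card {i. i < N \<and> (\<exists>V\<in>\<V>. ?lo i \<le> w V x \<and> w V x \<le> ?hi i)} \<le> n \<and>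
     (\<exists>V\<in>\<V>. \<forall>i<N. ?hi i \<le> w V x) \<and> (\<forall>V\<in>\<V>. w V x < ?lo 0 \<or> x \<in> G V)" for x
  have "\<exists>T. openin X T \<and> x0 \<in> T \<and> (\<forall>x\<in>T. good x)" if x0: "x0 \<in> K" for x0
  proof -
    obtain V0 where V0: "V0 \<in> \<V>" "x0 \<in> V0" "u V0 x0 = 1"
      using u(4) x0 by blast
    \<comment> \<open>The bands are closed, so a value outside a band stays outside nearby, while a
      value inside is left free: near \<open>x0\<close> no new band is hit. The second factor keeps
      the value that is 1 at \<open>x0\<close> above every band.\<close>
    define S where "S = (\<lambda>(i, V). {x \<in> topspace X. w V x \<in> (if ?lo i \<le> w V x0 \<and> w V x0 \<le> ?hi i then UNIV else - {?lo i..?hi i})}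
        \<inter> {x \<in> topspace X. w V0 x \<in> {?hi i<..}})"
    define S' where "S' V = {x \<in> topspace X. w V x \<in> {..<?lo 0}} \<union> G V" for V
    define T where "T = {x \<in> {x \<in> topspace X. \<forall>V\<in>\<V>. x \<in> S' V}. \<forall>p \<in> {..<N} \<times> \<V>. x \<in> S p}"
    have opS': "openin X (S' V)" if "V \<in> \<V>" for V
      unfolding S'_def using that by (intro openin_Un pre Gop) auto
    have opS: "openin X (S p)" if pI: "p \<in> {..<N} \<times> \<V>" for p
    proof -
      obtain i V where p: "p = (i, V)" "V \<in> \<V>"
        using pI by auto
      have "open (if ?lo i \<le> w V x0 \<and> w V x0 \<le> ?hi i then UNIV else - {?lo i..?hi i})"
        by (simp only: if_split open_UNIV open_Compl closed_atLeastAtMost) simp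
      then show ?thesis
        unfolding S_def p by (simp only: prod.case) (intro openin_Int pre p V0(1) open_greaterThan)
    qed
    have "openin X T"
      unfolding T_def using \<V>(1) opS opS' by (intro openin_finite_conditions) auto
    moreover have "x0 \<in> T"
    proof -
      have 1: "w V x0 < ?lo 0 \<or> x0 \<in> G V" if "V \<in> \<V>" for V
        using u(3) w(2)[OF that x0] G[OF that] x0 that band_lo_pos[of N 0] by (cases "x0 \<in> V") auto
      have 2: "?hi i < w V0 x0" if "i < N" for i
        using w(2)[OF V0(1) x0] V0(3) band_hi_less_1[OF that] by simp
      show ?thesis
        using 1 2 x0 Ksub by (auto simp: T_def S_def S'_def)
    qed
    moreover have "good x" if x: "x \<in> T" for x
    proof -
      have xX: "x \<in> topspace X"
        using x by (simp add: T_def)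
      have G1: "w V x < ?lo 0 \<or> x \<in> G V" if "V \<in> \<V>" for V
        using x that by (auto simp: T_def S'_def)
      have hit: "?lo i \<le> w V x0 \<and> w V x0 \<le> ?hi i" if "V \<in> \<V>" "i < N" "?lo i \<le> w V x" "w V x \<le> ?hi i" for i V
        using x that by (fastforce simp: T_def S_def split: if_splits)
      have "w V0 x > ?hi i" if "i < N" for i
        using x V0(1) that by (force simp: T_def S_def)
      then have big: "\<exists>V\<in>\<V>. \<forall>i<N. ?hi i \<le> w V x"
        using V0(1) by (auto intro!: bexI[of _ V0] less_imp_le)
      have sub: "{V \<in> \<V>. 0 < w V x0} \<subseteq> {V \<in> \<V>. x0 \<in> V}"
        using u(3) w(2) x0 by force
      have fin: "finite {V \<in> \<V>. x0 \<in> V}"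
        using \<V>(1) by simp
      have "card {i. i < N \<and> (\<exists>V\<in>\<V>. ?lo i \<le> w V x \<and> w V x \<le> ?hi i)} \<le>
            card {i. i < N \<and> (\<exists>V\<in>\<V>. ?lo i \<le> w V x0 \<and> w V x0 \<le> ?hi i)}"
        using hit by (intro card_mono) auto
      also have "\<dots> \<le> n"
      proof (rule card_bands_hit)
        show "finite {V \<in> \<V>. 0 < w V x0}"
          using finite_subset[OF sub fin] .
        show "card {V \<in> \<V>. 0 < w V x0} \<le> n + 1"
          using card_mono[OF fin sub] ord x0 by (meson order_trans)
        show "\<exists>V\<in>\<V>. w V x0 = 1"
          using V0 w(2) x0 by auto
      qed
      finally show ?thesis
        using G1 big xX by (simp add: good_def)
    qed
    ultimately show ?thesis
      by blast
  qed
  then obtain T where T: "\<And>x0. x0 \<in> K \<Longrightarrow> openin X (T x0) \<and> x0 \<in> T x0 \<and> (\<forall>x\<in>T x0. good x)"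
    by metis
  have "openin X (\<Union>(T ` K))" "K \<subseteq> \<Union>(T ` K)"
    using T by blast+
  then obtain V where V: "openin Y V" "y \<in> V" "{x \<in> topspace X. f x \<in> V} \<subseteq> \<Union>(T ` K)"
    using perfect_imp_closed_map[OF f, unfolded closed_map_fibre_neighbourhood, THEN conjunct2, rule_format,
        of "\<Union>(T ` K)" y] y unfolding K_def by blast
  have good: "good x" if "x \<in> topspace X" "f x \<in> V" for x
    using V(3) T that by blast
  \<comment> \<open>The cell of the empty set is left out: there all values are low and nothing
    places the point in a member of \<open>\<G>\<close>. Points over \<open>V\<close> lose nothing,
    since one of their values exceeds all bands.\<close>
  define \<A> where "\<A> i = (\<lambda>B. topspace X \<inter> level_cell N w \<V> i B) ` {B. B \<subseteq> \<V> \<and> B \<noteq> {}}" for i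
  show ?thesis
  proof (intro exI[of _ V] exI[of _ \<A>] conjI allI impI ballI)
    show "finite (\<A> i)" for i
      unfolding \<A>_def using \<V>(1) by (intro finite_imageI) (auto intro: finite_subset[of _ "Pow \<V>"])
    show "pairwise disjnt (\<A> i)" for i
    proof (rule pairwiseI)
      fix A A' assume A: "A \<in> \<A> i" "A' \<in> \<A> i" "A \<noteq> A'"
      then obtain B B' where B: "B \<subseteq> \<V>" "A = topspace X \<inter> level_cell N w \<V> i B"
          "B' \<subseteq> \<V>" "A' = topspace X \<inter> level_cell N w \<V> i B'"
        unfolding \<A>_def by blast
      then have "B \<noteq> B'"
        using A(3) by blast
      then show "disjnt A A'"
        using level_cell_disjoint[OF B(1,3), of N w i] B(2,4) by (auto simp: disjnt_def)
    qed
    fix i assume i: "i < N"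
    fix A assume A: "A \<in> \<A> i"
    then obtain B where B: "B \<subseteq> \<V>" "B \<noteq> {}" "A = topspace X \<inter> level_cell N w \<V> i B"
      by (auto simp: \<A>_def)
    show "closedin X A"
      unfolding B(3) using w(1) B(1) by (rule closedin_level_cell)
    obtain V' where V': "V' \<in> B"
      using B(2) by blast
    have "{x \<in> A. f x \<in> V} \<subseteq> G V'"
    proof
      fix x assume x: "x \<in> {x \<in> A. f x \<in> V}"
      then have "?hi i \<le> w V' x" "x \<in> topspace X"
        using B V' by (auto simp: level_cell_def)
      moreover have "?lo 0 < ?hi i"
        using band_lo_less_hi[of N 0] band_lo_less_hi[of N i] band_hi_less_lo[of 0 i N] by (cases "i = 0") auto
      ultimately show "x \<in> G V'"
        using good[of x] x B(1) V' by (force simp: good_def)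
    qed
    then show "\<exists>G\<in>\<G>. {x \<in> A. f x \<in> V} \<subseteq> G"
      using G B(1) V' by blast
  next
    fix x assume x: "x \<in> topspace X" "f x \<in> V"
    have "i \<in> {i. i < N \<and> (\<exists>V\<in>\<V>. ?lo i \<le> w V x \<and> w V x \<le> ?hi i)}"
      if i: "i < N" "x \<notin> \<Union>(\<A> i)" for i
    proof (rule ccontr)
      assume "i \<notin> {i. i < N \<and> (\<exists>V\<in>\<V>. ?lo i \<le> w V x \<and> w V x \<le> ?hi i)}"
      then have "\<exists>B. B \<subseteq> \<V> \<and> B \<noteq> {} \<and> x \<in> level_cell N w \<V> i B"
        using good[OF x] i(1) by (intro in_level_cell_if_no_band_hit) (auto simp: good_def)
      then show False
        using i(2) x(1) by (auto simp: \<A>_def)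
    qed
    then have "card {i. i < N \<and> x \<notin> \<Union>(\<A> i)} \<le> card {i. i < N \<and> (\<exists>V\<in>\<V>. ?lo i \<le> w V x \<and> w V x \<le> ?hi i)}"
      by (intro card_mono) auto
    then show "card {i. i < N \<and> x \<notin> \<Union>(\<A> i)} \<le> n"
      using good[OF x] by (simp add: good_def)
  qed (use V in auto)
qed


section \<open>Merging closed families of several scales\<close>

text \<open>A pair \<open>(C, \<A>)\<close> in \<open>\<C>\<close> consists of \<open>C \<subseteq> Y\<close> and of families \<open>\<A> i\<close>, \<open>i < N\<close>, of subsets of \<open>X\<close>.\<close>

definition fibrewise_families ::
  "'a topology \<Rightarrow> 'b topology \<Rightarrow> ('a \<Rightarrow> 'b) \<Rightarrow> nat \<Rightarrow> nat \<Rightarrow> ('b set \<times> (nat \<Rightarrow> 'a set set)) set \<Rightarrow> bool" where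
  "fibrewise_families X Y f N n \<C> \<longleftrightarrow>
     (\<forall>y\<in>topspace Y. \<exists>c\<in>\<C>. y \<in> Y interior_of fst c) \<and>
     (\<forall>c\<in>\<C>. \<forall>x\<in>topspace X. f x \<in> fst c \<longrightarrow> card {i. i < N \<and> x \<notin> \<Union>(snd c i)} \<le> n)"

text \<open>Members of \<open>\<G>'\<close> are so small that a member of \<open>\<A>\<close> can be enlarged by all disjoint sets it meets
  that refine \<open>\<G>'\<close>, staying disjoint from the other members of \<open>\<A>\<close> and inside a member of \<open>\<G>\<close>.\<close>

definition absorbable :: "'a topology \<Rightarrow> 'a set set \<Rightarrow> 'a set set \<Rightarrow> 'a set set \<Rightarrow> bool" where
  "absorbable X \<G> \<G>' \<A> \<longleftrightarrow> finite \<A> \<and> pairwise disjnt \<A> \<and>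
     (\<forall>A\<in>\<A>. closedin X A \<and> (\<exists>G\<in>\<G>. A \<subseteq> G \<and> (\<forall>D\<in>\<G>'. D \<inter> A \<noteq> {} \<longrightarrow> D \<subseteq> G))) \<and>
     (\<forall>D\<in>\<G>'. \<forall>A\<in>\<A>. \<forall>A'\<in>\<A>. D \<inter> A \<noteq> {} \<and> D \<inter> A' \<noteq> {} \<longrightarrow> A = A')"

text \<open>A member of \<open>\<F>\<close> lies in a member of \<open>\<G>'\<close> and so meets at
  most one member of \<open>\<A>\<close>. It is absorbed there, or kept in \<open>R\<close> if it
  meets none. As both families refine the result, a point covered at either scale stays covered
  after merging.\<close>

lemma absorb:
  assumes \<A>: "absorbable X \<G> \<G>' \<A>" and ref: "refines \<G>' \<G>"
    and \<F>: "finite \<F>" "pairwise disjnt \<F>" "\<And>F. F \<in> \<F> \<Longrightarrow> closedin X F" "refines \<F> \<G>'"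
  shows "\<exists>\<F>'. finite \<F>' \<and> pairwise disjnt \<F>' \<and> (\<forall>F\<in>\<F>'. closedin X F) \<and> refines \<F>' \<G> \<and>
    refines \<A> \<F>' \<and> refines \<F> \<F>'"
proof -
  define M where "M A = A \<union> \<Union>{F \<in> \<F>. F \<inter> A \<noteq> {}}" for A
  define R where "R = {F \<in> \<F>. \<forall>A\<in>\<A>. F \<inter> A = {}}"
  have uniq: "A = A'" if "D \<in> \<G>'" "A \<in> \<A>" "A' \<in> \<A>" "D \<inter> A \<noteq> {}" "D \<inter> A' \<noteq> {}" for D A A'
    using \<A> that by (simp add: absorbable_def)
  have disA: "A \<inter> A' = {}" if "A \<in> \<A>" "A' \<in> \<A>" "A \<noteq> A'" for A A'
    using \<A> that by (auto simp: absorbable_def pairwise_def disjnt_def)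
  have disF: "F \<inter> F' = {}" if "F \<in> \<F>" "F' \<in> \<F>" "F \<noteq> F'" for F F'
    using \<F>(2) that by (auto simp: pairwise_def disjnt_def)
  have one: "A = A'" if "F \<in> \<F>" "A \<in> \<A>" "A' \<in> \<A>" "F \<inter> A \<noteq> {}" "F \<inter> A' \<noteq> {}" for F A A'
  proof -
    obtain D where "D \<in> \<G>'" "F \<subseteq> D"
      using \<F>(4) \<open>F \<in> \<F>\<close> by (auto simp: refines_def)
    moreover from this have "D \<inter> A \<noteq> {}" "D \<inter> A' \<noteq> {}"
      using that by auto
    ultimately show ?thesis
      by (intro uniq[of D A A'] that)
  qed
  have disM: "M A \<inter> M A' = {}" if A: "A \<in> \<A>" "A' \<in> \<A>" "A \<noteq> A'" for A A'
  proof (rule ccontr)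
    assume "M A \<inter> M A' \<noteq> {}"
    then obtain x where x: "x \<in> M A" "x \<in> M A'"
      by blast
    consider "x \<in> A" "x \<in> A'" | F where "F \<in> \<F>" "F \<inter> A' \<noteq> {}" "x \<in> F" "x \<in> A"
      | F where "F \<in> \<F>" "F \<inter> A \<noteq> {}" "x \<in> F" "x \<in> A'"
      | F F' where "F \<in> \<F>" "F' \<in> \<F>" "F \<inter> A \<noteq> {}" "F' \<inter> A' \<noteq> {}" "x \<in> F" "x \<in> F'"
      using x unfolding M_def by blast
    then show False
    proof cases
      case 1 then show ?thesis using disA A by blast
    next
      case 2 then show ?thesis using one[of F A A'] A by blast
    next
      case 3 then show ?thesis using one[of F A A'] A by blast
    next
      case 4
      then have "F = F'" using disF by blast
      then show ?thesis using 4 one[of F A A'] A by blast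
    qed
  qed
  have disMR: "M A \<inter> F = {}" if A: "A \<in> \<A>" and F: "F \<in> R" for A F
  proof -
    have "F \<inter> A = {}" "F \<in> \<F>"
      using that by (auto simp: R_def)
    moreover have "F \<inter> F' = {}" if "F' \<in> \<F>" "F' \<inter> A \<noteq> {}" for F'
      using disF[of F F'] that \<open>F \<inter> A = {}\<close> \<open>F \<in> \<F>\<close> by blast
    ultimately show ?thesis
      unfolding M_def by blast
  qed
  show ?thesis
  proof (intro exI conjI)
    show "finite (M ` \<A> \<union> R)"
      using \<A> \<F>(1) by (simp add: absorbable_def R_def)
    show "pairwise disjnt (M ` \<A> \<union> R)"
    proof (rule pairwiseI)
      fix S T assume ST: "S \<in> M ` \<A> \<union> R" "T \<in> M ` \<A> \<union> R" "S \<noteq> T"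
      consider A A' where "A \<in> \<A>" "A' \<in> \<A>" "S = M A" "T = M A'"
        | A where "A \<in> \<A>" "S = M A" "T \<in> R" | A where "A \<in> \<A>" "T = M A" "S \<in> R" | "S \<in> R" "T \<in> R"
        using ST by blast
      then show "disjnt S T"
      proof cases
        case 1 then show ?thesis using disM[of A A'] ST(3) by (auto simp: disjnt_def)
      next
        case 2 then show ?thesis using disMR[of A T] by (simp add: disjnt_def)
      next
        case 3 then show ?thesis using disMR[of A S] by (auto simp: disjnt_def)
      next
        case 4 then show ?thesis using disF[of S T] ST(3) by (simp add: disjnt_def R_def)
      qed
    qed
    show "\<forall>F\<in>M ` \<A> \<union> R. closedin X F"
    proof
      fix S assume "S \<in> M ` \<A> \<union> R"
      then consider A where "A \<in> \<A>" "S = M A" | "S \<in> \<F>"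
        by (auto simp: R_def)
      then show "closedin X S"
      proof cases
        case 1
        have "closedin X (\<Union>{F \<in> \<F>. F \<inter> A \<noteq> {}})"
          using \<F>(1,3) by (intro closedin_Union) auto
        then show ?thesis
          using 1 \<A> by (auto simp: M_def absorbable_def)
      qed (use \<F>(3) in auto)
    qed
    show "refines (M ` \<A> \<union> R) \<G>"
      unfolding refines_def
    proof
      fix S assume "S \<in> M ` \<A> \<union> R"
      then consider A where "A \<in> \<A>" "S = M A" | "S \<in> \<F>"
        by (auto simp: R_def)
      then show "\<exists>G\<in>\<G>. S \<subseteq> G"
      proof cases
        case 1
        then obtain G where G: "G \<in> \<G>" "A \<subseteq> G" "\<forall>D\<in>\<G>'. D \<inter> A \<noteq> {} \<longrightarrow> D \<subseteq> G"
          using \<A> by (auto simp: absorbable_def)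
        have "F \<subseteq> G" if "F \<in> \<F>" "F \<inter> A \<noteq> {}" for F
        proof -
          obtain D where "D \<in> \<G>'" "F \<subseteq> D"
            using \<F>(4) \<open>F \<in> \<F>\<close> by (auto simp: refines_def)
          then show ?thesis
            using G(3) that by blast
        qed
        then have "S \<subseteq> G"
          using 1 G(2) by (auto simp: M_def)
        then show ?thesis
          using G(1) by blast
      next
        case 2
        then obtain D where "D \<in> \<G>'" "S \<subseteq> D"
          using \<F>(4) by (auto simp: refines_def)
        then show ?thesis
          using ref unfolding refines_def by (meson order_trans)
      qed
    qed
    show "refines \<A> (M ` \<A> \<union> R)"
      unfolding refines_def M_def by blast
    show "refines \<F> (M ` \<A> \<union> R)"
      unfolding refines_def
    proof
      fix F assume F: "F \<in> \<F>"
      show "\<exists>S\<in>M ` \<A> \<union> R. F \<subseteq> S"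
      proof (cases "F \<in> R")
        case False
        then obtain A where "A \<in> \<A>" "F \<inter> A \<noteq> {}"
          using F by (auto simp: R_def)
        then show ?thesis
          using F by (intro bexI[of _ "M A"]) (auto simp: M_def)
      qed auto
    qed
  qed
qed

text \<open>Locally finitely many local families are selected, each cut down to a closed piece of
  \<open>Y\<close>. All their members together then look locally like a finite system of closed
  sets, and this is what allows a single cover \<open>\<G>'\<close> finer than all of them at
  once.\<close>

lemma one_scale:
  fixes X :: "'a topology" and Y :: "'b topology" and N n :: nat
  assumes X: "normal_space X" "Hausdorff_space X" and Y: "paracompact_space Y" and f: "perfect_map X Y f"
    and dim: "map_dim_le X Y f n" and \<G>: "open_cover X \<G>"
  shows "\<exists>\<C> \<G>'. fibrewise_families X Y f N n \<C> \<and> open_cover X \<G>' \<and> refines \<G>' \<G> \<and>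
    (\<forall>c\<in>\<C>. \<forall>i<N. absorbable X \<G> \<G>' (snd c i))"
proof -
  have fY: "f x \<in> topspace Y" if "x \<in> topspace X" for x
    using f that perfect_imp_continuous_map continuous_map_image_subset_topspace by blast
  define P where "P y V \<A> \<longleftrightarrow> openin Y V \<and> y \<in> V \<and>
    (\<forall>i<N. finite (\<A> i) \<and> pairwise disjnt (\<A> i) \<and>
       (\<forall>A\<in>\<A> i. closedin X A \<and> (\<exists>G\<in>\<G>. {x \<in> A. f x \<in> V} \<subseteq> G))) \<and>
    (\<forall>x\<in>topspace X. f x \<in> V \<longrightarrow> card {i. i < N \<and> x \<notin> \<Union>(\<A> i)} \<le> n)"
    for y V and \<A> :: "nat \<Rightarrow> 'a set set"
  have "\<exists>p. P y (fst p) (snd p)" if "y \<in> topspace Y" for y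
    using fibre_families[OF X f that _ \<G>, of n N] dim that unfolding map_dim_le_def P_def by auto
  then obtain p where p: "\<And>y. y \<in> topspace Y \<Longrightarrow> P y (fst (p y)) (snd (p y))"
    by metis
  have "open_cover Y ((\<lambda>y. fst (p y)) ` topspace Y)"
  proof -
    have "openin Y (fst (p y)) \<and> y \<in> fst (p y)" if "y \<in> topspace Y" for y
      using p[OF that] by (simp add: P_def)
    then show ?thesis
      unfolding open_cover_def using openin_subset[of Y] by fast
  qed
  then obtain \<O> where \<O>: "open_cover Y \<O>" "locally_finite_in Y \<O>"
    and "\<And>W. W \<in> \<O> \<Longrightarrow> \<exists>U\<in>(\<lambda>y. fst (p y)) ` topspace Y. Y closure_of W \<subseteq> U"
    using paracompact_closure_refinement[OF Y] by blast
  then have "\<forall>W\<in>\<O>. \<exists>y. y \<in> topspace Y \<and> Y closure_of W \<subseteq> fst (p y)"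
    by blast
  then obtain q where q: "\<And>W. W \<in> \<O> \<Longrightarrow> q W \<in> topspace Y \<and> Y closure_of W \<subseteq> fst (p (q W))"
    by metis
  \<comment> \<open>Restricting to the closure of \<open>W\<close>, which lies in the neighbourhood
    where the local family is small, puts the members inside members of \<open>\<G>\<close> and
    keeps them closed.\<close>
  define fam where "fam W i = (\<lambda>A. {x \<in> A. f x \<in> Y closure_of W}) ` snd (p (q W)) i" for W i
  define \<C> where "\<C> = (\<lambda>W. (Y closure_of W, fam W)) ` \<O>"
  define \<AA> where "\<AA> = (\<Union>W\<in>\<O>. \<Union>i<N. fam W i)"
  have PW: "finite (snd (p (q W)) i)" "pairwise disjnt (snd (p (q W)) i)"
      "\<And>A. A \<in> snd (p (q W)) i \<Longrightarrow> closedin X A"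
      "\<And>A. A \<in> snd (p (q W)) i \<Longrightarrow> \<exists>G\<in>\<G>. {x \<in> A. f x \<in> fst (p (q W))} \<subseteq> G" if "W \<in> \<O>" "i < N" for W i
    using p[of "q W"] q[OF that(1)] that(2) by (simp_all add: P_def)
  have famfin: "finite (fam W i)" if "W \<in> \<O>" "i < N" for W i
    unfolding fam_def using PW(1)[OF that] by simp
  have famG: "\<exists>G\<in>\<G>. A \<subseteq> G" if Wi: "W \<in> \<O>" "i < N" "A \<in> fam W i" for W i A
  proof -
    obtain A' where A': "A' \<in> snd (p (q W)) i" "A = {x \<in> A'. f x \<in> Y closure_of W}"
      using Wi by (auto simp: fam_def)
    then obtain G where "G \<in> \<G>" "{x \<in> A'. f x \<in> fst (p (q W))} \<subseteq> G"
      using PW(4)[OF Wi(1,2)] by blast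
    then show ?thesis
      using A'(2) q[OF Wi(1)] by blast
  qed
  have famcl: "closedin X A" if Wi: "W \<in> \<O>" "i < N" "A \<in> fam W i" for W i A
  proof -
    obtain A' where A': "A' \<in> snd (p (q W)) i" "A = {x \<in> A'. f x \<in> Y closure_of W}"
      using Wi by (auto simp: fam_def)
    then have cl: "closedin X A'"
      using PW(3)[OF Wi(1,2)] by blast
    have "closedin X {x \<in> topspace X. f x \<in> Y closure_of W}"
      using f by (intro closedin_continuous_map_preimage) (auto simp: perfect_map_def)
    moreover have "A = A' \<inter> {x \<in> topspace X. f x \<in> Y closure_of W}"
      using A'(2) closedin_subset[OF cl] by blast
    ultimately show ?thesis
      using cl by (simp add: closedin_Int)
  qed
  have famdis: "pairwise disjnt (fam W i)" if Wi: "W \<in> \<O>" "i < N" for W i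
  proof (rule pairwiseI)
    fix A B assume AB: "A \<in> fam W i" "B \<in> fam W i" "A \<noteq> B"
    then obtain A' B' where "A' \<in> snd (p (q W)) i" "B' \<in> snd (p (q W)) i" "A \<subseteq> A'" "B \<subseteq> B'" "A' \<noteq> B'"
      unfolding fam_def by blast
    then show "disjnt A B"
      using PW(2)[OF Wi] by (meson disjnt_subset1 disjnt_subset2 pairwiseD)
  qed
  have "\<forall>A\<in>\<AA>. \<exists>G. G \<in> \<G> \<and> A \<subseteq> G"
    using famG unfolding \<AA>_def by blast
  then obtain G where G: "\<And>A. A \<in> \<AA> \<Longrightarrow> G A \<in> \<G> \<and> A \<subseteq> G A"
    by metis
  have clA: "closedin X A" if "A \<in> \<AA>" for A
    using that famcl unfolding \<AA>_def by blast
  have opG: "openin X U" if "U \<in> \<G>" for U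
    using \<G> that unfolding open_cover_def by blast
  \<comment> \<open>\<open>D\<close> has a centre: every member of \<open>\<AA>\<close> that
    \<open>D\<close> meets contains it. Hence \<open>D\<close> cannot meet two members of a disjoint
    family, and it lies in the chosen \<open>G A\<close> of each member \<open>A\<close> that it
    meets.\<close>
  define small where "small D \<longleftrightarrow> openin X D \<and> (\<exists>U\<in>\<G>. D \<subseteq> U) \<and> (\<exists>x\<in>D. \<forall>A\<in>\<AA>. (x \<in> A \<longrightarrow> D \<subseteq> G A) \<and> (x \<notin> A \<longrightarrow> D \<inter> A = {}))" for D
  have smallD: "\<exists>x. \<forall>A\<in>\<AA>. D \<inter> A \<noteq> {} \<longrightarrow> x \<in> A \<and> D \<subseteq> G A" if "small D" for D
    using that unfolding small_def by fast
  have ex_small: "\<exists>D. small D \<and> x \<in> D" if x: "x \<in> topspace X" for x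
  proof -
    obtain T where T: "openin Y T" "f x \<in> T" "finite {W \<in> \<O>. W \<inter> T \<noteq> {}}"
      using \<O>(2) fY[OF x] unfolding locally_finite_in_def by blast
    \<comment> \<open>Only these finitely many members matter: for any other \<open>W\<close> the
      open set \<open>T\<close> misses \<open>W\<close>, hence its closure, so the preimage of
      \<open>T\<close> misses the sets of \<open>fam W i\<close>.\<close>
    define \<BB> where "\<BB> = (\<Union>W\<in>{W \<in> \<O>. W \<inter> T \<noteq> {}}. \<Union>i<N. fam W i)"
    have finB: "finite \<BB>"
      unfolding \<BB>_def using T(3) famfin by blast
    have BA: "\<BB> \<subseteq> \<AA>"
      by (auto simp: \<BB>_def \<AA>_def)
    obtain U where U: "U \<in> \<G>" "x \<in> U"
      using \<G> x by (auto simp: open_cover_def)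
    define D where "D = {z \<in> U \<inter> {z \<in> topspace X. f z \<in> T}. \<forall>A\<in>\<BB>. z \<in> (if x \<in> A then G A else topspace X - A)}"
    have "openin X D"
      unfolding D_def
    proof (rule openin_finite_conditions[OF _ finB])
      show "openin X (U \<inter> {z \<in> topspace X. f z \<in> T})"
        using f T(1) opG[OF U(1)] by (intro openin_Int openin_continuous_map_preimage) (auto simp: perfect_map_def)
      show "openin X (if x \<in> A then G A else topspace X - A)" if "A \<in> \<BB>" for A
      proof -
        have "A \<in> \<AA>"
          using that BA by blast
        then show ?thesis
          using opG G clA by (simp add: openin_diff)
      qed
    qed
    moreover have "x \<in> D"
      using x U T(2) G BA by (auto simp: D_def)
    moreover have "D \<subseteq> U"
      by (auto simp: D_def)
    moreover have "(x \<in> A \<longrightarrow> D \<subseteq> G A) \<and> (x \<notin> A \<longrightarrow> D \<inter> A = {})" if A: "A \<in> \<AA>" for A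
    proof (cases "A \<in> \<BB>")
      case True
      then have "\<forall>z\<in>D. z \<in> (if x \<in> A then G A else topspace X - A)"
        unfolding D_def by blast
      then show ?thesis
        by (cases "x \<in> A") auto
    next
      case False
      obtain W i where W: "W \<in> \<O>" "i < N" "A \<in> fam W i"
        using A by (auto simp: \<AA>_def)
      then have "W \<inter> T = {}"
        using False by (auto simp: \<BB>_def)
      then have "Y closure_of W \<inter> T = {}"
        using openin_Int_closure_of_eq_empty[OF T(1), of W] by blast
      then have "D \<inter> A = {}"
        using W(3) unfolding D_def fam_def by blast
      then show ?thesis
        using \<open>x \<in> D\<close> by blast
    qed
    ultimately show ?thesis
      using U(1) unfolding small_def by blast
  qed
  show ?thesis
  proof (intro exI conjI)
    show "fibrewise_families X Y f N n \<C>"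
      unfolding fibrewise_families_def
    proof (intro conjI ballI impI)
      fix y assume "y \<in> topspace Y"
      then obtain W where "W \<in> \<O>" "y \<in> W"
        using \<O>(1) by (auto simp: open_cover_def)
      moreover from this have "W \<subseteq> Y interior_of (Y closure_of W)"
        using \<O>(1) closure_of_subset[of W Y] openin_subset[of Y W]
        by (intro interior_of_maximal) (auto simp: open_cover_def)
      ultimately show "\<exists>c\<in>\<C>. y \<in> Y interior_of fst c"
        by (auto simp: \<C>_def)
    next
      fix c x assume c: "c \<in> \<C>" and x: "x \<in> topspace X" "f x \<in> fst c"
      then obtain W where W: "W \<in> \<O>" "c = (Y closure_of W, fam W)"
        by (auto simp: \<C>_def)
      have "\<forall>x\<in>topspace X. f x \<in> fst (p (q W)) \<longrightarrow> card {i. i < N \<and> x \<notin> \<Union>(snd (p (q W)) i)} \<le> n"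
        using p[of "q W"] q[OF W(1)] by (simp add: P_def)
      then have "card {i. i < N \<and> x \<notin> \<Union>(snd (p (q W)) i)} \<le> n"
        using x q[OF W(1)] W(2) by auto
      moreover have "{i. i < N \<and> x \<notin> \<Union>(snd c i)} = {i. i < N \<and> x \<notin> \<Union>(snd (p (q W)) i)}"
        using W(2) x(2) by (auto simp: fam_def)
      ultimately show "card {i. i < N \<and> x \<notin> \<Union>(snd c i)} \<le> n"
        by simp
    qed
    show "open_cover X {D. small D}"
      unfolding open_cover_def
    proof (intro conjI ballI subset_antisym subsetI)
      fix x assume "x \<in> \<Union>{D. small D}"
      then show "x \<in> topspace X"
        using openin_subset[of X] by (auto simp: small_def)
    next
      fix x assume "x \<in> topspace X"
      then show "x \<in> \<Union>{D. small D}"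
        using ex_small by blast
    qed (simp add: small_def)
    show "refines {D. small D} \<G>"
      by (auto simp: refines_def small_def)
    show "\<forall>c\<in>\<C>. \<forall>i<N. absorbable X \<G> {D. small D} (snd c i)"
    proof (intro ballI allI impI)
      fix c i assume c: "c \<in> \<C>" and i: "i < N"
      then obtain W where W: "W \<in> \<O>" "c = (Y closure_of W, fam W)"
        by (auto simp: \<C>_def)
      have AA: "A \<in> \<AA>" if "A \<in> fam W i" for A
        using that W(1) i by (auto simp: \<AA>_def)
      show "absorbable X \<G> {D. small D} (snd c i)"
        unfolding absorbable_def W(2) snd_conv
      proof (intro conjI ballI impI)
        fix A assume A: "A \<in> fam W i"
        have "D \<subseteq> G A" if "small D" "D \<inter> A \<noteq> {}" for D
          using smallD[OF that(1)] that(2) AA[OF A] by blast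
        then show "\<exists>G\<in>\<G>. A \<subseteq> G \<and> (\<forall>D\<in>{D. small D}. D \<inter> A \<noteq> {} \<longrightarrow> D \<subseteq> G)"
          using G[OF AA[OF A]] by (intro bexI[of _ "G A"]) auto
        show "closedin X A"
          by (rule clA[OF AA[OF A]])
      next
        fix D A A' assume D: "D \<in> {D. small D}" and A: "A \<in> fam W i" "A' \<in> fam W i"
          "D \<inter> A \<noteq> {} \<and> D \<inter> A' \<noteq> {}"
        then obtain x where "x \<in> A" "x \<in> A'"
          using smallD[of D] D AA[OF A(1)] AA[OF A(2)] by blast
        then show "A = A'"
          using famdis[OF W(1) i] A(1,2) by (auto simp: pairwise_def disjnt_def)
      qed (use famfin famdis W i in auto)
    qed
  qed
qed

text \<open>Scale 0 is the coarsest. The remaining scales are built for the cover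
  \<open>\<G>'\<close> returned with it, so their merged family refines \<open>\<G>'\<close> and can
  be absorbed. The statement allows any set \<open>P\<close> of scales and any choice
  \<open>ch\<close> because over different parts of \<open>Y\<close> different scales and different
  local families are present.\<close>

lemma many_scales:
  fixes X :: "'a topology" and Y :: "'b topology" and N n r :: nat
  assumes X: "normal_space X" "Hausdorff_space X" and Y: "paracompact_space Y" and f: "perfect_map X Y f"
    and dim: "map_dim_le X Y f n" and \<G>: "open_cover X \<G>"
  shows "\<exists>\<C>. (\<forall>p<r. fibrewise_families X Y f N n (\<C> p)) \<and>
    (\<forall>i<N. \<forall>P\<subseteq>{..<r}. \<forall>ch. (\<forall>p\<in>P. ch p \<in> \<C> p) \<longrightarrow>
      (\<exists>\<F>. finite \<F> \<and> pairwise disjnt \<F> \<and> (\<forall>F\<in>\<F>. closedin X F) \<and> refines \<F> \<G> \<and>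
          (\<forall>p\<in>P. refines (snd (ch p) i) \<F>)))"
  using \<G>
proof (induction r arbitrary: \<G>)
  case 0
  then show ?case
    by (auto intro!: exI[of _ "{}"] simp: refines_def)
next
  case (Suc r)
  obtain \<C>0 \<G>' where C0: "fibrewise_families X Y f N n \<C>0" "open_cover X \<G>'" "refines \<G>' \<G>"
    "\<And>c i. c \<in> \<C>0 \<Longrightarrow> i < N \<Longrightarrow> absorbable X \<G> \<G>' (snd c i)"
    using one_scale[OF X Y f dim Suc.prems, of N] by blast
  obtain \<C>1 where C1: "\<And>p. p < r \<Longrightarrow> fibrewise_families X Y f N n (\<C>1 p)"
    and M1: "\<And>i P ch. \<lbrakk>i < N; P \<subseteq> {..<r}; \<forall>p\<in>P. ch p \<in> \<C>1 p\<rbrakk> \<Longrightarrow>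
      \<exists>\<F>. finite \<F> \<and> pairwise disjnt \<F> \<and> (\<forall>F\<in>\<F>. closedin X F) \<and> refines \<F> \<G>' \<and>
          (\<forall>p\<in>P. refines (snd (ch p) i) \<F>)"
    using Suc.IH[OF C0(2)] by metis
  show ?case
  proof (intro exI[of _ "case_nat \<C>0 \<C>1"] conjI allI impI)
    fix p assume "p < Suc r"
    then show "fibrewise_families X Y f N n (case_nat \<C>0 \<C>1 p)"
      using C0(1) C1 by (cases p) auto
  next
    fix i P ch assume i: "i < N" and P: "P \<subseteq> {..<Suc r}" and ch: "\<forall>p\<in>P. ch p \<in> case_nat \<C>0 \<C>1 p"
    define P' where "P' = {p. Suc p \<in> P}"
    have P': "P' \<subseteq> {..<r}" "\<forall>p\<in>P'. ch (Suc p) \<in> \<C>1 p"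
      using P ch by (force simp: P'_def)+
    obtain \<F> where \<F>: "finite \<F>" "pairwise disjnt \<F>" "\<forall>F\<in>\<F>. closedin X F" "refines \<F> \<G>'"
          "\<forall>p\<in>P'. refines (snd (ch (Suc p)) i) \<F>"
      using M1[OF i P'] by blast
    have trans: "refines \<A> \<D>" if "refines \<A> \<B>" "refines \<B> \<D>" for \<A> \<B> \<D> :: "'a set set"
      using that unfolding refines_def by (meson order_trans)
    show "\<exists>\<F>. finite \<F> \<and> pairwise disjnt \<F> \<and> (\<forall>F\<in>\<F>. closedin X F) \<and> refines \<F> \<G> \<and>
          (\<forall>p\<in>P. refines (snd (ch p) i) \<F>)"
    proof (cases "0 \<in> P")
      case True
      then have "ch 0 \<in> \<C>0"
        using ch by force
      then obtain \<F>' where \<F>': "finite \<F>'" "pairwise disjnt \<F>'" "\<forall>F\<in>\<F>'. closedin X F" "refines \<F>' \<G>"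
          "refines (snd (ch 0) i) \<F>'" "refines \<F> \<F>'"
        using absorb[OF C0(4) C0(3) \<F>(1,2) _ \<F>(4)] i \<F>(3) by blast
      have "refines (snd (ch p) i) \<F>'" if "p \<in> P" for p
        using that \<F>'(5) \<F>(5) trans[OF _ \<F>'(6)] by (cases p) (auto simp: P'_def)
      then show ?thesis
        using \<F>' by blast
    next
      case False
      have "refines (snd (ch p) i) \<F>" if "p \<in> P" for p
        using that False \<F>(5) by (cases p) (auto simp: P'_def)
      then show ?thesis
        using \<F> trans[OF \<F>(4) C0(3)] by blast
    qed
  qed
qed


section \<open>Ostrand families of a finite-dimensional paracompact space\<close>

text \<open>\<open>W B\<close> is where the functions indexed by \<open>B\<close> strictly dominate
  all the others, the analogue of the open star of the barycentre of the simplex \<open>B\<close> in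
  the nerve. Distinct sets of equal finite size are incomparable, so their dominance conditions
  contradict each other: the stars can be coloured by the size of \<open>B\<close>.\<close>

lemma sigma_disjoint_refinement:
  assumes Y: "paracompact_space Y" and \<omega>: "open_cover Y \<omega>"
  shows "\<exists>\<W> :: nat \<Rightarrow> 'b set set. (\<forall>k. (\<forall>W\<in>\<W> k. openin Y W) \<and> pairwise disjnt (\<W> k) \<and> refines (\<W> k) \<omega>) \<and>
    (\<Union>k. \<Union>(\<W> k)) = topspace (Y :: 'b topology)"
proof -
  obtain \<V> where \<V>: "open_cover Y \<V>" "refines \<V> \<omega>" "locally_finite_in Y \<V>"
    using Y \<omega> unfolding paracompact_space_def by blast
  have "\<exists>u :: 'b set \<Rightarrow> 'b \<Rightarrow> real. (\<forall>V\<in>\<V>. continuous_map Y euclideanreal (u V)) \<and>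
    (\<forall>V\<in>\<V>. \<forall>x\<in>topspace Y. u V x \<in> {0..1}) \<and> (\<forall>V\<in>\<V>. \<forall>x\<in>topspace Y. x \<notin> V \<longrightarrow> u V x = 0) \<and>
    (\<forall>x\<in>topspace Y. \<exists>V\<in>\<V>. x \<in> V \<and> u V x = 1)"
    using paracompact_Urysohn_family[OF Y, of \<V> "\<lambda>V. V"] \<V>(1) unfolding open_cover_def by auto
  then obtain u :: "'b set \<Rightarrow> 'b \<Rightarrow> real" where u: "\<forall>V\<in>\<V>. continuous_map Y euclideanreal (u V)"
    "\<forall>V\<in>\<V>. \<forall>x\<in>topspace Y. u V x \<in> {0..1}" "\<forall>V\<in>\<V>. \<forall>x\<in>topspace Y. x \<notin> V \<longrightarrow> u V x = 0"
    "\<forall>x\<in>topspace Y. \<exists>V\<in>\<V>. x \<in> V \<and> u V x = 1"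
    by blast
  define W where "W B = {y \<in> topspace Y. \<forall>V\<in>B. 0 < u V y \<and> (\<forall>V'\<in>\<V> - B. u V' y < u V y)}" for B
  define \<W> where "\<W> k = W ` {B. B \<subseteq> \<V> \<and> finite B \<and> B \<noteq> {} \<and> card B = k}" for k
  have opW: "openin Y (W B)" if B: "B \<subseteq> \<V>" "finite B" "B \<noteq> {}" for B
  proof (subst openin_subopen, rule ballI)
    fix y assume y: "y \<in> W B"
    then have yY: "y \<in> topspace Y"
      by (simp add: W_def)
    obtain T where T: "openin Y T" "y \<in> T" "finite {V \<in> \<V>. V \<inter> T \<noteq> {}}"
      using \<V>(3) yY unfolding locally_finite_in_def by blast
    \<comment> \<open>Outside \<open>R\<close> the comparison is automatic on \<open>T\<close>: such
      functions vanish there, while those of \<open>B\<close> are positive. This leaves finitely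
      many open conditions.\<close>
    define R where "R = {V \<in> \<V>. V \<inter> T \<noteq> {}} - B"
    define S where "S = (\<lambda>(V, V'). {z \<in> topspace Y. u V z - u V' z \<in> {0<..}})"
    define S0 where "S0 V = {z \<in> topspace Y. u V z \<in> {0<..}}" for V
    define D where "D = {z \<in> {z \<in> T. \<forall>V\<in>B. z \<in> S0 V}. \<forall>p\<in>B \<times> R. z \<in> S p}"
    have "openin Y (S0 V)" if "V \<in> B" for V
      unfolding S0_def using u(1) B(1) that by (intro openin_continuous_map_preimage) auto
    moreover have "openin Y (S p)" if p: "p \<in> B \<times> R" for p
    proof -
      obtain V V' where V: "p = (V, V')" "V \<in> \<V>" "V' \<in> \<V>"
        using p B(1) by (auto simp: R_def)
      have "continuous_map Y euclideanreal (\<lambda>z. u V z - u V' z)"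
        using u(1) V(2,3) by (intro continuous_intros) auto
      then show ?thesis
        unfolding S_def V(1) by (simp only: prod.case) (rule openin_continuous_map_preimage, auto)
    qed
    ultimately have "openin Y D"
      unfolding D_def using T B(2) by (intro openin_finite_conditions) (auto simp: R_def)
    moreover have "y \<in> D"
      using y T(2) by (auto simp: D_def S_def S0_def R_def W_def)
    moreover have "D \<subseteq> W B"
    proof
      fix z assume z: "z \<in> D"
      then have zT: "z \<in> T" "z \<in> topspace Y"
        using T(1) openin_subset by (auto simp: D_def)
      have pos: "0 < u V z" if "V \<in> B" for V
        using z that by (auto simp: D_def S0_def)
      have "u V' z < u V z" if "V \<in> B" "V' \<in> \<V> - B" for V V'
      proof (cases "V' \<in> R")
        case True
        then have "z \<in> S (V, V')"
          using z that(1) by (auto simp: D_def)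
        then show ?thesis
          by (simp add: S_def)
      next
        case False
        then have "z \<notin> V'"
          using that(2) zT(1) by (auto simp: R_def)
        then show ?thesis
          using u(3) that zT(2) pos[OF that(1)] by simp
      qed
      then show "z \<in> W B"
        using pos zT(2) by (simp add: W_def)
    qed
    ultimately show "\<exists>T. openin Y T \<and> y \<in> T \<and> T \<subseteq> W B"
      by blast
  qed
  have WV: "W B \<subseteq> V" if "B \<subseteq> \<V>" "V \<in> B" for B V
    using that u(3) by (force simp: W_def)
  have dis: "W B \<inter> W B' = {}" if B: "B \<subseteq> \<V>" "finite B" "B' \<subseteq> \<V>" "finite B'" "card B = card B'" "B \<noteq> B'" for B B'
  proof -
    have "\<not> B \<subseteq> B'" "\<not> B' \<subseteq> B"
      using card_subset_eq[of B' B] card_subset_eq[of B B'] B by auto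
    then obtain V V' where V: "V \<in> B" "V \<notin> B'" "V' \<in> B'" "V' \<notin> B"
      by blast
    have "u V' y < u V y" if "y \<in> W B" for y
      using that V B by (auto simp: W_def)
    moreover have "u V y < u V' y" if "y \<in> W B'" for y
      using that V B by (auto simp: W_def)
    ultimately show ?thesis
      by (meson disjoint_iff less_asym)
  qed
  show ?thesis
  proof (intro exI conjI allI)
    fix k
    show "\<forall>W\<in>\<W> k. openin Y W"
      using opW by (auto simp: \<W>_def)
    show "pairwise disjnt (\<W> k)"
    proof (rule pairwiseI)
      fix S T assume "S \<in> \<W> k" "T \<in> \<W> k" "S \<noteq> T"
      moreover from this obtain B where B: "B \<subseteq> \<V>" "finite B" "card B = k" "S = W B"
        by (auto simp: \<W>_def)
      moreover from calculation obtain B' where B': "B' \<subseteq> \<V>" "finite B'" "card B' = k" "T = W B'"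
        by (auto simp: \<W>_def)
      ultimately show "disjnt S T"
        using dis[of B B'] by (auto simp: disjnt_def)
    qed
    show "refines (\<W> k) \<omega>"
      unfolding refines_def
    proof
      fix S assume "S \<in> \<W> k"
      then obtain B V where "B \<subseteq> \<V>" "V \<in> B" "S = W B"
        by (auto simp: \<W>_def)
      then have "S \<subseteq> V" "V \<in> \<V>"
        using WV by auto
      then show "\<exists>U\<in>\<omega>. S \<subseteq> U"
        using \<V>(2) unfolding refines_def by (meson order_trans)
    qed
  next
    show "(\<Union>k. \<Union>(\<W> k)) = topspace Y"
    proof (intro subset_antisym subsetI)
      fix y assume y: "y \<in> topspace Y"
      \<comment> \<open>The functions attaining 1 at \<open>y\<close> dominate all others; they are
        finitely many by local finiteness and at least one by the choice of
        \<open>u\<close>.\<close>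
      define B where "B = {V \<in> \<V>. u V y = 1}"
      obtain T where T: "openin Y T" "y \<in> T" "finite {V \<in> \<V>. V \<inter> T \<noteq> {}}"
        using \<V>(3) y unfolding locally_finite_in_def by blast
      have "B \<subseteq> {V \<in> \<V>. V \<inter> T \<noteq> {}}"
      proof
        fix V assume "V \<in> B"
        then have "V \<in> \<V>" "u V y \<noteq> 0"
          by (auto simp: B_def)
        then show "V \<in> {V \<in> \<V>. V \<inter> T \<noteq> {}}"
          using u(3) y T(2) by blast
      qed
      then have "finite B"
        using T(3) finite_subset by blast
      moreover have "B \<subseteq> \<V>" "B \<noteq> {}"
        using u(4) y by (auto simp: B_def)
      moreover have "y \<in> W B"
        using u(2) y by (auto simp: W_def B_def order_less_le)
      ultimately show "y \<in> (\<Union>k. \<Union>(\<W> k))"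
        by (auto simp: \<W>_def)
    qed (auto simp: \<W>_def W_def)
  qed
qed

text \<open>Dowker's argument: a finite cover of the whole space yields the order bound on one strip
  \<open>j \<le> \<phi> \<le> j + 1\<close>, and strips of the same parity can be treated simultaneously.\<close>

lemma shrink_on_strips:
  fixes Y :: "'b topology" and Q :: "nat \<Rightarrow> 'b set" and b :: bool and m :: nat
  assumes dim: "covering_dim_le Y m" and \<phi>: "continuous_map Y euclideanreal \<phi>"
    and Q: "\<And>k. openin Y (Q k)" "\<And>k y. y \<in> Q k \<Longrightarrow> real k < \<phi> y" "topspace Y \<subseteq> (\<Union>k. Q k)"
  shows "\<exists>R. (\<forall>k. openin Y (R k) \<and> R k \<subseteq> Q k) \<and> topspace Y \<subseteq> (\<Union>k. R k) \<and>
    (\<forall>j y. even j = b \<longrightarrow> y \<in> topspace Y \<longrightarrow> real j \<le> \<phi> y \<longrightarrow> \<phi> y \<le> real j + 1 \<longrightarrow> card {k. y \<in> R k} \<le> m + 1)"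
proof -
  define S where "S j = {y \<in> topspace Y. \<phi> y \<in> {real j..real j + 1}}" for j
  \<comment> \<open>The margin 1/2 makes \<open>M j\<close> a neighbourhood of the strip that is
    still disjoint from every other strip of the same parity.\<close>
  define M where "M j = {y \<in> topspace Y. \<phi> y \<in> {real j - 1/2<..<real j + 3/2}}" for j
  have clS: "closedin Y (S j)" for j
    unfolding S_def by (rule closedin_continuous_map_preimage[OF \<phi>]) auto
  have opM: "openin Y (M j)" for j
    unfolding M_def by (rule openin_continuous_map_preimage[OF \<phi>]) auto
  have SM: "S j \<subseteq> M j" for j
    by (auto simp: S_def M_def)
  have "\<exists>P. (\<forall>k. openin Y (P k) \<and> P k \<subseteq> Q k) \<and> S j \<subseteq> (\<Union>k. P k) \<and> (\<forall>y\<in>S j. card {k. y \<in> P k} \<le> m + 1)" for j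
  proof -
    \<comment> \<open>On the strip \<open>\<phi>\<close> is at most j + 1 and on \<open>Q k\<close>
      it exceeds k, so only the indices up to j matter there; the complement of the strip completes
      a finite cover.\<close>
    define \<U> where "\<U> = insert (topspace Y - S j) (Q ` {..j})"
    have "open_cover Y \<U>"
      unfolding open_cover_def
    proof (intro conjI ballI subset_antisym subsetI)
      fix U assume "U \<in> \<U>"
      then show "openin Y U"
        using Q(1) clS by (auto simp: \<U>_def)
    next
      fix y assume "y \<in> \<Union>\<U>"
      then show "y \<in> topspace Y"
        using Q(1) openin_subset by (fastforce simp: \<U>_def)
    next
      fix y assume y: "y \<in> topspace Y"
      obtain k where k: "y \<in> Q k"
        using Q(3) y by blast
      show "y \<in> \<Union>\<U>"
      proof (cases "y \<in> S j")
        case True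
        then have "real k < real j + 1"
          using Q(2)[OF k] by (simp add: S_def)
        then show ?thesis
          using k by (auto simp: \<U>_def)
      qed (use y in \<open>auto simp: \<U>_def\<close>)
    qed
    moreover have "finite \<U>"
      by (simp add: \<U>_def)
    ultimately obtain \<V> where \<V>: "finite \<V>" "open_cover Y \<V>" "refines \<V> \<U>"
        "\<forall>y\<in>topspace Y. card {V \<in> \<V>. y \<in> V} \<le> m + 1"
      using dim unfolding covering_dim_le_def by blast
    \<comment> \<open>A member meeting the strip is not inside its complement, hence lies in some
      \<open>Q k\<close>. Assigning it to one such index makes the number of sets \<open>P k\<close>
      through a point at most the number of members through it.\<close>
    define \<V>' where "\<V>' = {V \<in> \<V>. \<exists>k. V \<subseteq> Q k}"
    have "\<forall>V\<in>\<V>'. \<exists>k. V \<subseteq> Q k"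
      by (auto simp: \<V>'_def)
    then obtain a where a: "\<And>V. V \<in> \<V>' \<Longrightarrow> V \<subseteq> Q (a V)"
      by metis
    define P where "P k = \<Union>{V \<in> \<V>'. a V = k}" for k
    show ?thesis
    proof (intro exI conjI allI ballI)
      fix k
      show "openin Y (P k)"
        using \<V>(2) unfolding P_def \<V>'_def open_cover_def by (intro openin_Union) auto
      show "P k \<subseteq> Q k"
        using a by (auto simp: P_def)
    next
      show "S j \<subseteq> (\<Union>k. P k)"
      proof
        fix y assume y: "y \<in> S j"
        then obtain V where V: "V \<in> \<V>" "y \<in> V"
          using \<V>(2) by (auto simp: open_cover_def S_def)
        then obtain U where "U \<in> \<U>" "V \<subseteq> U"
          using \<V>(3) by (auto simp: refines_def)
        then have "V \<in> \<V>'"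
          using V y by (auto simp: \<U>_def \<V>'_def)
        then show "y \<in> (\<Union>k. P k)"
          using V(2) by (auto simp: P_def)
      qed
    next
      fix y assume y: "y \<in> S j"
      have fin: "finite {V \<in> \<V>. y \<in> V}"
        using \<V>(1) by simp
      have "{k. y \<in> P k} \<subseteq> a ` {V \<in> \<V>. y \<in> V}"
        by (auto simp: P_def \<V>'_def)
      then have "card {k. y \<in> P k} \<le> card {V \<in> \<V>. y \<in> V}"
        using fin by (rule surj_card_le[rotated])
      also have "\<dots> \<le> m + 1"
        using \<V>(4) y by (simp add: S_def)
      finally show "card {k. y \<in> P k} \<le> m + 1" .
    qed
  qed
  then obtain P where P: "\<And>j k. openin Y (P j k)" "\<And>j k. P j k \<subseteq> Q k" "\<And>j. S j \<subseteq> (\<Union>k. P j k)"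
      "\<And>j y. y \<in> S j \<Longrightarrow> card {k. y \<in> P j k} \<le> m + 1"
    by metis
  define J where "J = {j :: nat. even j = b}"
  define E where "E = \<Union>(S ` J)"
  \<comment> \<open>Away from the strips of this parity nothing is changed. A point of strip j lies
    in \<open>E\<close> and in no other \<open>M i\<close> with i in \<open>J\<close>, so there only
    the sets \<open>P j k\<close> count.\<close>
  define R where "R k = (Q k - E) \<union> (\<Union>j\<in>J. P j k \<inter> M j)" for k
  have clE: "closedin Y E"
    unfolding E_def
  proof (rule closedin_locally_finite_Union)
    show "locally_finite_in Y (S ` J)"
      unfolding locally_finite_in_def
    proof (intro conjI ballI)
      fix y assume y: "y \<in> topspace Y"
      let ?T = "{z \<in> topspace Y. \<phi> z \<in> {..<\<phi> y + 1}}"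
      have "j \<le> nat \<lceil>\<phi> y + 1\<rceil>" if "S j \<inter> ?T \<noteq> {}" for j
        using that by (auto simp: S_def) linarith
      then have "{U \<in> S ` J. U \<inter> ?T \<noteq> {}} \<subseteq> S ` {..nat \<lceil>\<phi> y + 1\<rceil>}"
        by auto
      then have "finite {U \<in> S ` J. U \<inter> ?T \<noteq> {}}"
        by (rule finite_subset) simp
      moreover have "openin Y ?T"
        by (rule openin_continuous_map_preimage[OF \<phi>]) auto
      ultimately show "\<exists>T. openin Y T \<and> y \<in> T \<and> finite {U \<in> S ` J. U \<inter> T \<noteq> {}}"
        using y by (intro exI[of _ ?T]) auto
    qed (auto simp: S_def)
  qed (use clS in auto)
  show ?thesis
  proof (intro exI conjI allI impI)
    fix k
    show "openin Y (R k)"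
      unfolding R_def using Q(1) P(1) opM clE by (intro openin_Un openin_diff openin_Union) auto
    show "R k \<subseteq> Q k"
      using P(2) by (auto simp: R_def)
  next
    show "topspace Y \<subseteq> (\<Union>k. R k)"
    proof
      fix y assume y: "y \<in> topspace Y"
      show "y \<in> (\<Union>k. R k)"
      proof (cases "y \<in> E")
        case True
        then obtain j where j: "j \<in> J" "y \<in> S j"
          by (auto simp: E_def)
        then show ?thesis
        proof -
          obtain k where "y \<in> P j k"
            using P(3)[of j] j(2) by blast
          then have "y \<in> R k"
            using j SM[of j] unfolding R_def by blast
          then show ?thesis
            by blast
        qed
      next
        case False
        then show ?thesis
          using Q(3) y unfolding R_def by blast
      qed
    qed
  next
    fix j y assume j: "even j = b" and y: "y \<in> topspace Y" "real j \<le> \<phi> y" "\<phi> y \<le> real j + 1"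
    then have yS: "y \<in> S j" "j \<in> J"
      by (auto simp: S_def J_def)
    have "i = j" if i: "i \<in> J" "y \<in> M i" for i
    proof (rule ccontr)
      assume "i \<noteq> j"
      moreover have "even i = even j"
        using i(1) j by (auto simp: J_def)
      ultimately have "i + 2 \<le> j \<or> j + 2 \<le> i"
        by presburger
      then have "real i + 2 \<le> real j \<or> real j + 2 \<le> real i"
        by linarith
      then show False
        using i(2) y by (auto simp: M_def)
    qed
    then have "{k. y \<in> R k} \<subseteq> {k. y \<in> P j k}"
      using yS by (auto simp: R_def E_def)
    moreover have "finite {k. y \<in> P j k}"
    proof (rule finite_subset)
      show "{k. y \<in> P j k} \<subseteq> {..j}"
        using P(2) Q(2) y(3) by fastforce
    qed simp
    ultimately have "card {k. y \<in> R k} \<le> card {k. y \<in> P j k}"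
      by (intro card_mono)
    then show "card {k. y \<in> R k} \<le> m + 1"
      using P(4)[OF yS(1)] by linarith
  qed
qed

text \<open>Extends the order bound from finite covers, which define the dimension, to countable
  ones. Even strips are treated before odd ones, and the second shrinking cannot raise the
  multiplicity reached by the first. The local finiteness also makes the counted sets finite, so
  that \<open>card\<close> is a genuine bound.\<close>

lemma countable_cover_shrinking:
  fixes Y :: "'b topology" and P :: "nat \<Rightarrow> 'b set" and m :: nat
  assumes Y: "paracompact_space Y" and dim: "covering_dim_le Y m"
    and P: "\<And>k. openin Y (P k)" "topspace Y \<subseteq> (\<Union>k. P k)"
  shows "\<exists>R. (\<forall>k. openin Y (R k) \<and> R k \<subseteq> P k) \<and> topspace Y \<subseteq> (\<Union>k. R k) \<and>
    (\<forall>y\<in>topspace Y. \<exists>T. openin Y T \<and> y \<in> T \<and> finite {k. R k \<inter> T \<noteq> {}}) \<and>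
    (\<forall>y\<in>topspace Y. card {k. y \<in> R k} \<le> m + 1)"
proof -
  have "\<exists>\<phi>. continuous_map Y euclideanreal \<phi> \<and>
    (\<forall>y\<in>topspace Y. \<exists>i\<in>UNIV. y \<in> P i \<and> \<phi> y \<le> real i + 1) \<and>
    (\<forall>y\<in>topspace Y. \<exists>i\<in>UNIV. y \<in> P i \<and> real i + 1 \<le> \<phi> y)"
    by (rule paracompact_insertion[OF Y]) (use P in auto)
  then obtain \<phi> where \<phi>: "continuous_map Y euclideanreal \<phi>" "\<And>y. y \<in> topspace Y \<Longrightarrow> \<exists>i. y \<in> P i \<and> real i + 1 \<le> \<phi> y"
    by blast
  \<comment> \<open>Some i with \<open>y\<close> in \<open>P i\<close> satisfies i + 1 \<le>
    \<open>\<phi> y\<close>, so these sets still cover; and \<open>\<phi>\<close> is locally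
    bounded, so they are locally finite.\<close>
  define Q0 where "Q0 k = P k \<inter> {y \<in> topspace Y. \<phi> y \<in> {real k<..}}" for k
  have Q0: "openin Y (Q0 k)" "y \<in> Q0 k \<Longrightarrow> real k < \<phi> y" "topspace Y \<subseteq> (\<Union>k. Q0 k)" for k y
  proof -
    show "openin Y (Q0 k)"
      unfolding Q0_def by (intro openin_Int P openin_continuous_map_preimage[OF \<phi>(1)]) auto
    show "topspace Y \<subseteq> (\<Union>k. Q0 k)"
      using \<phi>(2) by (fastforce simp: Q0_def)
  qed (simp add: Q0_def)
  obtain Q1 where Q1: "\<And>k. openin Y (Q1 k)" "\<And>k. Q1 k \<subseteq> Q0 k" "topspace Y \<subseteq> (\<Union>k. Q1 k)"
    "\<And>j y. even j = True \<Longrightarrow> y \<in> topspace Y \<Longrightarrow> real j \<le> \<phi> y \<Longrightarrow> \<phi> y \<le> real j + 1 \<Longrightarrow> card {k. y \<in> Q1 k} \<le> m + 1"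
    using shrink_on_strips[OF dim \<phi>(1) Q0, of True] by metis
  have Q1': "y \<in> Q1 k \<Longrightarrow> real k < \<phi> y" for k y
    using Q0(2) Q1(2) by blast
  obtain R where R: "\<And>k. openin Y (R k)" "\<And>k. R k \<subseteq> Q1 k" "topspace Y \<subseteq> (\<Union>k. R k)"
    "\<And>j y. even j = False \<Longrightarrow> y \<in> topspace Y \<Longrightarrow> real j \<le> \<phi> y \<Longrightarrow> \<phi> y \<le> real j + 1 \<Longrightarrow> card {k. y \<in> R k} \<le> m + 1"
    using shrink_on_strips[OF dim \<phi>(1) Q1(1) Q1' Q1(3), of False] by metis
  have fin: "finite {k. Q1 k \<inter> {z \<in> topspace Y. \<phi> z \<in> {..<t}} \<noteq> {}}" for t
  proof (rule finite_subset)
    show "{k. Q1 k \<inter> {z \<in> topspace Y. \<phi> z \<in> {..<t}} \<noteq> {}} \<subseteq> {..nat \<lceil>t\<rceil>}"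
    proof
      fix k assume "k \<in> {k. Q1 k \<inter> {z \<in> topspace Y. \<phi> z \<in> {..<t}} \<noteq> {}}"
      then obtain z where "z \<in> Q1 k" "\<phi> z \<in> {..<t}"
        by blast
      then have "real k < t"
        using Q1' by fastforce
      then show "k \<in> {..nat \<lceil>t\<rceil>}"
        by simp linarith
    qed
  qed simp
  show ?thesis
  proof (intro exI[of _ R] conjI allI ballI)
    fix k
    show "openin Y (R k)" "R k \<subseteq> P k"
      using R(1,2) Q1(2) unfolding Q0_def by blast+
  next
    fix y assume y: "y \<in> topspace Y"
    let ?T = "{z \<in> topspace Y. \<phi> z \<in> {..<\<phi> y + 1}}"
    have "openin Y ?T"
      by (rule openin_continuous_map_preimage[OF \<phi>(1)]) auto
    moreover have "finite {k. R k \<inter> ?T \<noteq> {}}"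
      by (rule finite_subset[OF _ fin]) (use R(2) in blast)
    ultimately show "\<exists>T. openin Y T \<and> y \<in> T \<and> finite {k. R k \<inter> T \<noteq> {}}"
      using y by (intro exI[of _ ?T]) auto
    have "finite {k. y \<in> Q1 k}"
      by (rule finite_subset[OF _ fin[of "\<phi> y + 1"]]) (use y in auto)
    then have le: "card {k. y \<in> R k} \<le> card {k. y \<in> Q1 k}"
      using R(2) by (intro card_mono) auto
    define j where "j = nat \<lfloor>\<phi> y\<rfloor>"
    have "0 \<le> \<phi> y"
      using \<phi>(2)[OF y] by (metis add_nonneg_nonneg of_nat_0_le_iff order_trans zero_le_one)
    then have j: "real j \<le> \<phi> y" "\<phi> y \<le> real j + 1"
      unfolding j_def by linarith+
    show "card {k. y \<in> R k} \<le> m + 1"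
      using R(4)[OF _ y j] Q1(4)[OF _ y j] le by (cases "even j") auto
  qed (rule R(3))
qed

text \<open>A countable cover of order m suffices to run the band argument, but its members are only
  disjoint unions of small sets. Each level cell lies in one such union and is cut into its small
  pieces.\<close>

lemma Ostrand_families:
  fixes Y :: "'b topology" and N m :: nat
  assumes Y: "paracompact_space Y" and dim: "covering_dim_le Y m" and \<omega>: "open_cover Y \<omega>"
  shows "\<exists>\<D>. (\<forall>i<N. (\<forall>D\<in>\<D> i. closedin Y D) \<and> locally_finite_in Y (\<D> i) \<and> pairwise disjnt (\<D> i) \<and>
      refines (\<D> i) \<omega>) \<and> (\<forall>y\<in>topspace Y. card {i. i < N \<and> y \<notin> \<Union>(\<D> i)} \<le> m)"
proof -
  obtain \<W> :: "nat \<Rightarrow> 'b set set" where \<W>: "\<And>k W. W \<in> \<W> k \<Longrightarrow> openin Y W" "\<And>k. pairwise disjnt (\<W> k)"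
    "\<And>k. refines (\<W> k) \<omega>" "(\<Union>k. \<Union>(\<W> k)) = topspace Y"
  proof -
    from sigma_disjoint_refinement[OF Y \<omega>] obtain \<W> :: "nat \<Rightarrow> 'b set set" where
      "\<forall>k. (\<forall>W\<in>\<W> k. openin Y W) \<and> pairwise disjnt (\<W> k) \<and> refines (\<W> k) \<omega>"
      "(\<Union>k. \<Union>(\<W> k)) = topspace Y"
      by (elim exE conjE)
    then show thesis
      by (intro that[of \<W>]) auto
  qed
  have "\<exists>R. (\<forall>k. openin Y (R k) \<and> R k \<subseteq> \<Union>(\<W> k)) \<and> topspace Y \<subseteq> (\<Union>k. R k) \<and>
    (\<forall>y\<in>topspace Y. \<exists>T. openin Y T \<and> y \<in> T \<and> finite {k. R k \<inter> T \<noteq> {}}) \<and>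
    (\<forall>y\<in>topspace Y. card {k. y \<in> R k} \<le> m + 1)"
    by (rule countable_cover_shrinking[OF Y dim]) (use \<W> in auto)
  then obtain R where R: "\<And>k. openin Y (R k)" "\<And>k. R k \<subseteq> \<Union>(\<W> k)" "topspace Y \<subseteq> (\<Union>k. R k)"
    "\<And>y. y \<in> topspace Y \<Longrightarrow> \<exists>T. openin Y T \<and> y \<in> T \<and> finite {k. R k \<inter> T \<noteq> {}}"
    "\<And>y. y \<in> topspace Y \<Longrightarrow> card {k. y \<in> R k} \<le> m + 1"
    by blast
  have "\<exists>u :: nat \<Rightarrow> 'b \<Rightarrow> real. (\<forall>i\<in>UNIV. continuous_map Y euclideanreal (u i)) \<and>
    (\<forall>i\<in>UNIV. \<forall>y\<in>topspace Y. u i y \<in> {0..1}) \<and>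
    (\<forall>i\<in>UNIV. \<forall>y\<in>topspace Y. y \<notin> R i \<longrightarrow> u i y = 0) \<and>
    (\<forall>y\<in>topspace Y. \<exists>i\<in>UNIV. y \<in> R i \<and> u i y = 1)"
    using R(1,3) by (intro paracompact_Urysohn_family[OF Y]) auto
  then obtain u :: "nat \<Rightarrow> 'b \<Rightarrow> real" where u: "\<And>k. continuous_map Y euclideanreal (u k)"
    "\<And>k y. y \<in> topspace Y \<Longrightarrow> y \<notin> R k \<Longrightarrow> u k y = 0" "\<And>y. y \<in> topspace Y \<Longrightarrow> \<exists>k. y \<in> R k \<and> u k y = 1"
    by blast
  have finR: "finite {k. y \<in> R k}" if y: "y \<in> topspace Y" for y
  proof -
    obtain T where "y \<in> T" "finite {k. R k \<inter> T \<noteq> {}}"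
      using R(4)[OF y] by blast
    then show ?thesis
      by (elim finite_subset[rotated]) auto
  qed
  define C where "C i B = topspace Y \<inter> level_cell N u UNIV i B" for i B
  have clC: "closedin Y (C i B)" for i B
    unfolding C_def by (rule closedin_level_cell) (use u in auto)
  have CR: "C i B \<subseteq> R k" if "k \<in> B" for i B k
  proof
    fix y assume y: "y \<in> C i B"
    have "0 < band_hi N i"
      using band_lo_pos[of N i] band_lo_less_hi[of N i] by linarith
    then have "0 < u k y" "y \<in> topspace Y"
      using y that by (auto simp: C_def level_cell_def intro: less_le_trans)
    then show "y \<in> R k"
      using u(2)[of y k] by force
  qed
  \<comment> \<open>\<open>Min B\<close> merely selects a member of \<open>B\<close>. Pieces of
    different cells are disjoint through the band, pieces of one cell through the disjointness of
    \<open>\<W> (Min B)\<close>.\<close>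
  define \<D> where "\<D> i = {C i B \<inter> W | B W. finite B \<and> B \<noteq> {} \<and> W \<in> \<W> (Min B)}" for i
  show ?thesis
  proof (intro exI conjI allI impI ballI)
    fix i assume i: "i < N"
    {
      fix D assume "D \<in> \<D> i"
      then obtain B W where B: "finite B" "B \<noteq> {}" "W \<in> \<W> (Min B)" "D = C i B \<inter> W"
        unfolding \<D>_def by blast
      have "C i B \<subseteq> \<Union>(\<W> (Min B))"
        using CR[OF Min_in[OF B(1,2)]] R(2) by blast
      \<comment> \<open>The cell is covered by the disjoint open sets of
        \<open>\<W> (Min B)\<close>, so intersecting with one of them is the same as removing the
        others; hence the piece is closed.\<close>
      then have "D = C i B - \<Union>(\<W> (Min B) - {W})"
        using \<W>(2)[of "Min B"] B(3,4) by (auto simp: pairwise_def disjnt_def)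
      moreover have "openin Y (\<Union>(\<W> (Min B) - {W}))"
        using \<W>(1) by (intro openin_Union) auto
      ultimately show "closedin Y D"
        using clC by (simp add: closedin_diff)
    }
    show "pairwise disjnt (\<D> i)"
    proof (rule pairwiseI)
      fix D D' assume D: "D \<in> \<D> i" "D' \<in> \<D> i" "D \<noteq> D'"
      then obtain B W B' W' where B: "W \<in> \<W> (Min B)" "D = C i B \<inter> W" "W' \<in> \<W> (Min B')" "D' = C i B' \<inter> W'"
        unfolding \<D>_def by blast
      show "disjnt D D'"
      proof (cases "B = B'")
        case True
        then have "W \<inter> W' = {}"
          using B D(3) \<W>(2)[of "Min B"] by (auto simp: pairwise_def disjnt_def)
        then show ?thesis
          using B by (auto simp: disjnt_def)
      next
        case False
        then have "C i B \<inter> C i B' = {}"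
          using level_cell_disjoint[of B UNIV B' N u i] by (auto simp: C_def)
        then show ?thesis
          using B by (auto simp: disjnt_def)
      qed
    qed
    show "refines (\<D> i) \<omega>"
      unfolding refines_def
    proof
      fix D assume "D \<in> \<D> i"
      then obtain B W where "W \<in> \<W> (Min B)" "D \<subseteq> W"
        unfolding \<D>_def by blast
      then show "\<exists>U\<in>\<omega>. D \<subseteq> U"
        using \<W>(3)[of "Min B"] unfolding refines_def by (meson order_trans)
    qed
    show "locally_finite_in Y (\<D> i)"
      unfolding locally_finite_in_def
    proof (intro conjI ballI)
      show "\<Union>(\<D> i) \<subseteq> topspace Y"
        by (auto simp: \<D>_def C_def)
      fix y assume y: "y \<in> topspace Y"
      obtain T where T: "openin Y T" "y \<in> T" "finite {k. R k \<inter> T \<noteq> {}}"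
        using R(4)[OF y] by blast
      define K where "K = {k. R k \<inter> T \<noteq> {}}"
      \<comment> \<open>A neighbourhood of \<open>y\<close> meeting at most one piece of the cell of
        \<open>B\<close>: the member of \<open>\<W> (Min B)\<close> containing \<open>y\<close>, or
        else the complement of the cell, which then does not contain \<open>y\<close>.\<close>
      define h where "h B = (if y \<in> \<Union>(\<W> (Min B)) then (SOME W. W \<in> \<W> (Min B) \<and> y \<in> W) else topspace Y - C i B)" for B
      have h: "h B \<in> \<W> (Min B) \<and> y \<in> h B" if "y \<in> \<Union>(\<W> (Min B))" for B
        using that someI_ex[of "\<lambda>W. W \<in> \<W> (Min B) \<and> y \<in> W"] by (auto simp: h_def)
      define T' where "T' = {z \<in> T. \<forall>B\<in>Pow K - {{}}. z \<in> h B}"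
      have "openin Y (h B)" for B
        using h[of B] \<W>(1) clC[of i B] by (cases "y \<in> \<Union>(\<W> (Min B))") (auto simp: h_def)
      then have "openin Y T'"
        unfolding T'_def using T by (intro openin_finite_conditions) (auto simp: K_def)
      moreover have "y \<in> T'"
      proof -
        have "y \<in> h B" if B: "B \<in> Pow K - {{}}" for B
        proof (cases "y \<in> \<Union>(\<W> (Min B))")
          case False
          have "finite B"
            using B T(3) by (auto simp: K_def intro: finite_subset)
          then have "C i B \<subseteq> \<Union>(\<W> (Min B))"
            using CR[of "Min B" B i] Min_in[of B] R(2)[of "Min B"] B by blast
          then show ?thesis
            using False y by (auto simp: h_def)
        qed (use h in blast)
        then show ?thesis
          using T(2) by (simp add: T'_def)
      qed
      moreover have "finite {D \<in> \<D> i. D \<inter> T' \<noteq> {}}"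
      proof (rule finite_subset)
        show "finite ((\<lambda>B. C i B \<inter> h B) ` Pow K)"
          using T(3) by (simp add: K_def)
        show "{D \<in> \<D> i. D \<inter> T' \<noteq> {}} \<subseteq> (\<lambda>B. C i B \<inter> h B) ` Pow K"
        proof clarify
          fix D assume D: "D \<in> \<D> i" "D \<inter> T' \<noteq> {}"
          then obtain z where z: "z \<in> D" "z \<in> T'"
            by blast
          obtain B W where B: "finite B" "B \<noteq> {}" "W \<in> \<W> (Min B)" "D = C i B \<inter> W"
            using D unfolding \<D>_def by blast
          have "z \<in> R k" if "k \<in> B" for k
            using CR[OF that, of i] z(1) B(4) by blast
          moreover have "z \<in> T"
            using z(2) by (simp add: T'_def)
          ultimately have BK: "B \<in> Pow K"
            unfolding K_def by blast
          then have zh: "z \<in> h B"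
            using z(2) B(2) by (auto simp: T'_def)
          have "y \<in> \<Union>(\<W> (Min B))"
          proof (rule ccontr)
            assume "y \<notin> \<Union>(\<W> (Min B))"
            then have "z \<notin> C i B"
              using zh by (simp add: h_def)
            then show False
              using z(1) B(4) by simp
          qed
          then have "h B \<in> \<W> (Min B)"
            using h by blast
          then have "h B = W"
            using \<W>(2)[of "Min B"] B(3,4) zh z(1) by (auto simp: pairwise_def disjnt_def)
          then show "D \<in> (\<lambda>B. C i B \<inter> h B) ` Pow K"
            using BK B(4) by blast
        qed
      qed
      ultimately show "\<exists>T. openin Y T \<and> y \<in> T \<and> finite {D \<in> \<D> i. D \<inter> T \<noteq> {}}"
        by blast
    qed
  next
    fix y assume y: "y \<in> topspace Y"
    let ?M = "{i. i < N \<and> (\<exists>k\<in>UNIV. band_lo N i \<le> u k y \<and> u k y \<le> band_hi N i)}"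
    have sub: "{k \<in> UNIV. 0 < u k y} \<subseteq> {k. y \<in> R k}"
      using u(2)[OF y] by force
    have "card ?M \<le> m"
    proof (rule card_bands_hit)
      show "finite {k \<in> UNIV. 0 < u k y}"
        using finite_subset[OF sub finR[OF y]] .
      show "card {k \<in> UNIV. 0 < u k y} \<le> m + 1"
        using card_mono[OF finR[OF y] sub] R(5)[OF y] by linarith
      show "\<exists>k\<in>UNIV. u k y = 1"
        using u(3)[OF y] by blast
    qed
    moreover have "i \<in> ?M" if i: "i < N" "y \<notin> \<Union>(\<D> i)" for i
    proof (rule ccontr)
      assume no: "i \<notin> ?M"
      obtain k1 where "u k1 y = 1"
        using u(3)[OF y] by blast
      then have "\<exists>k\<in>UNIV. band_hi N i \<le> u k y"
        using band_hi_less_1[OF i(1)] by (intro bexI[of _ k1]) auto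
      then obtain B where B: "B \<noteq> {}" "y \<in> level_cell N u UNIV i B"
        using in_level_cell_if_no_band_hit[of i N UNIV u y] no i(1) by blast
      then have yC: "y \<in> C i B"
        using y by (simp add: C_def)
      then have "B \<subseteq> {k. y \<in> R k}"
        using CR by blast
      then have finB: "finite B"
        using finR[OF y] finite_subset by blast
      obtain W where "W \<in> \<W> (Min B)" "y \<in> W"
        using CR[OF Min_in[OF finB B(1)]] R(2) yC by blast
      then have "y \<in> \<Union>(\<D> i)"
        using finB B(1) yC unfolding \<D>_def by blast
      then show False
        using i(2) by blast
    qed
    then have "{i. i < N \<and> y \<notin> \<Union>(\<D> i)} \<subseteq> ?M"
      by blast
    then have "card {i. i < N \<and> y \<notin> \<Union>(\<D> i)} \<le> card ?M"
      by (intro card_mono) auto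
    ultimately show "card {i. i < N \<and> y \<notin> \<Union>(\<D> i)} \<le> m"
      by linarith
  qed
qed


section \<open>Approximation of the coordinate functions\<close>

lemma exists_inj_choice:
  assumes "finite F" "\<And>A. A \<in> F \<Longrightarrow> infinite (S A)"
  shows "\<exists>c. inj_on c F \<and> (\<forall>A\<in>F. c A \<in> S A)"
  using assms
proof (induction F rule: finite_induct)
  case (insert A F)
  then obtain c where c: "inj_on c F" "\<forall>A\<in>F. c A \<in> S A"
    by auto
  have "infinite (S A - c ` F)"
    using insert by simp
  then obtain t where t: "t \<in> S A" "t \<notin> c ` F"
    by (metis DiffE all_not_in_conv finite.emptyI)
  have "inj_on (c(A := t)) (insert A F)"
    using c(1) t(2) insert.hyps(2) by (auto simp: inj_on_def)
  moreover have "\<forall>B\<in>insert A F. (c(A := t)) B \<in> S B"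
    using c(2) t(1) by auto
  ultimately show ?case
    by blast
qed simp

text \<open>Dividing the prescribed change by \<open>\<alpha>\<close> turns the variable tolerance
  into the fixed interval [-1,1], to which Tietze's theorem applies. The prescribed function is
  continuous on the union of the sets because these are closed, disjoint and locally finite.\<close>

lemma extend_locally_constant_approximation:
  fixes X :: "'a topology" and Y :: "'b topology" and g \<alpha> :: "'a \<Rightarrow> real" and c :: "'b set \<Rightarrow> 'a set \<Rightarrow> real"
  assumes X: "normal_space X" and f: "continuous_map X Y f"
    and \<D>: "\<And>V. V \<in> \<D> \<Longrightarrow> closedin Y V" "locally_finite_in Y \<D>" "pairwise disjnt \<D>"
    and \<F>: "\<And>V. V \<in> \<D> \<Longrightarrow> finite (\<F> V)" "\<And>V. V \<in> \<D> \<Longrightarrow> pairwise disjnt (\<F> V)"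
      "\<And>V F. V \<in> \<D> \<Longrightarrow> F \<in> \<F> V \<Longrightarrow> closedin X F"
    and g: "continuous_map X euclideanreal g" "\<And>x. x \<in> topspace X \<Longrightarrow> g x \<in> {0..1}"
    and \<alpha>: "continuous_map X euclideanreal \<alpha>" "\<And>x. x \<in> topspace X \<Longrightarrow> 0 < \<alpha> x"
    and c: "\<And>V F. V \<in> \<D> \<Longrightarrow> F \<in> \<F> V \<Longrightarrow> c V F \<in> {0..1}"
      "\<And>V F x. V \<in> \<D> \<Longrightarrow> F \<in> \<F> V \<Longrightarrow> x \<in> F \<Longrightarrow> \<bar>c V F - g x\<bar> \<le> \<alpha> x"
  shows "\<exists>g'. continuous_map X euclideanreal g' \<and>
     (\<forall>x\<in>topspace X. g' x \<in> {0..1} \<and> \<bar>g x - g' x\<bar> \<le> \<alpha> x) \<and>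
     (\<forall>V\<in>\<D>. \<forall>F\<in>\<F> V. \<forall>x\<in>F. f x \<in> V \<longrightarrow> g' x = c V F)"
proof -
  define I where "I = Sigma \<D> \<F>"
  define T where "T p = snd p \<inter> {x \<in> topspace X. f x \<in> fst p}" for p :: "'b set \<times> 'a set"
  define k where "k p x = (c (fst p) (snd p) - g x) / \<alpha> x" for p x
  define Z where "Z = \<Union>(T ` I)"
  have clT: "closedin X (T p)" if "p \<in> I" for p
    using that \<D>(1) \<F>(3) f unfolding T_def I_def
    by (auto intro!: closedin_Int closedin_continuous_map_preimage[OF f])
  have lf: "\<exists>V. openin X V \<and> x \<in> V \<and> finite {p \<in> I. T p \<inter> V \<noteq> {}}" if x: "x \<in> topspace X" for x
  proof -
    have "f x \<in> topspace Y"
      using x f continuous_map_image_subset_topspace by blast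
    then obtain S where S: "openin Y S" "f x \<in> S" "finite {V \<in> \<D>. V \<inter> S \<noteq> {}}"
      using \<D>(2) unfolding locally_finite_in_def by blast
    let ?O = "{z \<in> topspace X. f z \<in> S}"
    have "{p \<in> I. T p \<inter> ?O \<noteq> {}} \<subseteq> Sigma {V \<in> \<D>. V \<inter> S \<noteq> {}} \<F>"
      unfolding I_def T_def by fastforce
    moreover have "finite (Sigma {V \<in> \<D>. V \<inter> S \<noteq> {}} \<F>)"
      using S(3) \<F>(1) by (intro finite_SigmaI) auto
    ultimately have "finite {p \<in> I. T p \<inter> ?O \<noteq> {}}"
      using finite_subset by blast
    moreover have "openin X ?O"
      by (rule openin_continuous_map_preimage[OF f S(1)])
    ultimately show ?thesis
      using x S(2) by (intro exI[of _ ?O]) auto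
  qed
  have dis: "p = q" if "p \<in> I" "q \<in> I" "x \<in> T p" "x \<in> T q" for p q x
  proof -
    have I: "fst p \<in> \<D>" "snd p \<in> \<F> (fst p)" "fst q \<in> \<D>" "snd q \<in> \<F> (fst q)"
      and T: "x \<in> snd p" "f x \<in> fst p" "x \<in> snd q" "f x \<in> fst q"
      using that by (auto simp: I_def T_def)
    have "\<not> disjnt (fst p) (fst q)"
      using T by (auto simp: disjnt_iff)
    then have "fst p = fst q"
      using pairwiseD[OF \<D>(3) I(1,3)] by blast
    moreover have "\<not> disjnt (snd p) (snd q)"
      using T by (auto simp: disjnt_iff)
    with calculation have "snd p = snd q"
      using pairwiseD[OF \<F>(2)[OF I(1)] I(2), of "snd q"] I(4) by auto
    ultimately show ?thesis
      by (simp add: prod_eq_iff)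
  qed
  have "Z \<subseteq> topspace X"
    by (auto simp: Z_def T_def)
  have clZ: "closedin X Z"
    unfolding Z_def
  proof (rule closedin_locally_finite_Union)
    show "locally_finite_in X (T ` I)"
      unfolding locally_finite_in_def
    proof (intro conjI ballI)
      fix x assume "x \<in> topspace X"
      then obtain V where V: "openin X V" "x \<in> V" "finite {p \<in> I. T p \<inter> V \<noteq> {}}"
        using lf by blast
      have "{U \<in> T ` I. U \<inter> V \<noteq> {}} \<subseteq> T ` {p \<in> I. T p \<inter> V \<noteq> {}}"
        by blast
      then have "finite {U \<in> T ` I. U \<inter> V \<noteq> {}}"
        using V(3) finite_surj by blast
      then show "\<exists>V. openin X V \<and> x \<in> V \<and> finite {U \<in> T ` I. U \<inter> V \<noteq> {}}"
        using V by blast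
    qed (auto simp: T_def)
  qed (use clT in auto)
  have topZ: "topspace (subtopology X Z) = Z"
    using \<open>Z \<subseteq> topspace X\<close> by auto
  obtain j where j: "\<And>x. x \<in> Z \<Longrightarrow> j x \<in> I \<and> x \<in> T (j x)"
    unfolding Z_def by (metis UN_E)
  define q where "q x = k (j x) x" for x
  have qk: "q x = k p x" if "p \<in> I" "x \<in> T p" for p x
  proof -
    have "x \<in> Z"
      using that by (auto simp: Z_def)
    then show ?thesis
      using j dis that unfolding q_def by metis
  qed
  have "continuous_map (subtopology X Z) euclideanreal q"
  proof (rule pasting_lemma_locally_finite[where I = I and T = T and f = k])
    fix x assume "x \<in> topspace (subtopology X Z)"
    then have x: "x \<in> topspace X" "x \<in> Z"
      by auto
    then obtain V where V: "openin X V" "x \<in> V" "finite {p \<in> I. T p \<inter> V \<noteq> {}}"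
      using lf by blast
    have "{p \<in> I. T p \<inter> (Z \<inter> V) \<noteq> {}} \<subseteq> {p \<in> I. T p \<inter> V \<noteq> {}}"
      by blast
    then have "finite {p \<in> I. T p \<inter> (Z \<inter> V) \<noteq> {}}"
      using V(3) finite_subset by blast
    then show "\<exists>V. openin (subtopology X Z) V \<and> x \<in> V \<and> finite {p \<in> I. T p \<inter> V \<noteq> {}}"
      using V x by (intro exI[of _ "Z \<inter> V"]) (auto intro: openin_subtopology_Int2)
    show "\<exists>p. p \<in> I \<and> x \<in> T p \<and> q x = k p x"
      using j[OF x(2)] qk by blast
  next
    fix p assume p: "p \<in> I"
    then have "T p \<subseteq> Z"
      by (auto simp: Z_def)
    then show "closedin (subtopology X Z) (T p)"
      using clT[OF p] closedin_subset_topspace by blast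
    have "continuous_map X euclideanreal (k p)"
      unfolding k_def using g(1) \<alpha> by (intro continuous_intros) (auto simp: less_imp_neq[symmetric] dest: \<alpha>(2))
    then show "continuous_map (subtopology (subtopology X Z) (T p)) euclideanreal (k p)"
      by (simp add: continuous_map_from_subtopology)
  next
    fix p p' x assume "p \<in> I" "p' \<in> I" "x \<in> topspace (subtopology X Z) \<inter> T p \<inter> T p'"
    then show "k p x = k p' x"
      using dis by (metis IntE)
  qed
  moreover have "q ` Z \<subseteq> {-1..1}"
  proof clarify
    fix x assume x: "x \<in> Z"
    then have jx: "fst (j x) \<in> \<D>" "snd (j x) \<in> \<F> (fst (j x))" "x \<in> snd (j x)" "x \<in> topspace X"
      using j[OF x] by (auto simp: I_def T_def)
    have "\<bar>c (fst (j x)) (snd (j x)) - g x\<bar> \<le> \<alpha> x"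
      by (rule c(2)[OF jx(1-3)])
    then show "q x \<in> {-1..1}"
      using \<alpha>(2)[OF jx(4)] by (auto simp: q_def k_def field_simps abs_le_iff)
  qed
  ultimately obtain R where R: "continuous_map X euclideanreal R" "\<And>x. x \<in> Z \<Longrightarrow> R x = q x"
      "R ` topspace X \<subseteq> {-1..1}"
    using Tietze_extension_closed_real_interval[OF X clZ, of q "-1" 1] by auto
  \<comment> \<open>Clamping to [0,1] does not increase the distance to \<open>g\<close>, which has
    values there, and leaves the prescribed constants unchanged.\<close>
  define g' where "g' x = max 0 (min 1 (g x + \<alpha> x * R x))" for x
  show ?thesis
  proof (intro exI[of _ g'] conjI ballI impI)
    show "continuous_map X euclideanreal g'"
      unfolding g'_def using g(1) \<alpha>(1) R(1) by (intro continuous_intros) auto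
    fix x assume x: "x \<in> topspace X"
    show "g' x \<in> {0..1}"
      by (auto simp: g'_def)
    have "R x \<in> {-1..1}"
      using R(3) x by blast
    then have "\<bar>\<alpha> x * R x\<bar> \<le> \<alpha> x"
      using \<alpha>(2)[OF x] by (auto simp: abs_mult mult_left_le abs_le_iff)
    then show "\<bar>g x - g' x\<bar> \<le> \<alpha> x"
      using g(2)[OF x] by (auto simp: g'_def max_def min_def)
  next
    fix V F x assume V: "V \<in> \<D>" "F \<in> \<F> V" "x \<in> F" "f x \<in> V"
    then have x: "x \<in> topspace X"
      using \<F>(3) closedin_subset by blast
    then have p: "(V, F) \<in> I" "x \<in> T (V, F)"
      using V by (auto simp: I_def T_def)
    then have "R x = (c V F - g x) / \<alpha> x"
      using R(2)[of x] qk[OF p] by (auto simp: Z_def k_def)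
    then have "g x + \<alpha> x * R x = c V F"
      using \<alpha>(2)[OF x] by simp
    then show "g' x = c V F"
      using c(1)[OF V(1,2)] by (simp add: g'_def)
  qed
qed

text \<open>Besides smallness under \<open>h\<close>, each member comes with a whole interval of
  admissible constants per coordinate. Its infinitely many values leave room for distinct constants
  on the sets of a finite family.\<close>

lemma fine_cover:
  fixes X :: "'a topology" and g :: "nat \<Rightarrow> 'a \<Rightarrow> real" and N :: nat
  assumes h: "continuous_map X (mtopology_of M) h" and r: "0 < r"
    and g: "\<And>i. i < N \<Longrightarrow> continuous_map X euclideanreal (g i)"
      "\<And>i x. i < N \<Longrightarrow> x \<in> topspace X \<Longrightarrow> g i x \<in> {0..1}"
    and \<alpha>: "continuous_map X euclideanreal \<alpha>" "\<And>x. x \<in> topspace X \<Longrightarrow> 0 < \<alpha> x"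
  shows "\<exists>\<G>. open_cover X \<G> \<and> (\<forall>G\<in>\<G>. (\<forall>x\<in>G. \<forall>x'\<in>G. mdist M (h x) (h x') < r) \<and>
     (\<forall>i<N. \<exists>a b. 0 \<le> a \<and> a < b \<and> b \<le> 1 \<and> (\<forall>x\<in>G. \<forall>t\<in>{a<..<b}. \<bar>t - g i x\<bar> \<le> \<alpha> x)))"
proof -
  interpret H: Metric_space "mspace M" "mdist M"
    by simp
  define thin where "thin G \<longleftrightarrow> openin X G \<and> (\<forall>x\<in>G. \<forall>x'\<in>G. mdist M (h x) (h x') < r) \<and>
     (\<forall>i<N. \<exists>a b. 0 \<le> a \<and> a < b \<and> b \<le> 1 \<and> (\<forall>x\<in>G. \<forall>t\<in>{a<..<b}. \<bar>t - g i x\<bar> \<le> \<alpha> x))" for G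
  have him: "h x \<in> mspace M" if "x \<in> topspace X" for x
    using continuous_map_image_subset_topspace[OF h] that by auto
  have "\<exists>G. thin G \<and> x0 \<in> G" if x0: "x0 \<in> topspace X" for x0
  proof -
    \<comment> \<open>The constants stay within e of \<open>g i x0\<close>, the function moves by
      less than e on \<open>G\<close>, and \<open>\<alpha>\<close> exceeds 2 e there; at
      \<open>x0\<close> itself it is 4 e.\<close>
    define e where "e = \<alpha> x0 / 4"
    have e: "0 < e"
      using \<alpha>(2)[OF x0] by (simp add: e_def)
    define S where "S i = {x \<in> topspace X. g i x - g i x0 \<in> {-e<..<e}}" for i
    define T where "T = {x \<in> topspace X. h x \<in> mball_of M (h x0) (r / 2)} \<inter> {x \<in> topspace X. \<alpha> x \<in> {2 * e<..}}"
    define G where "G = {x \<in> T. \<forall>i\<in>{..<N}. x \<in> S i}"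
    have "openin X (S i)" if "i < N" for i
    proof -
      have "continuous_map X euclideanreal (\<lambda>x. g i x - g i x0)"
        using g(1)[OF that] by (intro continuous_intros) auto
      then show ?thesis
        unfolding S_def by (rule openin_continuous_map_preimage) auto
    qed
    moreover have "openin X T"
      unfolding T_def
      by (intro openin_Int openin_continuous_map_preimage[OF h] openin_continuous_map_preimage[OF \<alpha>(1)])
        (simp_all add: mball_of_def mtopology_of_def H.openin_mball)
    ultimately have "openin X G"
      unfolding G_def by (intro openin_finite_conditions) auto
    moreover have "x0 \<in> G"
      using x0 r e him[OF x0] by (auto simp: G_def T_def S_def e_def in_mball_of)
    moreover have "mdist M (h x) (h x') < r" if "x \<in> G" "x' \<in> G" for x x'
    proof -
      have "mdist M (h x0) (h x) < r / 2" "mdist M (h x0) (h x') < r / 2" "x \<in> topspace X" "x' \<in> topspace X"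
        using that by (auto simp: G_def T_def in_mball_of)
      then show ?thesis
        using mdist_triangle[of "h x" M "h x0" "h x'"] him x0 by (simp add: mdist_commute[of M "h x"])
    qed
    moreover have "\<exists>a b. 0 \<le> a \<and> a < b \<and> b \<le> 1 \<and> (\<forall>x\<in>G. \<forall>t\<in>{a<..<b}. \<bar>t - g i x\<bar> \<le> \<alpha> x)" if i: "i < N" for i
    proof (intro exI conjI ballI)
      show "0 \<le> max 0 (g i x0 - e)" "max 0 (g i x0 - e) < min 1 (g i x0 + e)" "min 1 (g i x0 + e) \<le> 1"
        using g(2)[OF i x0] e by auto
      fix x t assume x: "x \<in> G" and t: "t \<in> {max 0 (g i x0 - e)<..<min 1 (g i x0 + e)}"
      have "x \<in> S i" "2 * e < \<alpha> x"
        using x i by (auto simp: G_def T_def)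
      then have "\<bar>g i x - g i x0\<bar> < e" "2 * e < \<alpha> x"
        by (auto simp: S_def)
      then show "\<bar>t - g i x\<bar> \<le> \<alpha> x"
        using t by auto
    qed
    ultimately show ?thesis
      unfolding thin_def by blast
  qed
  then have "topspace X \<subseteq> \<Union>{G. thin G}"
    by blast
  moreover have "\<Union>{G. thin G} \<subseteq> topspace X"
    using openin_subset by (fastforce simp: thin_def)
  ultimately have "open_cover X {G. thin G}"
    by (auto simp: open_cover_def thin_def)
  then show ?thesis
    by (intro exI[of _ "{G. thin G}"]) (simp add: thin_def)
qed

text \<open>Over a member of this cover, each \<open>p\<close> has at most one member of
  \<open>E p\<close> in play, so that the local family belonging to scale \<open>p\<close> is
  unambiguous. Local finiteness leaves finitely many closed sets to avoid near a given
  point.\<close>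

lemma neighbourhood_cover:
  fixes Y :: "'b topology" and E :: "nat \<Rightarrow> 'b set set" and r :: nat
  assumes E: "\<And>p. p < r \<Longrightarrow> locally_finite_in Y (E p)" "\<And>p W. p < r \<Longrightarrow> W \<in> E p \<Longrightarrow> closedin Y W"
      "\<And>p. p < r \<Longrightarrow> pairwise disjnt (E p)"
    and U: "\<And>p W. p < r \<Longrightarrow> W \<in> E p \<Longrightarrow> openin Y (U W) \<and> W \<subseteq> U W"
  shows "\<exists>\<nu>. open_cover Y \<nu> \<and> (\<forall>V\<in>\<nu>. \<forall>p<r. (\<forall>W\<in>E p. V \<inter> W \<noteq> {} \<longrightarrow> V \<subseteq> U W) \<and>
     (\<forall>W\<in>E p. \<forall>W'\<in>E p. V \<inter> W \<noteq> {} \<and> V \<inter> W' \<noteq> {} \<longrightarrow> W = W'))"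
proof -
  define ok where "ok V \<longleftrightarrow> openin Y V \<and> (\<forall>p<r. (\<forall>W\<in>E p. V \<inter> W \<noteq> {} \<longrightarrow> V \<subseteq> U W) \<and>
     (\<forall>W\<in>E p. \<forall>W'\<in>E p. V \<inter> W \<noteq> {} \<and> V \<inter> W' \<noteq> {} \<longrightarrow> W = W'))" for V
  have "\<exists>V. ok V \<and> y \<in> V" if y: "y \<in> topspace Y" for y
  proof -
    have "\<forall>p\<in>{..<r}. \<exists>T. openin Y T \<and> y \<in> T \<and> finite {W \<in> E p. W \<inter> T \<noteq> {}}"
      using E(1) y unfolding locally_finite_in_def by blast
    then obtain T where T: "\<And>p. p < r \<Longrightarrow> openin Y (T p) \<and> y \<in> T p \<and> finite {W \<in> E p. W \<inter> T p \<noteq> {}}"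
      by (metis lessThan_iff)
    define T0 where "T0 = {z \<in> topspace Y. \<forall>p\<in>{..<r}. z \<in> T p}"
    have opT0: "openin Y T0"
      unfolding T0_def using T by (intro openin_finite_conditions) auto
    define \<BB> where "\<BB> = (\<Union>p<r. {W \<in> E p. W \<inter> T p \<noteq> {}})"
    have finB: "finite \<BB>"
      unfolding \<BB>_def using T by simp
    define V where "V = {z \<in> T0. \<forall>W\<in>\<BB>. z \<in> (if y \<in> W then U W else topspace Y - W)}"
    have opV: "openin Y V"
      unfolding V_def
    proof (rule openin_finite_conditions[OF opT0 finB])
      fix W assume "W \<in> \<BB>"
      then obtain p where "p < r" "W \<in> E p"
        by (auto simp: \<BB>_def)
      then show "openin Y (if y \<in> W then U W else topspace Y - W)"
        using U E(2) by (simp add: openin_diff)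
    qed
    have yV: "y \<in> V"
      using y T U by (fastforce simp: V_def T0_def \<BB>_def)
    have meet: "y \<in> W \<and> V \<subseteq> U W" if W: "p < r" "W \<in> E p" "V \<inter> W \<noteq> {}" for p W
    proof -
      obtain z where z: "z \<in> V" "z \<in> W"
        using W(3) by blast
      then have "z \<in> T p"
        using W(1) by (auto simp: V_def T0_def)
      then have "W \<in> \<BB>"
        using z(2) W(1,2) by (auto simp: \<BB>_def)
      then have all: "\<And>v. v \<in> V \<Longrightarrow> v \<in> (if y \<in> W then U W else topspace Y - W)"
        unfolding V_def by blast
      show ?thesis
        using all[OF z(1)] z(2) all by (cases "y \<in> W") auto
    qed
    have "ok V"
      unfolding ok_def
    proof (intro conjI allI impI ballI)
      fix p W assume "p < r" "W \<in> E p" "V \<inter> W \<noteq> {}"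
      then show "V \<subseteq> U W"
        using meet by blast
    next
      fix p W W' assume p: "p < r" and W: "W \<in> E p" "W' \<in> E p" "V \<inter> W \<noteq> {} \<and> V \<inter> W' \<noteq> {}"
      then have "y \<in> W" "y \<in> W'"
        using meet[OF p] by blast+
      then show "W = W'"
        using E(3)[OF p] W(1,2) by (auto simp: pairwise_def disjnt_def)
    qed (rule opV)
    then show ?thesis
      using yV by blast
  qed
  then have "topspace Y \<subseteq> \<Union>{V. ok V}"
    by blast
  moreover have "\<Union>{V. ok V} \<subseteq> topspace Y"
    using openin_subset by (fastforce simp: ok_def)
  ultimately have "open_cover Y {V. ok V}"
    by (auto simp: open_cover_def ok_def)
  then show ?thesis
    by (intro exI[of _ "{V. ok V}"]) (simp add: ok_def)
qed

text \<open>The two kinds of families play different roles: \<open>E\<close> decides which local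
  family a fibre is measured against, \<open>\<D> i\<close> says where in \<open>Y\<close> the i-th
  coordinate is prescribed.\<close>

lemma coordinatewise_approximation:
  fixes X :: "'a topology" and Y :: "'b topology" and g :: "nat \<Rightarrow> 'a \<Rightarrow> real" and n m N :: nat
  assumes X: "normal_space X" "Hausdorff_space X" and Y: "paracompact_space Y" and f: "perfect_map X Y f"
    and dimf: "map_dim_le X Y f n" and dimY: "covering_dim_le Y m" and N: "2 * n + m < N"
    and h: "continuous_map X (mtopology_of M) h" and r: "0 < r"
    and g: "\<And>i. i < N \<Longrightarrow> continuous_map X euclideanreal (g i)"
      "\<And>i x. i < N \<Longrightarrow> x \<in> topspace X \<Longrightarrow> g i x \<in> {0..1}"
    and \<alpha>: "continuous_map X euclideanreal \<alpha>" "\<And>x. x \<in> topspace X \<Longrightarrow> 0 < \<alpha> x"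
  shows "\<exists>g'. (\<forall>i<N. continuous_map X euclideanreal (g' i) \<and>
       (\<forall>x\<in>topspace X. g' i x \<in> {0..1} \<and> \<bar>g i x - g' i x\<bar> \<le> \<alpha> x)) \<and>
     (\<forall>x\<in>topspace X. \<forall>x'\<in>topspace X. f x = f x' \<and> (\<forall>i<N. g' i x = g' i x') \<longrightarrow> mdist M (h x) (h x') < r)"
proof -
  have fc: "continuous_map X Y f"
    using f by (simp add: perfect_map_def)
  obtain \<G> where \<G>: "open_cover X \<G>" and Gh: "\<And>G x x'. G \<in> \<G> \<Longrightarrow> x \<in> G \<Longrightarrow> x' \<in> G \<Longrightarrow> mdist M (h x) (h x') < r"
    and Gg: "\<And>G i. G \<in> \<G> \<Longrightarrow> i < N \<Longrightarrow> \<exists>a b. 0 \<le> a \<and> a < b \<and> b \<le> 1 \<and> (\<forall>x\<in>G. \<forall>t\<in>{a<..<b}. \<bar>t - g i x\<bar> \<le> \<alpha> x)"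
  proof -
    obtain \<G> where "open_cover X \<G> \<and> (\<forall>G\<in>\<G>. (\<forall>x\<in>G. \<forall>x'\<in>G. mdist M (h x) (h x') < r) \<and>
     (\<forall>i<N. \<exists>a b. 0 \<le> a \<and> a < b \<and> b \<le> 1 \<and> (\<forall>x\<in>G. \<forall>t\<in>{a<..<b}. \<bar>t - g i x\<bar> \<le> \<alpha> x)))"
      using fine_cover[OF h r g \<alpha>] by (rule exE)
    then show thesis
      by (intro that[of \<G>]) simp_all
  qed
  have "\<exists>\<C>. (\<forall>p<m+1. fibrewise_families X Y f N n (\<C> p)) \<and>
    (\<forall>i<N. \<forall>P\<subseteq>{..<m+1}. \<forall>ch. (\<forall>p\<in>P. ch p \<in> \<C> p) \<longrightarrow>
      (\<exists>\<F>. finite \<F> \<and> pairwise disjnt \<F> \<and> (\<forall>F\<in>\<F>. closedin X F) \<and> refines \<F> \<G> \<and>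
          (\<forall>p\<in>P. refines (snd (ch p) i) \<F>)))"
    by (rule many_scales[OF X Y f dimf \<G>])
  then obtain \<C> where C0: "\<forall>p<m+1. fibrewise_families X Y f N n (\<C> p)"
    and merge0: "\<forall>i<N. \<forall>P\<subseteq>{..<m+1}. \<forall>ch. (\<forall>p\<in>P. ch p \<in> \<C> p) \<longrightarrow>
      (\<exists>\<F>. finite \<F> \<and> pairwise disjnt \<F> \<and> (\<forall>F\<in>\<F>. closedin X F) \<and> refines \<F> \<G> \<and>
          (\<forall>p\<in>P. refines (snd (ch p) i) \<F>))"
    by (elim exE conjE)
  have C: "\<And>y. y \<in> topspace Y \<Longrightarrow> \<exists>c\<in>\<C> p. y \<in> Y interior_of fst c"
    "\<And>c x. c \<in> \<C> p \<Longrightarrow> x \<in> topspace X \<Longrightarrow> f x \<in> fst c \<Longrightarrow> card {i. i < N \<and> x \<notin> \<Union>(snd c i)} \<le> n"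
    if "p < m + 1" for p
    using C0 that unfolding fibrewise_families_def by simp_all
  have merge: "\<exists>\<F>. finite \<F> \<and> pairwise disjnt \<F> \<and> (\<forall>F\<in>\<F>. closedin X F) \<and> refines \<F> \<G> \<and>
          (\<forall>p\<in>P. refines (snd (ch p) i) \<F>)"
    if "i < N" "P \<subseteq> {..<m+1}" "\<forall>p\<in>P. ch p \<in> \<C> p" for i P ch
    using merge0 that by simp
  \<comment> \<open>Over a member of \<open>\<omega>\<close>, a single local family is valid at
    every scale.\<close>
  define \<omega> where "\<omega> = {U. openin Y U \<and> (\<forall>p<m+1. \<exists>c\<in>\<C> p. U \<subseteq> fst c)}"
  have "\<exists>U\<in>\<omega>. y \<in> U" if y: "y \<in> topspace Y" for y
  proof -
    have "\<forall>p\<in>{..<m+1}. \<exists>c. c \<in> \<C> p \<and> y \<in> Y interior_of fst c"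
      using C(1) y by blast
    then obtain c where c: "\<forall>p\<in>{..<m+1}. c p \<in> \<C> p \<and> y \<in> Y interior_of fst (c p)"
      by (rule bchoice[THEN exE])
    let ?U = "{z \<in> topspace Y. \<forall>p\<in>{..<m+1}. z \<in> Y interior_of fst (c p)}"
    have "openin Y ?U"
      by (intro openin_finite_conditions) auto
    moreover have "?U \<subseteq> fst (c p)" if "p < m + 1" for p
      using that interior_of_subset[of Y "fst (c p)"] by blast
    ultimately show ?thesis
      using c y by (intro bexI[of _ ?U]) (auto simp: \<omega>_def)
  qed
  moreover have omega_open: "openin Y U" if "U \<in> \<omega>" for U
    using that by (simp add: \<omega>_def)
  ultimately have "open_cover Y \<omega>"
    using openin_subset[of Y] unfolding open_cover_def by blast
  \<comment> \<open>Taking m + 1 families with at most m misses per point makes them cover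
    \<open>Y\<close> jointly; this fixes the number of scales.\<close>
  from Ostrand_families[OF Y dimY this, of "m + 1"]
  obtain E where E0: "\<forall>p<m+1. (\<forall>D\<in>E p. closedin Y D) \<and> locally_finite_in Y (E p) \<and> pairwise disjnt (E p) \<and>
      refines (E p) \<omega>" and Ecard: "\<forall>y\<in>topspace Y. card {p. p < m+1 \<and> y \<notin> \<Union>(E p)} \<le> m"
    by (elim exE conjE)
  have E: "\<And>W. W \<in> E p \<Longrightarrow> closedin Y W" "locally_finite_in Y (E p)" "pairwise disjnt (E p)" "refines (E p) \<omega>"
    if "p < m + 1" for p
    using E0 that by auto
  have Ecov: "\<exists>p<m+1. \<exists>W\<in>E p. y \<in> W" if y: "y \<in> topspace Y" for y
  proof (rule ccontr)
    assume "\<not> (\<exists>p<m+1. \<exists>W\<in>E p. y \<in> W)"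
    then have "{p. p < m+1 \<and> y \<notin> \<Union>(E p)} = {..<m+1}"
      by auto
    then show False
      using Ecard y by (metis Suc_eq_plus1 card_lessThan not_less_eq_eq order_refl)
  qed
  define U where "U W = (SOME U. U \<in> \<omega> \<and> W \<subseteq> U)" for W
  have U: "U W \<in> \<omega>" "W \<subseteq> U W" if "p < m + 1" "W \<in> E p" for p W
  proof -
    have "\<exists>U. U \<in> \<omega> \<and> W \<subseteq> U"
      using E(4)[OF that(1)] that(2) by (auto simp: refines_def)
    from someI_ex[OF this] show "U W \<in> \<omega>" "W \<subseteq> U W"
      by (simp_all add: U_def)
  qed
  define ch where "ch p W = (SOME c. c \<in> \<C> p \<and> U W \<subseteq> fst c)" for p W
  have ch: "ch p W \<in> \<C> p" "U W \<subseteq> fst (ch p W)" if "p < m + 1" "W \<in> E p" for p W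
  proof -
    have "\<exists>c. c \<in> \<C> p \<and> U W \<subseteq> fst c"
      using U(1)[OF that] that(1) unfolding \<omega>_def mem_Collect_eq by blast
    from someI_ex[OF this] show "ch p W \<in> \<C> p" "U W \<subseteq> fst (ch p W)"
      by (simp_all add: ch_def)
  qed
  have "\<exists>\<nu>. open_cover Y \<nu> \<and> (\<forall>V\<in>\<nu>. \<forall>p<m+1. (\<forall>W\<in>E p. V \<inter> W \<noteq> {} \<longrightarrow> V \<subseteq> U W) \<and>
     (\<forall>W\<in>E p. \<forall>W'\<in>E p. V \<inter> W \<noteq> {} \<and> V \<inter> W' \<noteq> {} \<longrightarrow> W = W'))"
    by (rule neighbourhood_cover) (use E U omega_open in auto)
  then obtain \<nu> where \<nu>: "open_cover Y \<nu>"
    and \<nu>0: "\<forall>V\<in>\<nu>. \<forall>p<m+1. (\<forall>W\<in>E p. V \<inter> W \<noteq> {} \<longrightarrow> V \<subseteq> U W) \<and>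
     (\<forall>W\<in>E p. \<forall>W'\<in>E p. V \<inter> W \<noteq> {} \<and> V \<inter> W' \<noteq> {} \<longrightarrow> W = W')"
    by (elim exE conjE)
  have \<nu>1: "\<And>V p W W'. V \<in> \<nu> \<Longrightarrow> p < m+1 \<Longrightarrow> W \<in> E p \<Longrightarrow> W' \<in> E p \<Longrightarrow> V \<inter> W \<noteq> {} \<Longrightarrow> V \<inter> W' \<noteq> {} \<Longrightarrow> W = W'"
    using \<nu>0 by simp
  from Ostrand_families[OF Y dimY \<nu>, of N]
  obtain \<D> where D0: "\<forall>i<N. (\<forall>D\<in>\<D> i. closedin Y D) \<and> locally_finite_in Y (\<D> i) \<and> pairwise disjnt (\<D> i) \<and>
      refines (\<D> i) \<nu>" and Dcard: "\<forall>y\<in>topspace Y. card {i. i < N \<and> y \<notin> \<Union>(\<D> i)} \<le> m"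
    by (elim exE conjE)
  have D: "\<And>V. V \<in> \<D> i \<Longrightarrow> closedin Y V" "locally_finite_in Y (\<D> i)" "pairwise disjnt (\<D> i)" "refines (\<D> i) \<nu>"
    if "i < N" for i
    using D0 that by auto
  have Duniq: "W = W'" if Vi: "i < N" "V \<in> \<D> i" "p < m + 1" "W \<in> E p" "W' \<in> E p" "V \<inter> W \<noteq> {}" "V \<inter> W' \<noteq> {}" for i V p W W'
  proof -
    obtain V' where V': "V' \<in> \<nu>" "V \<subseteq> V'"
      using D(4)[OF Vi(1)] Vi(2) by (auto simp: refines_def)
    show ?thesis
      by (rule \<nu>1[OF V'(1) Vi(3-5)]) (use V'(2) Vi(6,7) in blast)+
  qed
  \<comment> \<open>The scales present over \<open>V\<close>. For \<open>V\<close> in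
    \<open>\<D> i\<close> the member \<open>w V p\<close> is the only one of \<open>E p\<close> that
    meets \<open>V\<close>.\<close>
  define P where "P V = {p. p < m + 1 \<and> (\<exists>W\<in>E p. V \<inter> W \<noteq> {})}" for V
  define w where "w V p = (SOME W. W \<in> E p \<and> V \<inter> W \<noteq> {})" for V p
  have w: "w V p \<in> E p" "V \<inter> w V p \<noteq> {}" "p < m + 1" if "p \<in> P V" for V p
  proof -
    have "\<exists>W. W \<in> E p \<and> V \<inter> W \<noteq> {}"
      using that by (auto simp: P_def)
    from someI_ex[OF this] show "w V p \<in> E p" "V \<inter> w V p \<noteq> {}"
      by (simp_all add: w_def)
    show "p < m + 1"
      using that by (simp add: P_def)
  qed
  have "\<exists>\<F>. finite \<F> \<and> pairwise disjnt \<F> \<and> (\<forall>F\<in>\<F>. closedin X F) \<and> refines \<F> \<G> \<and>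
          (\<forall>p\<in>P V. refines (snd (ch p (w V p)) i) \<F>)" if "i < N" for i V
  proof (rule merge[OF that])
    show "P V \<subseteq> {..<m+1}"
      by (auto simp: P_def)
    show "\<forall>p\<in>P V. ch p (w V p) \<in> \<C> p"
      using ch(1) w by blast
  qed
  then have "\<forall>i V. \<exists>\<F>. i < N \<longrightarrow> finite \<F> \<and> pairwise disjnt \<F> \<and> (\<forall>F\<in>\<F>. closedin X F) \<and> refines \<F> \<G> \<and>
          (\<forall>p\<in>P V. refines (snd (ch p (w V p)) i) \<F>)"
    by blast
  then obtain \<F> where F0: "\<forall>i V. i < N \<longrightarrow> finite (\<F> i V) \<and> pairwise disjnt (\<F> i V) \<and> (\<forall>F\<in>\<F> i V. closedin X F) \<and>
      refines (\<F> i V) \<G> \<and> (\<forall>p\<in>P V. refines (snd (ch p (w V p)) i) (\<F> i V))"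
    by metis
  have F: "finite (\<F> i V)" "pairwise disjnt (\<F> i V)" "\<And>F. F \<in> \<F> i V \<Longrightarrow> closedin X F" "refines (\<F> i V) \<G>"
      "\<And>p. p \<in> P V \<Longrightarrow> refines (snd (ch p (w V p)) i) (\<F> i V)" if "i < N" for i V
    using F0 that by auto
  \<comment> \<open>Admissible constants for coordinate i on \<open>F\<close>; since
    \<open>F\<close> lies in a member of \<open>\<G>\<close>, an interval of them exists.\<close>
  define S where "S i F = {t. t \<in> {0..1} \<and> (\<forall>x\<in>F. \<bar>t - g i x\<bar> \<le> \<alpha> x)}" for i F
  have infS: "infinite (S i F)" if i: "i < N" and F': "F \<in> \<F> i V" for i V F
  proof -
    obtain G where "G \<in> \<G>" "F \<subseteq> G"
      using F(4)[OF i, of V] F' unfolding refines_def by blast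
    moreover obtain a b where "0 \<le> a" "a < b" "b \<le> 1" "\<forall>x\<in>G. \<forall>t\<in>{a<..<b}. \<bar>t - g i x\<bar> \<le> \<alpha> x"
      using Gg[OF \<open>G \<in> \<G>\<close> i] by blast
    ultimately have "{a<..<b} \<subseteq> S i F" "infinite {a<..<b}"
      by (auto simp: S_def)
    then show ?thesis
      using finite_subset by blast
  qed
  have "\<forall>i V. \<exists>c. i < N \<longrightarrow> inj_on c (\<F> i V) \<and> (\<forall>F\<in>\<F> i V. c F \<in> S i F)"
  proof (intro allI)
    fix i V
    show "\<exists>c. i < N \<longrightarrow> inj_on c (\<F> i V) \<and> (\<forall>F\<in>\<F> i V. c F \<in> S i F)"
    proof (cases "i < N")
      case True
      then show ?thesis
        using exists_inj_choice[of "\<F> i V" "S i"] F(1) infS by blast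
    qed simp
  qed
  then obtain c where c0: "\<forall>i V. i < N \<longrightarrow> inj_on (c i V) (\<F> i V) \<and> (\<forall>F\<in>\<F> i V. c i V F \<in> S i F)"
    by metis
  have c: "inj_on (c i V) (\<F> i V)" "\<And>F. F \<in> \<F> i V \<Longrightarrow> c i V F \<in> S i F" if "i < N" for i V
    using c0 that by auto
  have "\<exists>g'. continuous_map X euclideanreal g' \<and>
     (\<forall>x\<in>topspace X. g' x \<in> {0..1} \<and> \<bar>g i x - g' x\<bar> \<le> \<alpha> x) \<and>
     (\<forall>V\<in>\<D> i. \<forall>F\<in>\<F> i V. \<forall>x\<in>F. f x \<in> V \<longrightarrow> g' x = c i V F)" if i: "i < N" for i
  proof (rule extend_locally_constant_approximation[where \<D> = "\<D> i" and \<F> = "\<F> i" and c = "c i" and g = "g i", OF X(1) fc])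
    show "closedin Y V" if "V \<in> \<D> i" for V
      using D(1)[OF i that] .
    show "finite (\<F> i V)" "pairwise disjnt (\<F> i V)" for V
      using F(1,2)[OF i] by auto
    show "closedin X F" if "F \<in> \<F> i V" for V F
      using F(3)[OF i that] .
    show "c i V F \<in> {0..1}" if "F \<in> \<F> i V" for V F
      using c(2)[OF i that] by (simp add: S_def)
    show "\<bar>c i V F - g i x\<bar> \<le> \<alpha> x" if "F \<in> \<F> i V" "x \<in> F" for V F x
      using c(2)[OF i that(1)] that(2) by (simp add: S_def)
    show "g i x \<in> {0..1}" if "x \<in> topspace X" for x
      using g(2)[OF i that] .
    show "0 < \<alpha> x" if "x \<in> topspace X" for x
      using \<alpha>(2)[OF that] .
  qed (rule D(2,3)[OF i] g(1)[OF i] \<alpha>(1))+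
  then have "\<forall>i\<in>{..<N}. \<exists>u. continuous_map X euclideanreal u \<and>
     (\<forall>x\<in>topspace X. u x \<in> {0..1} \<and> \<bar>g i x - u x\<bar> \<le> \<alpha> x) \<and>
     (\<forall>V\<in>\<D> i. \<forall>F\<in>\<F> i V. \<forall>x\<in>F. f x \<in> V \<longrightarrow> u x = c i V F)"
    by simp
  then obtain g' where "\<forall>i\<in>{..<N}. continuous_map X euclideanreal (g' i) \<and>
     (\<forall>x\<in>topspace X. g' i x \<in> {0..1} \<and> \<bar>g i x - g' i x\<bar> \<le> \<alpha> x) \<and>
     (\<forall>V\<in>\<D> i. \<forall>F\<in>\<F> i V. \<forall>x\<in>F. f x \<in> V \<longrightarrow> g' i x = c i V F)"
    by (rule bchoice[THEN exE])
  then have g': "\<forall>i<N. continuous_map X euclideanreal (g' i) \<and>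
     (\<forall>x\<in>topspace X. g' i x \<in> {0..1} \<and> \<bar>g i x - g' i x\<bar> \<le> \<alpha> x) \<and>
     (\<forall>V\<in>\<D> i. \<forall>F\<in>\<F> i V. \<forall>x\<in>F. f x \<in> V \<longrightarrow> g' i x = c i V F)"
    by simp
  have "mdist M (h x) (h x') < r"
    if x: "x \<in> topspace X" "x' \<in> topspace X" "f x = f x'" "\<forall>i<N. g' i x = g' i x'" for x x'
  proof -
    have y: "f x \<in> topspace Y"
      using x(1) fc continuous_map_image_subset_topspace by blast
    \<comment> \<open>The choice depends only on \<open>f x\<close>, so both points are measured
      against the same local family \<open>ch p W\<close>.\<close>
    obtain p W where p: "p < m + 1" and W: "W \<in> E p" "f x \<in> W"
      using Ecov[OF y] by blast
    have fxc: "f x \<in> fst (ch p W)"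
      using U(2)[OF p W(1)] ch(2)[OF p W(1)] W(2) by blast
    define B1 where "B1 = {i. i < N \<and> f x \<notin> \<Union>(\<D> i)}"
    define B2 where "B2 z = {i. i < N \<and> z \<notin> \<Union>(snd (ch p W) i)}" for z
    have "card (B2 z) \<le> n" if "z \<in> topspace X" "f z = f x" for z
      using C(2)[OF p ch(1)[OF p W(1)]] fxc that unfolding B2_def by simp
    then have "card (B2 x) \<le> n" "card (B2 x') \<le> n"
      using x by auto
    moreover have "card B1 \<le> m"
      using Dcard y by (simp add: B1_def)
    \<comment> \<open>At most m coordinates are not prescribed over \<open>f x\<close> and at most n
      fail to cover each of the two points; 2 n + m < N leaves one coordinate with none of these
      defects.\<close>
    ultimately have "card (B1 \<union> B2 x \<union> B2 x') < N"
      using card_Un_le[of "B1 \<union> B2 x" "B2 x'"] card_Un_le[of B1 "B2 x"] N by linarith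
    moreover have "B1 \<union> B2 x \<union> B2 x' \<subseteq> {..<N}"
      by (auto simp: B1_def B2_def)
    ultimately obtain i where i: "i < N" "i \<notin> B1" "i \<notin> B2 x" "i \<notin> B2 x'"
      by (metis UnCI card_lessThan lessThan_iff order_less_irrefl subsetI subset_antisym)
    obtain V where V: "V \<in> \<D> i" "f x \<in> V"
      using i by (auto simp: B1_def)
    have pV: "p \<in> P V"
      using p W V by (auto simp: P_def)
    then have "w V p = W"
      using Duniq[OF i(1) V(1) p w(1)[OF pV] W(1) w(2)[OF pV]] W(2) V(2) by blast
    then have ref: "refines (snd (ch p W) i) (\<F> i V)"
      using F(5)[OF i(1) pV] by simp
    have inF: "\<exists>F\<in>\<F> i V. z \<in> F" if "i \<notin> B2 z" for z
      using that i(1) ref unfolding B2_def refines_def by blast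
    obtain F1 F2 where FF: "F1 \<in> \<F> i V" "x \<in> F1" "F2 \<in> \<F> i V" "x' \<in> F2"
      using inF[OF i(3)] inF[OF i(4)] by blast
    have "c i V F1 = g' i x"
      using g' i(1) V FF(1,2) by simp
    moreover have "c i V F2 = g' i x'"
      using g' i(1) V FF(3,4) x(3) by simp
    ultimately have "F1 = F2"
      using c(1)[OF i(1)] FF(1,3) x(4) i(1) by (simp add: inj_on_def)
    moreover obtain G where "G \<in> \<G>" "F1 \<subseteq> G"
      using F(4)[OF i(1), of V] FF(1) unfolding refines_def by blast
    ultimately show ?thesis
      using Gh FF by blast
  qed
  then show ?thesis
    using g' by (intro exI[of _ g']) auto
qed


section \<open>Density\<close>

lemma continuous_map_cube_iff:
  "continuous_map X (mtopology_of (cube_metric k)) g \<longleftrightarrow>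
     (\<forall>i. continuous_map X euclideanreal (\<lambda>x. g x i)) \<and> (\<forall>x\<in>topspace X. g x \<in> cube k)"
proof -
  have "{x. \<forall>i\<ge>k. x i = 0} \<inter> cube k = cube k"
    by (auto simp: cube_def)
  then have "mtopology_of (cube_metric k) = subtopology (powertop_real UNIV) (cube k)"
    by (simp add: mtopology_of_cube_metric Euclidean_space_def subtopology_subtopology)
  then show ?thesis
    by (auto simp: continuous_map_in_subtopology continuous_map_componentwise_UNIV)
qed

lemma continuous_map_hilbert_cube_iff:
  "continuous_map X (mtopology_of hilbert_cube_metric) g \<longleftrightarrow>
     (\<forall>i. continuous_map X euclideanreal (\<lambda>x. g x i)) \<and> (\<forall>x\<in>topspace X. \<forall>i. g x i \<in> {0..1})"
  unfolding mtopology_of_hilbert_cube_metric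
  by (auto simp: continuous_map_in_subtopology continuous_map_componentwise_UNIV)

lemma mcomplete_of_cube_metric: "mcomplete_of (cube_metric k)"
proof -
  interpret M: Metric_space "cube k" "\<lambda>x y. L2_set (\<lambda>i. x i - y i) {..<k}"
    by (rule Metric_space_cube)
  have eq: "cube k = PiE UNIV (\<lambda>i. if i < k then {0..1::real} else {0})"
  proof (intro set_eqI iffI)
    fix x assume x: "x \<in> PiE UNIV (\<lambda>i. if i < k then {0..1::real} else {0})"
    have "x i \<in> (if i < k then {0..1::real} else {0})" for i
      using x by blast
    then have "i < k \<Longrightarrow> x i \<in> {0..1}" "\<not> i < k \<Longrightarrow> x i = 0" for i
      by (metis, metis singletonD)
    then show "x \<in> cube k"
      by (simp add: cube_def)
  qed (auto simp: cube_def)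
  have "compactin (powertop_real UNIV) (PiE UNIV (\<lambda>i. if i < k then {0..1::real} else {0}))"
    by (simp add: compactin_PiE)
  then have "compact_space (subtopology (powertop_real UNIV) (cube k))"
    unfolding eq by (rule compact_space_subtopology)
  moreover have "{x. \<forall>i\<ge>k. x i = 0} \<inter> cube k = cube k"
    by (auto simp: cube_def)
  ultimately have "compact_space M.mtopology"
    using mtopology_of_cube_metric[of k]
    by (simp add: cube_metric_def Euclidean_space_def subtopology_subtopology)
  then have "M.mcomplete"
    by (rule M.compact_space_imp_mcomplete)
  then show ?thesis
    by (simp add: cube_metric_def)
qed

lemma cube_approximation:
  fixes X :: "'a topology" and Y :: "'b topology" and n m N :: nat
  assumes X: "normal_space X" "Hausdorff_space X" and Y: "paracompact_space Y" and f: "perfect_map X Y f"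
    and dimf: "map_dim_le X Y f n" and dimY: "covering_dim_le Y m" and N: "2 * n + m < N"
    and h: "continuous_map X (mtopology_of M) h" and r: "0 < r"
    and g: "g \<in> map_space X (mtopology_of (cube_metric N))"
    and \<alpha>: "continuous_map X euclideanreal \<alpha>" "\<forall>x\<in>topspace X. 0 < \<alpha> x"
  shows "fibre_small_maps X (mtopology_of (cube_metric N)) M f h r \<inter> sl_cball X (cube_metric N) g \<alpha> \<noteq> {}"
proof -
  have gc: "continuous_map X euclideanreal (\<lambda>x. g x i)" for i
    using g by (simp add: map_space_def continuous_map_cube_iff)
  have gcube: "g x \<in> cube N" if "x \<in> topspace X" for x
    using g that by (simp add: map_space_def continuous_map_cube_iff)
  have gr: "g x i \<in> {0..1}" if "i < N" "x \<in> topspace X" for i x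
    using gcube[OF that(2)] that(1) by (simp add: cube_def)
  have Npos: "0 < real N"
    using N by simp
  \<comment> \<open>The Euclidean distance is at most the sum of the N coordinate distances, so each
    coordinate receives an equal share of \<open>\<alpha>\<close>.\<close>
  have \<beta>: "continuous_map X euclideanreal (\<lambda>x. \<alpha> x / real N)"
    using \<alpha>(1) Npos by (intro continuous_intros) auto
  have "\<exists>u. (\<forall>i<N. continuous_map X euclideanreal (u i) \<and>
       (\<forall>x\<in>topspace X. u i x \<in> {0..1} \<and> \<bar>g x i - u i x\<bar> \<le> \<alpha> x / real N)) \<and>
     (\<forall>x\<in>topspace X. \<forall>x'\<in>topspace X. f x = f x' \<and> (\<forall>i<N. u i x = u i x') \<longrightarrow> mdist M (h x) (h x') < r)"
    by (rule coordinatewise_approximation[OF X Y f dimf dimY N h r gc gr \<beta>]) (use \<alpha>(2) Npos in auto)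
  then obtain u where u: "\<forall>i<N. continuous_map X euclideanreal (u i) \<and>
       (\<forall>x\<in>topspace X. u i x \<in> {0..1} \<and> \<bar>g x i - u i x\<bar> \<le> \<alpha> x / real N)"
     "\<forall>x\<in>topspace X. \<forall>x'\<in>topspace X. f x = f x' \<and> (\<forall>i<N. u i x = u i x') \<longrightarrow> mdist M (h x) (h x') < r"
    by (elim exE conjE)
  define G where "G = restrict (\<lambda>x i. if i < N then u i x else 0) (topspace X)"
  have Gx: "G x i = (if i < N then u i x else 0)" if "x \<in> topspace X" for x i
    using that by (simp add: G_def)
  have "continuous_map X euclideanreal (\<lambda>x. G x i)" for i
  proof (rule continuous_map_eq)
    show "continuous_map X euclideanreal (if i < N then u i else (\<lambda>x. 0))"
      using u(1) by auto
    show "(if i < N then u i else (\<lambda>x. 0)) x = G x i" if "x \<in> topspace X" for x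
      using Gx[OF that] by simp
  qed
  moreover have "G x \<in> cube N" if "x \<in> topspace X" for x
    using u(1) Gx[OF that] that by (auto simp: cube_def)
  ultimately have "G \<in> map_space X (mtopology_of (cube_metric N))"
    by (simp add: map_space_def continuous_map_cube_iff) (simp add: G_def)
  moreover have "mdist M (h x) (h x') < r" if "x \<in> topspace X" "x' \<in> topspace X" "f x = f x'" "G x = G x'" for x x'
  proof -
    have "u i x = u i x'" if "i < N" for i
      using fun_cong[OF \<open>G x = G x'\<close>, of i] Gx[OF \<open>x \<in> topspace X\<close>] Gx[OF \<open>x' \<in> topspace X\<close>] that by simp
    then show ?thesis
      using u(2) that by blast
  qed
  moreover have "mdist (cube_metric N) (g x) (G x) \<le> \<alpha> x" if x: "x \<in> topspace X" for x
  proof -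
    have "L2_set (\<lambda>i. g x i - G x i) {..<N} \<le> (\<Sum>i<N. \<bar>g x i - G x i\<bar>)"
      by (rule L2_set_le_sum_abs)
    also have "\<dots> \<le> (\<Sum>i<N. \<alpha> x / real N)"
      using u(1) x Gx[OF x] by (intro sum_mono) auto
    also have "\<dots> = \<alpha> x"
      using Npos by simp
    finally show ?thesis
      by simp
  qed
  ultimately have "G \<in> fibre_small_maps X (mtopology_of (cube_metric N)) M f h r \<inter> sl_cball X (cube_metric N) g \<alpha>"
    by (simp add: fibre_small_maps_def sl_cball_def)
  then show ?thesis
    by blast
qed

text \<open>Blending the coordinates of \<open>h\<close> into the far coordinates of \<open>g\<close>, with every coordinate of \<open>h\<close>
  occurring infinitely often, costs little in the metric and makes the result determine \<open>h\<close>.\<close>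

lemma hilbert_cube_approximation:
  fixes X :: "'a topology"
  assumes h: "continuous_map X (mtopology_of hilbert_cube_metric) h"
    and g: "g \<in> map_space X (mtopology_of hilbert_cube_metric)"
    and \<alpha>: "continuous_map X euclideanreal \<alpha>" "\<forall>x\<in>topspace X. 0 < \<alpha> x"
  shows "\<exists>g'\<in>sl_cball X hilbert_cube_metric g \<alpha>. \<forall>x\<in>topspace X. \<forall>x'\<in>topspace X. g' x = g' x' \<longrightarrow> h x = h x'"
proof -
  have gc: "continuous_map X euclideanreal (\<lambda>x. g x i)" for i
    using g by (simp add: map_space_def continuous_map_hilbert_cube_iff)
  have gr: "0 \<le> g x i" "g x i \<le> 1" if "x \<in> topspace X" for x i
    using g that by (auto simp: map_space_def continuous_map_hilbert_cube_iff)
  have hc: "continuous_map X euclideanreal (\<lambda>x. h x i)" for i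
    using h by (simp add: continuous_map_hilbert_cube_iff)
  have hr: "0 \<le> h x i" "h x i \<le> 1" if "x \<in> topspace X" for x i
    using h that by (auto simp: continuous_map_hilbert_cube_iff)
  \<comment> \<open>The metric gives coordinate \<open>from_nat n\<close> the factor (1/2)^n.
    Measuring \<open>w\<close> by the same enumeration makes it unbounded, yet growing too slowly to
    spoil the convergence of the weighted sum.\<close>
  define w where "w i = real (to_nat (i :: nat))" for i
  \<comment> \<open>Outside the range of \<open>to_nat\<close>, \<open>from_nat\<close> returns the
    unspecified value \<open>SOME i. False\<close>; \<open>c\<close> accounts for its
    weight.\<close>
  define c where "c = w (SOME i. False)"
  have wn: "w (from_nat n) \<le> real n + c" for n
  proof (cases "n \<in> range (to_nat :: nat \<Rightarrow> nat)")
    case True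
    then show ?thesis
      by (auto simp: w_def c_def)
  next
    case False
    then have "(\<lambda>x::nat. to_nat x = n) = (\<lambda>x. False)"
      by auto
    then show ?thesis
      by (simp add: from_nat_def inv_def c_def)
  qed
  have w0: "0 \<le> w i" for i
    by (simp add: w_def)
  have "summable (\<lambda>n. real (Suc n) * (1/2) ^ n)"
    using geometric_deriv_sums[of "1/2 :: real"] by (auto simp: sums_iff)
  then have sum1: "summable (\<lambda>n. (c + 1) * (real (Suc n) * (1/2) ^ n))"
    by (rule summable_mult)
  have sumw: "summable (\<lambda>n. (1/2) ^ n * w (from_nat n))"
  proof (rule summable_comparison_test'[OF sum1])
    fix n :: nat
    have "0 \<le> c"
      by (simp add: c_def w0)
    then have "0 \<le> c * real n"
      by simp
    then have "w (from_nat n) \<le> (c + 1) * real (Suc n)"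
      using wn[of n] by (simp add: algebra_simps)
    then have "(1/2) ^ n * w (from_nat n) \<le> (1/2) ^ n * ((c + 1) * real (Suc n))"
      by (rule mult_left_mono) simp
    then show "norm ((1/2) ^ n * w (from_nat n)) \<le> (c + 1) * (real (Suc n) * (1/2) ^ n)"
      using w0[of "from_nat n"] by (simp add: abs_mult mult_ac)
  qed
  \<comment> \<open>Normalises the total displacement to at most \<open>\<alpha>\<close>; the
    summand 1 makes it positive.\<close>
  define K where "K = (\<Sum>n. (1/2) ^ n * w (from_nat n)) + 1"
  have K: "0 < K" "(\<Sum>n. (1/2) ^ n * w (from_nat n)) \<le> K"
    using suminf_nonneg[OF sumw] w0 by (auto simp: K_def)
  \<comment> \<open>The blending coefficient: small on coordinates of small weight, and exactly 1
    once the weight reaches \<open>K / \<alpha> x\<close>, so that far coordinates reproduce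
    \<open>h\<close> itself.\<close>
  define l where "l i x = min 1 (w i * (\<alpha> x / K))" for i x
  have lc: "continuous_map X euclideanreal (l i)" for i
    unfolding l_def using \<alpha>(1) K(1) by (intro continuous_intros) auto
  have l01: "0 \<le> l i x" "l i x \<le> 1" if "x \<in> topspace X" for i x
  proof -
    have "0 \<le> \<alpha> x / K"
      using \<alpha>(2) K(1) that by (simp add: less_imp_le)
    then have "0 \<le> w i * (\<alpha> x / K)"
      using w0 by (rule mult_nonneg_nonneg[rotated])
    then show "0 \<le> l i x" "l i x \<le> 1"
      by (simp_all add: l_def)
  qed
  \<comment> \<open>The pairing function makes every index k equal to \<open>j i\<close> for
    infinitely many i.\<close>
  define j where "j i = fst (prod_decode i)" for i
  define G where "G = restrict (\<lambda>x i. (1 - l i x) * g x i + l i x * h x (j i)) (topspace X)"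
  have Gx: "G x i = (1 - l i x) * g x i + l i x * h x (j i)" if "x \<in> topspace X" for x i
    using that by (simp add: G_def)
  have "continuous_map X euclideanreal (\<lambda>x. G x i)" for i
  proof (rule continuous_map_eq)
    show "continuous_map X euclideanreal (\<lambda>x. (1 - l i x) * g x i + l i x * h x (j i))"
      by (intro continuous_intros lc gc hc) auto
  qed (simp add: Gx)
  moreover have "G x i \<in> {0..1}" if x: "x \<in> topspace X" for x i
  proof -
    have "(1 - l i x) * g x i + l i x * h x (j i) \<le> (1 - l i x) * 1 + l i x * 1"
      using l01[OF x, of i] gr[OF x] hr[OF x] by (intro add_mono mult_left_mono) auto
    then show ?thesis
      using l01[OF x, of i] gr[OF x] hr[OF x] by (simp add: Gx[OF x])
  qed
  ultimately have Gm: "G \<in> map_space X (mtopology_of hilbert_cube_metric)"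
    by (simp add: map_space_def continuous_map_hilbert_cube_iff) (simp add: G_def)
  have Gd: "mdist hilbert_cube_metric (g x) (G x) \<le> \<alpha> x" if x: "x \<in> topspace X" for x
  proof -
    have le: "(1/2) ^ n * min (dist (g x (from_nat n)) (G x (from_nat n))) 1 \<le> (\<alpha> x / K) * ((1/2) ^ n * w (from_nat n))" for n
    proof -
      define i :: nat where "i = from_nat n"
      have "g x i - G x i = l i x * (g x i - h x (j i))"
        by (simp add: Gx[OF x] algebra_simps)
      then have "dist (g x i) (G x i) = l i x * \<bar>g x i - h x (j i)\<bar>"
        using l01[OF x, of i] by (simp add: dist_real_def abs_mult)
      also have "\<dots> \<le> l i x * 1"
        using l01[OF x, of i] gr[OF x, of i] hr[OF x, of "j i"] by (intro mult_left_mono) auto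
      also have "\<dots> \<le> w i * (\<alpha> x / K)"
        by (simp add: l_def)
      finally have "min (dist (g x i) (G x i)) 1 \<le> w i * (\<alpha> x / K)"
        by simp
      then have "(1/2) ^ n * min (dist (g x i) (G x i)) 1 \<le> (1/2) ^ n * (w i * (\<alpha> x / K))"
        by (rule mult_left_mono) simp
      then show ?thesis
        by (simp add: i_def mult_ac)
    qed
    have "dist (g x) (G x) \<le> (\<Sum>n. (\<alpha> x / K) * ((1/2) ^ n * w (from_nat n)))"
      unfolding dist_fun_def
    proof (rule suminf_le[OF le])
      show "summable (\<lambda>n. (\<alpha> x / K) * ((1/2) ^ n * w (from_nat n)))"
        by (rule summable_mult[OF sumw])
      then show "summable (\<lambda>n. (1/2) ^ n * min (dist (g x (from_nat n)) (G x (from_nat n))) 1)"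
        by (rule summable_comparison_test'[where N = 0]) (use le in auto)
    qed
    also have "\<dots> = (\<alpha> x / K) * (\<Sum>n. (1/2) ^ n * w (from_nat n))"
      by (rule suminf_mult[OF sumw])
    also have "\<dots> \<le> (\<alpha> x / K) * K"
      using K \<alpha>(2) x by (intro mult_left_mono) auto
    also have "\<dots> = \<alpha> x"
      using K(1) by simp
    finally show ?thesis
      by (simp add: hilbert_cube_metric_def)
  qed
  have Gh: "h x = h x'" if x: "x \<in> topspace X" "x' \<in> topspace X" "G x = G x'" for x x'
  proof
    fix k
    \<comment> \<open>The threshold past which coordinates are fully blended depends on the point;
      one bound serves both points, so a common coordinate shows \<open>h\<close> at each.\<close>
    obtain B :: nat where B: "K / \<alpha> x < real B" "K / \<alpha> x' < real B"
      using reals_Archimedean2[of "max (K / \<alpha> x) (K / \<alpha> x')"] by auto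
    have "finite {i :: nat. to_nat i < B}"
      using finite_vimageI[of "{..<B}" "to_nat :: nat \<Rightarrow> nat"] by (simp add: vimage_def)
    moreover have "infinite (range (\<lambda>t. prod_encode (k, t)))"
      by (rule range_inj_infinite) (simp add: inj_on_def)
    ultimately obtain t where t: "\<not> to_nat (prod_encode (k, t)) < B"
      by (metis (mono_tags, lifting) finite_subset image_subsetI mem_Collect_eq)
    define i where "i = prod_encode (k, t)"
    have "real B \<le> w i"
      using t by (simp add: i_def w_def)
    then have "K / \<alpha> x < w i" "K / \<alpha> x' < w i"
      using B by auto
    then have "1 \<le> w i * (\<alpha> x / K)" "1 \<le> w i * (\<alpha> x' / K)"
      using K(1) \<alpha>(2) x by (auto simp: field_simps)
    then have "l i x = 1" "l i x' = 1"
      by (auto simp: l_def)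
    moreover have "j i = k"
      by (simp add: i_def j_def)
    ultimately have "G x i = h x k" "G x' i = h x' k"
      using x(1,2) by (simp_all add: Gx)
    then show "h x k = h x' k"
      using x(3) by simp
  qed
  have "G \<in> sl_cball X hilbert_cube_metric g \<alpha>"
    using Gm Gd by (simp add: sl_cball_def)
  then show ?thesis
    using Gh by blast
qed

theorem theorem1p1:
  fixes X :: "'a topology" and Y :: "'b topology" and f :: "'a \<Rightarrow> 'b"
  assumes "paracompact_space X" and "paracompact_space Y"
    and "perfect_map X Y f"
    and "countable_functional_weight X Y f"
  shows "(\<forall>n m :: nat. map_dim_le X Y f n \<and> covering_dim_le Y m \<longrightarrow>
            dense_gdelta_in
              (source_limitation_topology X (cube_metric (2 * n + 1 + m)))
              (embedding_maps X Y (mtopology_of (cube_metric (2 * n + 1 + m))) f))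
       \<and> (C_space Y \<longrightarrow>
            dense_gdelta_in
              (source_limitation_topology X hilbert_cube_metric)
              (embedding_maps X Y (mtopology_of hilbert_cube_metric) f))"
proof -
  have X: "normal_space X" "Hausdorff_space X" and Y: "Hausdorff_space Y"
    using assms(1,2) paracompact_imp_normal_space by (auto simp: paracompact_space_def)
  let ?Q = hilbert_cube_metric
  obtain h where h: "continuous_map X (mtopology_of ?Q) h"
    and emb: "embedding_map X (prod_topology Y (mtopology_of ?Q)) (diag_map f h)"
    using assms(4) by (auto simp: countable_functional_weight_def)
  let ?S = "\<lambda>Z k. fibre_small_maps X (mtopology_of Z) ?Q f h (1 / Suc k)"
  have Haus: "Hausdorff_space (mtopology_of Z)" for Z :: "(nat \<Rightarrow> real) metric"
    by (simp add: mtopology_of_def Metric_space.Hausdorff_space_mtopology)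
  have eq: "embedding_maps X Y (mtopology_of Z) f = (\<Inter>k. ?S Z k)" for Z :: "(nat \<Rightarrow> real) metric"
    by (rule embedding_maps_eq_fibre_small_maps[OF Y assms(3) h emb Haus])
  have gdelta: "gdelta_in (source_limitation_topology X Z) (embedding_maps X Y (mtopology_of Z) f)"
    for Z :: "(nat \<Rightarrow> real) metric"
    unfolding eq by (rule gdelta_in_source_limitation_topology[OF assms(2,3) h])
  have sub: "(\<Inter>k. ?S Z k) \<subseteq> map_space X (mtopology_of Z)" for Z :: "(nat \<Rightarrow> real) metric"
    by (auto simp: fibre_small_maps_def)
  show ?thesis
  proof (intro conjI allI impI)
    fix n m assume dim: "map_dim_le X Y f n \<and> covering_dim_le Y m"
    let ?Z = "cube_metric (2 * n + 1 + m)"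
    have "source_limitation_topology X ?Z closure_of (\<Inter>k. ?S ?Z k) = topspace (source_limitation_topology X ?Z)"
    proof (rule dense_in_source_limitation_topology[OF sub])
      fix g \<alpha> assume g: "g \<in> map_space X (mtopology_of ?Z)"
        and \<alpha>: "continuous_map X euclideanreal \<alpha>" "\<forall>x\<in>topspace X. 0 < \<alpha> x"
      show "(\<Inter>k. ?S ?Z k) \<inter> sl_cball X ?Z g \<alpha> \<noteq> {}"
      proof (rule source_limitation_Baire[OF mcomplete_of_cube_metric _ _ g \<alpha>])
        show "\<exists>\<alpha>. continuous_map X euclideanreal \<alpha> \<and> (\<forall>x\<in>topspace X. 0 < \<alpha> x) \<and> sl_cball X ?Z g \<alpha> \<subseteq> ?S ?Z k"
          if "g \<in> ?S ?Z k" for k g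
          by (rule fibre_small_maps_open[OF assms(2,3) h that])
        show "?S ?Z k \<inter> sl_cball X ?Z g \<alpha> \<noteq> {}"
          if "g \<in> map_space X (mtopology_of ?Z)" "continuous_map X euclideanreal \<alpha>" "\<forall>x\<in>topspace X. 0 < \<alpha> x" for k g \<alpha>
          by (rule cube_approximation[OF X assms(2,3) _ _ _ h _ that]) (use dim in auto)
      qed
    qed
    then show "dense_gdelta_in (source_limitation_topology X ?Z) (embedding_maps X Y (mtopology_of ?Z) f)"
      using gdelta unfolding dense_gdelta_in_def by (simp add: eq)
  next
    have "source_limitation_topology X ?Q closure_of (\<Inter>k. ?S ?Q k) = topspace (source_limitation_topology X ?Q)"
    proof (rule dense_in_source_limitation_topology[OF sub])
      fix g \<alpha> assume g: "g \<in> map_space X (mtopology_of ?Q)"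
        and \<alpha>: "continuous_map X euclideanreal \<alpha>" "\<forall>x\<in>topspace X. 0 < \<alpha> x"
      \<comment> \<open>A single map that determines \<open>h\<close> lies in all the sets of the
        intersection at once.\<close>
      obtain g' where g': "g' \<in> sl_cball X ?Q g \<alpha>" "\<forall>x\<in>topspace X. \<forall>x'\<in>topspace X. g' x = g' x' \<longrightarrow> h x = h x'"
        using hilbert_cube_approximation[OF h g \<alpha>] by blast
      have "mdist ?Q (h x) (h x') = 0" if "x \<in> topspace X" "x' \<in> topspace X" "g' x = g' x'" for x x'
      proof -
        have "h x = h x'"
          using g'(2) that by blast
        then show ?thesis
          by (simp add: hilbert_cube_metric_def)
      qed
      then have "g' \<in> (\<Inter>k. ?S ?Q k)"
        using g'(1) by (simp add: fibre_small_maps_def sl_cball_def)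
      then show "(\<Inter>k. ?S ?Q k) \<inter> sl_cball X ?Q g \<alpha> \<noteq> {}"
        using g'(1) by blast
    qed
    then show "dense_gdelta_in (source_limitation_topology X ?Q) (embedding_maps X Y (mtopology_of ?Q) f)"
      using gdelta unfolding dense_gdelta_in_def by (simp add: eq)
  qed
qed

end
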